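(* Let $I\subset\mathbb{R}$ be an open interval, $(F,g_F)$ a pseudo-Riemannian manifold with $\dim F=l=3$, $f:I\to(0,\infty)$ smooth, and let $M=I\times F$ carry the metric $g=-dt^2+f(t)^2g_F$. Let $\lambda_1,\lambda_2$ be nonzero real constants, $P=\frac{\partial}{\partial t}$, and let $\overline\nabla$ be the quarter-symmetric connection on $M$ determined by $P,\lambda_1,\lambda_2$. Put $v(t)=f(t)^2$. Then $(M,\overline\nabla)$ has constant scalar curvature $\overline S$ if and only if $(F,\nabla^F)$ has constant scalar curvature $S^F$ and one of the following holds for some real constants $c_1,c_2$: (1) $\overline S<\frac{27}{16}(\lambda_1+\lambda_2)^2+3\lambda_1^2+3\lambda_2^2-12\lambda_1\lambda_2$, $\overline S\neq3\lambda_1^2+3\lambda_2^2-12\lambda_1\lambda_2$, and $$v(t)=c_1e^{\frac12\left(\frac32(\lambda_1+\lambda_2)+\sqrt{D}\right)t}+c_2e^{\frac12\left(\frac32(\lambda_1+\lambda_2)-\sqrt{D}\right)t}+\frac{S^F}{12\lambda_1\lambda_2-3\lambda_1^2-3\lambda_2^2+\overline S},$$ where $D=\frac94(\lambda_1+\lambda_2)^2-\frac43\overline S+4\lambda_1^2+4\lambda_2^2-16\lambda_1\lambda_2$; (2) $\overline S=\frac{27}{16}(\lambda_1+\lambda_2)^2+3\lambda_1^2+3\lambda_2^2-12\lambda_1\lambda_2$, and $$v(t)=c_1e^{\frac34(\lambda_1+\lambda_2)t}+c_2te^{\frac34(\lambda_1+\lambda_2)t}+\frac{S^F}{12\lambda_1\lambda_2-3\lambda_1^2-3\lambda_2^2+\overline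 S};$$ (3) $\overline S>\frac{27}{16}(\lambda_1+\lambda_2)^2+3\lambda_1^2+3\lambda_2^2-12\lambda_1\lambda_2$, and $$v(t)=c_1e^{\frac34(\lambda_1+\lambda_2)t}\cos\left(\tfrac12\sqrt{-D}\,t\right)+c_2e^{\frac34(\lambda_1+\lambda_2)t}\sin\left(\tfrac12\sqrt{-D}\,t\right)+\frac{S^F}{12\lambda_1\lambda_2-3\lambda_1^2-3\lambda_2^2+\overline S},$$ where $-D=\frac43\overline S-4\lambda_1^2-4\lambda_2^2+16\lambda_1\lambda_2-\frac94(\lambda_1+\lambda_2)^2$; (4) $\overline S=3\lambda_1^2+3\lambda_2^2-12\lambda_1\lambda_2$, $\lambda_1+\lambda_2\neq0$, and $v(t)=c_1-\frac{2S^F}{9(\lambda_1+\lambda_2)}t+c_2e^{\frac32(\lambda_1+\lambda_2)t}$; (5) $\overline S=3\lambda_1^2+3\lambda_2^2-12\lambda_1\lambda_2$, $\lambda_1+\lambda_2=0$, and $v(t)=\frac{S^F}{6}t^2+c_1t+c_2$.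
   Context: On a pseudo-Riemannian manifold $(M,g)$ with Levi-Civita connection $\nabla$, a vector field $P$, the 1-form $\pi(X)=g(X,P)$ and nonzero real constants $\lambda_1,\lambda_2$, the quarter-symmetric connection is $\overline\nabla_XY=\nabla_XY+\lambda_1\pi(Y)X-\lambda_2g(X,Y)P$. Its curvature is $\overline R(X,Y)=\overline\nabla_X\overline\nabla_Y-\overline\nabla_Y\overline\nabla_X-\overline\nabla_{[X,Y]}$, its Ricci tensor is $\overline{Ric}(X,Y)=\sum_k\varepsilon_k\,g(\overline R(X,E_k)Y,E_k)$ and its scalar curvature is $\overline S=\sum_k\varepsilon_k\overline{Ric}(E_k,E_k)$, where $(E_k)$ is a local orthonormal frame with $g(E_k,E_k)=\varepsilon_k=\pm1$ (note the sign convention). $S^F$ is the scalar curvature of the Levi-Civita connection $\nabla^F$ of $(F,g_F)$, with the same convention.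
   Formalization: In case (2) the formal statement also requires S̄ ≠ 3λ1²+3λ2²−12λ1λ2 (equivalently λ1+λ2 ≠ 0 there), since otherwise the denominator under S^F is zero and the formula is undefined; that situation is covered by case (5). *)

theory Defs
  imports "HOL-Analysis.Analysis" "HOL-Library.Function_Algebras"
begin

section \<open>Smooth manifolds\<close>

text \<open>Derivatives of all orders on an open set: in finite dimensions it suffices that all
  iterated directional derivatives exist and are differentiable.\<close>

primrec times_differentiable_on ::
  "'e::euclidean_space set \<Rightarrow> ('e \<Rightarrow> 'b::real_normed_vector) \<Rightarrow> nat \<Rightarrow> bool" where
  "times_differentiable_on S f 0 \<longleftrightarrow> continuous_on S f"
| "times_differentiable_on S f (Suc n) \<longleftrightarrow>
     (\<forall>x\<in>S. f differentiable (at x)) \<and>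
     (\<forall>v. times_differentiable_on S (\<lambda>x. frechet_derivative f (at x) v) n)"

definition smooth_on ::
  "'e::euclidean_space set \<Rightarrow> ('e \<Rightarrow> 'b::real_normed_vector) \<Rightarrow> bool" where
  "smooth_on S f \<longleftrightarrow> (\<forall>n. times_differentiable_on S f n)"

text \<open>A chart is a pair of its domain and its coordinate map; the values of the coordinate map
  outside the domain are irrelevant.  A manifold is given by an atlas, which need not be maximal;
  its underlying space is the union of the chart domains, an open subset of the ambient type.\<close>

type_synonym ('a, 'e) atlas = "('a set \<times> ('a \<Rightarrow> 'e)) set"

definition carrier :: "('a, 'e) atlas \<Rightarrow> 'a set" where
  "carrier A = (\<Union>(V, \<phi>)\<in>A. V)"

definition smooth_manifold ::
  "('a::{t2_space, second_countable_topology}, 'e::euclidean_space) atlas \<Rightarrow> bool" where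
  "smooth_manifold A \<longleftrightarrow>
     (\<forall>(V, \<phi>)\<in>A. open V \<and> open (\<phi> ` V) \<and> homeomorphism V (\<phi> ` V) \<phi> (inv_into V \<phi>)) \<and>
     (\<forall>(V, \<phi>)\<in>A. \<forall>(W, \<psi>)\<in>A. smooth_on (\<phi> ` (V \<inter> W)) (\<psi> \<circ> inv_into V \<phi>))"

definition smooth_fun ::
  "('a::topological_space, 'e::euclidean_space) atlas \<Rightarrow> 'a set \<Rightarrow> ('a \<Rightarrow> real) \<Rightarrow> bool" where
  "smooth_fun A U h \<longleftrightarrow> (\<forall>(V, \<phi>)\<in>A. smooth_on (\<phi> ` (U \<inter> V)) (h \<circ> inv_into V \<phi>))"

definition smooth_near ::
  "('a::topological_space, 'e::euclidean_space) atlas \<Rightarrow> 'a \<Rightarrow> ('a \<Rightarrow> real) \<Rightarrow> bool" where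
  "smooth_near A p h \<longleftrightarrow> (\<exists>U. open U \<and> p \<in> U \<and> U \<subseteq> carrier A \<and> smooth_fun A U h)"

section \<open>Tangent vectors and vector fields\<close>

text \<open>A tangent vector at \<open>p\<close> is the operation of differentiating functions at \<open>p\<close> along a
  direction \<open>u\<close> of some chart.  It acts on the functions that are smooth near \<open>p\<close>; on all other
  functions its value is fixed to be \<open>0\<close>, so that tangent vectors are equal as HOL functions iff
  they agree on all germs of smooth functions.\<close>

type_synonym 'a tangent = "('a \<Rightarrow> real) \<Rightarrow> real"

definition tangent_space ::
  "('a::topological_space, 'e::euclidean_space) atlas \<Rightarrow> 'a \<Rightarrow> 'a tangent set" where
  "tangent_space A p = {v. \<exists>(V, \<phi>)\<in>A. p \<in> V \<and> (\<exists>u. v = (\<lambda>h.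
     if smooth_near A p h then frechet_derivative (h \<circ> inv_into V \<phi>) (at (\<phi> p)) u else 0))}"

text \<open>Smooth vector fields on an open set \<open>U\<close>.  A vector field is a total function; its values
  outside \<open>U\<close> are irrelevant.\<close>

type_synonym 'a vfield = "'a \<Rightarrow> 'a tangent"

definition vector_fields ::
  "('a::topological_space, 'e::euclidean_space) atlas \<Rightarrow> 'a set \<Rightarrow> 'a vfield set" where
  "vector_fields A U = {X. (\<forall>p\<in>U. X p \<in> tangent_space A p) \<and>
     (\<forall>V h. open V \<and> V \<subseteq> U \<and> smooth_fun A V h \<longrightarrow> smooth_fun A V (\<lambda>p. X p h))}"

definition lie_bracket ::
  "('a::topological_space, 'e::euclidean_space) atlas \<Rightarrow> 'a vfield \<Rightarrow> 'a vfield \<Rightarrow> 'a vfield" where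
  "lie_bracket A X Y = (\<lambda>p h.
     if smooth_near A p h then X p (\<lambda>q. Y q h) - Y p (\<lambda>q. X q h) else 0)"

section \<open>Pseudo-Riemannian metrics, connections and curvature\<close>

type_synonym 'a metric = "'a \<Rightarrow> 'a tangent \<Rightarrow> 'a tangent \<Rightarrow> real"

definition pseudo_riemannian_metric ::
  "('a::topological_space, 'e::euclidean_space) atlas \<Rightarrow> 'a metric \<Rightarrow> bool" where
  "pseudo_riemannian_metric A g \<longleftrightarrow>
     (\<forall>p\<in>carrier A. \<forall>u\<in>tangent_space A p. \<forall>v\<in>tangent_space A p.
        g p u v = g p v u \<and>
        (\<forall>w\<in>tangent_space A p. g p (u + v) w = g p u w + g p v w) \<and>
        (\<forall>c. g p (\<lambda>h. c * u h) v = c * g p u v)) \<and>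
     (\<forall>p\<in>carrier A. \<forall>u\<in>tangent_space A p.
        (\<forall>v\<in>tangent_space A p. g p u v = 0) \<longrightarrow> u = 0) \<and>
     (\<forall>U. open U \<and> U \<subseteq> carrier A \<longrightarrow>
        (\<forall>X\<in>vector_fields A U. \<forall>Y\<in>vector_fields A U. smooth_fun A U (\<lambda>p. g p (X p) (Y p))))"

text \<open>An affine connection acts on the smooth vector fields of every open subset (as one needs
  for local frames).  The axioms force locality: multiplying with the indicator function of a
  smaller open set shows that \<open>D X Y p\<close> depends only on the germs of \<open>X\<close> and \<open>Y\<close> at \<open>p\<close>.\<close>

type_synonym 'a connection = "'a vfield \<Rightarrow> 'a vfield \<Rightarrow> 'a vfield"

definition affine_connection ::
  "('a::topological_space, 'e::euclidean_space) atlas \<Rightarrow> 'a connection \<Rightarrow> bool" where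
  "affine_connection A D \<longleftrightarrow>
     (\<forall>U. open U \<and> U \<subseteq> carrier A \<longrightarrow>
       (\<forall>X\<in>vector_fields A U. \<forall>Y\<in>vector_fields A U.
          D X Y \<in> vector_fields A U \<and>
          (\<forall>Z\<in>vector_fields A U. \<forall>p\<in>U.
             D (X + Y) Z p = D X Z p + D Y Z p \<and> D X (Y + Z) p = D X Y p + D X Z p) \<and>
          (\<forall>f. smooth_fun A U f \<longrightarrow> (\<forall>p\<in>U.
             D (\<lambda>q h. f q * X q h) Y p = (\<lambda>h. f p * D X Y p h) \<and>
             D X (\<lambda>q h. f q * Y q h) p = (\<lambda>h. X p f * Y p h + f p * D X Y p h)))))"

definition levi_civita_connection ::
  "('a::topological_space, 'e::euclidean_space) atlas \<Rightarrow> 'a metric \<Rightarrow> 'a connection \<Rightarrow> bool" where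
  "levi_civita_connection A g D \<longleftrightarrow> affine_connection A D \<and>
     (\<forall>U. open U \<and> U \<subseteq> carrier A \<longrightarrow>
       (\<forall>X\<in>vector_fields A U. \<forall>Y\<in>vector_fields A U. \<forall>p\<in>U.
          D X Y p - D Y X p = lie_bracket A X Y p \<and>
          (\<forall>Z\<in>vector_fields A U.
             X p (\<lambda>q. g q (Y q) (Z q)) = g p (D X Y p) (Z p) + g p (Y p) (D X Z p))))"

definition quarter_symmetric_connection ::
  "'a metric \<Rightarrow> 'a vfield \<Rightarrow> real \<Rightarrow> real \<Rightarrow> 'a connection \<Rightarrow> 'a connection" where
  "quarter_symmetric_connection g P l1 l2 D X Y = (\<lambda>p h.
     D X Y p h + l1 * g p (Y p) (P p) * X p h - l2 * g p (X p) (Y p) * P p h)"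

definition curvature ::
  "('a::topological_space, 'e::euclidean_space) atlas \<Rightarrow> 'a connection \<Rightarrow>
     'a vfield \<Rightarrow> 'a vfield \<Rightarrow> 'a vfield \<Rightarrow> 'a vfield" where
  "curvature A D X Y Z = D X (D Y Z) - D Y (D X Z) - D (lie_bracket A X Y) Z"

definition orthonormal_frame ::
  "('a::topological_space, 'e::euclidean_space) atlas \<Rightarrow> 'a metric \<Rightarrow> 'a set \<Rightarrow>
     (nat \<Rightarrow> real) \<Rightarrow> (nat \<Rightarrow> 'a vfield) \<Rightarrow> bool" where
  "orthonormal_frame A g U \<epsilon> E \<longleftrightarrow> open U \<and> U \<subseteq> carrier A \<and>
     (\<forall>i<DIM('e). \<epsilon> i \<in> {1, -1} \<and> E i \<in> vector_fields A U \<and>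
        (\<forall>j<DIM('e). \<forall>p\<in>U. g p (E i p) (E j p) = (if i = j then \<epsilon> i else 0)))"

text \<open>The Ricci tensor and the scalar curvature at \<open>p\<close> are the common values obtained from all
  local orthonormal frames around \<open>p\<close>.  With the index order below they are the negatives of the
  usual ones (round spheres have negative scalar curvature).\<close>

definition ricci ::
  "('a::topological_space, 'e::euclidean_space) atlas \<Rightarrow> 'a metric \<Rightarrow> 'a connection \<Rightarrow>
     'a vfield \<Rightarrow> 'a vfield \<Rightarrow> 'a \<Rightarrow> real" where
  "ricci A g D X Y p = (THE r. \<exists>U \<epsilon> E. orthonormal_frame A g U \<epsilon> E \<and> p \<in> U \<and>
     r = (\<Sum>k<DIM('e). \<epsilon> k * g p (curvature A D X (E k) Y p) (E k p)))"

definition scalar_curvature ::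
  "('a::topological_space, 'e::euclidean_space) atlas \<Rightarrow> 'a metric \<Rightarrow> 'a connection \<Rightarrow>
     'a \<Rightarrow> real" where
  "scalar_curvature A g D p = (THE s. \<exists>U \<epsilon> E. orthonormal_frame A g U \<epsilon> E \<and> p \<in> U \<and>
     s = (\<Sum>k<DIM('e). \<epsilon> k * ricci A g D (E k) (E k) p))"

definition has_constant_scalar_curvature ::
  "('a::topological_space, 'e::euclidean_space) atlas \<Rightarrow> 'a metric \<Rightarrow> 'a connection \<Rightarrow>
     real \<Rightarrow> bool" where
  "has_constant_scalar_curvature A g D S \<longleftrightarrow> (\<forall>p\<in>carrier A. scalar_curvature A g D p = S)"

section \<open>Warped products with a time interval\<close>

definition interval_times :: "real set \<Rightarrow> ('a, 'e) atlas \<Rightarrow> (real \<times> 'a, real \<times> 'e) atlas" where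
  "interval_times I A = (\<lambda>(V, \<phi>). (I \<times> V, \<lambda>(t, x). (t, \<phi> x))) ` A"

text \<open>The metric \<open>-dt\<^sup>2 + f(t)\<^sup>2 g\<^sub>F\<close>: here \<open>w fst\<close> is \<open>dt(w)\<close>, and \<open>\<lambda>k. w (k \<circ> snd)\<close> is the
  push-forward of \<open>w\<close> along the projection to \<open>F\<close>.\<close>

definition warped_metric :: "(real \<Rightarrow> real) \<Rightarrow> 'a metric \<Rightarrow> (real \<times> 'a) metric" where
  "warped_metric f gF = (\<lambda>(t, x) w w'.
     - (w fst * w' fst) + (f t)\<^sup>2 * gF x (\<lambda>k. w (k \<circ> snd)) (\<lambda>k. w' (k \<circ> snd)))"

definition time_field ::
  "real set \<Rightarrow> ('a::topological_space, 'e::euclidean_space) atlas \<Rightarrow> (real \<times> 'a) vfield" where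
  "time_field I A = (\<lambda>(t, x) h.
     if smooth_near (interval_times I A) (t, x) h then deriv (\<lambda>s. h (s, x)) t else 0)"

end

theory Submission
  imports Defs
begin

text \<open>Curvature is tensorial, so the scalar curvature at a point is the sum over any orthonormal frame.
  On the warped product one takes \<open>\<partial>/\<partial>t\<close> together with \<open>1/f\<close> times the lifts of an orthonormal frame
  of \<open>F\<close>.  The Koszul formula gives the Levi-Civita connection on these fields, hence the
  quarter-symmetric connection and its curvature.  With \<open>v = f\<^sup>2\<close> the result is
  \<open>3v'' - 9/2 (l1 + l2) v' + (S - 3 l1\<^sup>2 - 3 l2\<^sup>2 + 12 l1 l2) v = S\<^sup>F\<close>, where \<open>S\<close> is the scalar curvature at
  \<open>(t, x)\<close> and \<open>S\<^sup>F\<close> that of \<open>F\<close> at \<open>x\<close>.  If \<open>S\<close> is constant, then fixing \<open>t\<close> shows that \<open>S\<^sup>F\<close> is constant,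
  and the equation is a linear equation for \<open>v\<close> with constant coefficients; the five cases are those
  of its characteristic polynomial, whose discriminant is \<open>D\<close>.\<close>

text \<open>\<open>ricci\<close> and \<open>scalar_curvature\<close> are definite descriptions over
  all frames at a point, so a frame has to be constructed and the traces shown to agree for all
  frames before anything can be evaluated. A connection is an operator on total functions whose
  axioms speak of open sets only; locality is extracted by multiplying with the indicator function
  of an open set, which is constant there. Identities between fields hold on
  \<open>I \<times> U\<close> only and enter iterated derivatives through \<open>D_cong\<close>.

  Dimension 3 is what makes the equation linear in \<open>v\<close>. For a fibre of dimension
  \<open>n > 0\<close> the product of the scalar curvature with \<open>f\<^sup>2\<close> contains
  \<open>- 2 n f f''\<close> and \<open>(n - n\<^sup>2) f'\<^sup>2\<close>; these combine to a
  multiple of \<open>v'' = 2 f f'' + 2 f'\<^sup>2\<close> exactly if \<open>n = 3\<close>.\<close>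

section \<open>Calculus of smooth functions\<close>

text \<open>Openness of \<open>S\<close> makes the derivatives of \<open>f\<close> and
  \<open>g\<close> agree at each point of \<open>S\<close>, so the induction can pass to directional
  derivatives.\<close>

lemma times_differentiable_on_cong:
  assumes "open S" "\<And>x. x \<in> S \<Longrightarrow> f x = g x" "times_differentiable_on S f n"
  shows "times_differentiable_on S g n"
  using assms
proof (induction n arbitrary: f g)
  case 0
  then show ?case by (auto cong: continuous_on_cong)
next
  case (Suc n)
  have d: "(g has_derivative frechet_derivative f (at x)) (at x)" if "x \<in> S" for x
    using that Suc.prems has_derivative_transform_within_open[of f _ x UNIV S g]
    by (auto simp: frechet_derivative_works)
  have "times_differentiable_on S (\<lambda>x. frechet_derivative g (at x) v) n" for v
    by (rule Suc.IH[OF Suc.prems(1), of "\<lambda>x. frechet_derivative f (at x) v"])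
      (use Suc.prems(3) frechet_derivative_at[OF d] in auto)
  then show ?case
    using d by (auto simp: differentiable_def)
qed

text \<open>\<open>frechet_derivative\<close> is a choice operator; by uniqueness of derivatives an
  explicitly given \<open>f'\<close> may stand in for it. Most closure properties below are proved
  through this rule.\<close>

lemma times_differentiable_on_SucI:
  assumes S: "open S" and d: "\<And>x. x \<in> S \<Longrightarrow> (f has_derivative f' x) (at x)"
    and f': "\<And>v. times_differentiable_on S (\<lambda>x. f' x v) n"
  shows "times_differentiable_on S f (Suc n)"
proof -
  have "times_differentiable_on S (\<lambda>x. frechet_derivative f (at x) v) n" for v
    by (rule times_differentiable_on_cong[OF S _ f'[of v]]) (simp add: frechet_derivative_at[OF d, symmetric])
  then show ?thesis
    using d by (auto simp: differentiable_def)
qed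

lemma times_differentiable_on_SucD:
  "times_differentiable_on S f (Suc n) \<Longrightarrow> times_differentiable_on S f n"
proof (induction n arbitrary: f)
  case 0
  then show ?case
    by (auto intro!: continuous_at_imp_continuous_on differentiable_imp_continuous_within)
qed (metis times_differentiable_on.simps(2))

lemma times_differentiable_on_derivative:
  assumes "times_differentiable_on S f (Suc n)" "x \<in> S"
  shows "(f has_derivative frechet_derivative f (at x)) (at x)"
  using assms by (auto simp: frechet_derivative_works)

lemma times_differentiable_on_subset:
  "times_differentiable_on S f n \<Longrightarrow> T \<subseteq> S \<Longrightarrow> times_differentiable_on T f n"
  by (induction n arbitrary: f) (auto intro: continuous_on_subset)

text \<open>Used to glue smoothness over chart domains. At order 0, continuity within
  \<open>S\<close> at \<open>x\<close> only sees \<open>S \<inter> T\<close>; at higher orders the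
  derivatives are taken in the full space and are not affected by \<open>T\<close>.\<close>

lemma times_differentiable_on_local:
  assumes "\<And>x. x \<in> S \<Longrightarrow> \<exists>T. open T \<and> x \<in> T \<and> times_differentiable_on (S \<inter> T) f n"
  shows "times_differentiable_on S f n"
  using assms
proof (induction n arbitrary: f)
  case 0
  have "continuous (at x within S) f" if x: "x \<in> S" for x
  proof -
    obtain T where T: "open T" "x \<in> T" "continuous_on (S \<inter> T) f" using 0[OF x] by auto
    then have "continuous (at x within S \<inter> T) f"
      using x by (auto simp: continuous_on_eq_continuous_within)
    then show ?thesis
      using at_within_nhd[OF T(2,1), of S "S \<inter> T"] by auto
  qed
  then show ?case by (auto simp: continuous_on_eq_continuous_within)
next
  case (Suc n)
  have "\<exists>T. open T \<and> x \<in> T \<and> times_differentiable_on (S \<inter> T) (\<lambda>x. frechet_derivative f (at x) v) n"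
    if "x \<in> S" for x v
    using Suc.prems[OF that] by auto
  with Suc show ?case
    by (metis IntI times_differentiable_on.simps(2))
qed

lemma times_differentiable_on_const: "times_differentiable_on S (\<lambda>_. c) n"
  by (induction n arbitrary: c) auto

lemma times_differentiable_on_bounded_linear_compose:
  assumes "open S" "bounded_linear L" "times_differentiable_on S f n"
  shows "times_differentiable_on S (\<lambda>x. L (f x)) n"
  using assms(3)
proof (induction n arbitrary: f)
  case 0
  then show ?case
    using assms(2) by (auto intro: bounded_linear.continuous_on)
next
  case (Suc n)
  show ?case
    by (rule times_differentiable_on_SucI[OF assms(1)
          bounded_linear.has_derivative[OF assms(2) times_differentiable_on_derivative[OF Suc.prems]]])
      (use Suc in auto)
qed

lemma times_differentiable_on_bounded_linear:
  assumes "open S" "bounded_linear L"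
  shows "times_differentiable_on S L n"
proof (cases n)
  case 0
  then show ?thesis
    using assms(2) bounded_linear.continuous_on[OF assms(2) continuous_on_id] by simp
next
  case (Suc m)
  show ?thesis unfolding Suc
    by (rule times_differentiable_on_SucI[OF assms(1) bounded_linear_imp_has_derivative[OF assms(2)]])
      (rule times_differentiable_on_const)
qed

lemma times_differentiable_on_add:
  assumes "open S" "times_differentiable_on S f n" "times_differentiable_on S g n"
  shows "times_differentiable_on S (\<lambda>x. f x + g x) n"
  using assms(2,3)
proof (induction n arbitrary: f g)
  case (Suc n)
  show ?case
    by (rule times_differentiable_on_SucI[OF assms(1)
          has_derivative_add[OF times_differentiable_on_derivative[OF Suc.prems(1)]
            times_differentiable_on_derivative[OF Suc.prems(2)]]])
      (use Suc in auto)
qed (auto intro: continuous_on_add)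

lemma times_differentiable_on_sum:
  assumes "open S" "finite J" "\<And>j. j \<in> J \<Longrightarrow> times_differentiable_on S (f j) n"
  shows "times_differentiable_on S (\<lambda>x. \<Sum>j\<in>J. f j x) n"
  using assms(2,3)
  by (induction J) (auto intro: times_differentiable_on_const times_differentiable_on_add[OF assms(1)])

lemma times_differentiable_on_scaleR:
  assumes "open S" "times_differentiable_on S a n" "times_differentiable_on S f n"
  shows "times_differentiable_on S (\<lambda>x. a x *\<^sub>R f x) n"
  using assms(2,3)
proof (induction n arbitrary: a f)
  case (Suc n)
  note S = Suc.prems[THEN times_differentiable_on_SucD]
  show ?case
    by (rule times_differentiable_on_SucI[OF assms(1)
          has_derivative_scaleR[OF times_differentiable_on_derivative[OF Suc.prems(1)]
            times_differentiable_on_derivative[OF Suc.prems(2)]]])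
      (use Suc S in \<open>auto intro!: times_differentiable_on_add[OF assms(1)]\<close>)
qed (auto intro: continuous_on_scaleR)

text \<open>The chain rule gives \<open>?g' (f x) (?f' x v)\<close>, where both the base point and
  the direction vary with \<open>x\<close>. Expanding the direction in the basis leaves scalar
  functions times \<open>?g' (f x) b\<close> with fixed \<open>b\<close>, and the induction
  hypothesis applies to the directional derivative of \<open>g\<close> along
  \<open>b\<close>.\<close>

lemma times_differentiable_on_compose:
  fixes f :: "'a::euclidean_space \<Rightarrow> 'b::euclidean_space" and g :: "'b \<Rightarrow> 'c::real_normed_vector"
  assumes "open S" "open T" "f ` S \<subseteq> T" "times_differentiable_on S f n" "times_differentiable_on T g n"
  shows "times_differentiable_on S (\<lambda>x. g (f x)) n"
  using assms(4,5)
proof (induction n arbitrary: g)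
  case 0
  then show ?case
    using assms(3) continuous_on_compose2[of T g S f] by simp
next
  case (Suc n)
  let ?f' = "\<lambda>x. frechet_derivative f (at x)" and ?g' = "\<lambda>y. frechet_derivative g (at y)"
  have *: "((\<lambda>x. g (f x)) has_derivative (\<lambda>v. \<Sum>b\<in>Basis. (?f' x v \<bullet> b) *\<^sub>R ?g' (f x) b)) (at x)"
    if "x \<in> S" for x
  proof -
    have g: "(g has_derivative ?g' (f x)) (at (f x))"
      using that assms(3) Suc.prems(2) by (intro times_differentiable_on_derivative) auto
    then have lin: "linear (?g' (f x))" by (rule has_derivative_linear)
    have "?g' (f x) v = (\<Sum>b\<in>Basis. (v \<bullet> b) *\<^sub>R ?g' (f x) b)" for v
    proof -
      have "?g' (f x) v = ?g' (f x) (\<Sum>b\<in>Basis. (v \<bullet> b) *\<^sub>R b)"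
        by (simp only: euclidean_representation)
      also have "\<dots> = (\<Sum>b\<in>Basis. ?g' (f x) ((v \<bullet> b) *\<^sub>R b))"
        by (rule linear_sum[OF lin])
      finally show ?thesis by (simp only: linear_scale[OF lin])
    qed
    then have "(\<lambda>v. ?g' (f x) (?f' x v)) = (\<lambda>v. \<Sum>b\<in>Basis. (?f' x v \<bullet> b) *\<^sub>R ?g' (f x) b)"
      by blast
    moreover have "((\<lambda>x. g (f x)) has_derivative (\<lambda>v. ?g' (f x) (?f' x v))) (at x)"
      using has_derivative_compose[OF times_differentiable_on_derivative[OF Suc.prems(1) that] g] .
    ultimately show ?thesis by simp
  qed
  show ?case
  proof (rule times_differentiable_on_SucI[OF assms(1) *])
    fix v
    have "times_differentiable_on S (\<lambda>x. ?f' x v \<bullet> b) n" for b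
      using Suc.prems(1)
      by (intro times_differentiable_on_bounded_linear_compose[OF assms(1) bounded_linear_inner_left]) auto
    moreover have "times_differentiable_on S (\<lambda>x. ?g' (f x) b) n" for b
      using Suc.prems(2) by (intro Suc.IH times_differentiable_on_SucD[OF Suc.prems(1)]) simp
    ultimately show "times_differentiable_on S (\<lambda>x. \<Sum>b\<in>Basis. (?f' x v \<bullet> b) *\<^sub>R ?g' (f x) b) n"
      by (intro times_differentiable_on_sum times_differentiable_on_scaleR assms(1)) auto
  qed auto
qed

text \<open>The factor \<open>c\<close> is general so that the derivative has the same form again.
  Exponent \<open>-1/2\<close> later normalizes frame vectors, exponent \<open>-1\<close> inverts
  \<open>f\<close>.\<close>

lemma times_differentiable_on_powr:
  "times_differentiable_on {0<..} (\<lambda>x::real. c * x powr a) n"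
proof (induction n arbitrary: a c)
  case 0
  then show ?case by (auto intro!: continuous_intros)
next
  case (Suc n)
  show ?case
  proof (rule times_differentiable_on_SucI)
    show "((\<lambda>x. c * x powr a) has_derivative (\<lambda>v. v * (c * (a * x powr (a - 1))))) (at x)"
      if "x \<in> {0<..}" for x :: real
      using that by (auto intro!: derivative_eq_intros simp: powr_diff)
    show "times_differentiable_on {0<..} (\<lambda>x. v * (c * (a * x powr (a - 1)))) n" for v
      using Suc.IH[of "v * (c * a)" "a - 1"] by (simp add: mult.assoc)
  qed auto
qed

context
  fixes S :: "'a::euclidean_space set"
  assumes S: "open S"
begin

lemma smooth_on_cong: "(\<And>x. x \<in> S \<Longrightarrow> f x = g x) \<Longrightarrow> smooth_on S f \<Longrightarrow> smooth_on S g"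
  using times_differentiable_on_cong[OF S] unfolding smooth_on_def by metis

lemma smooth_on_bounded_linear: "bounded_linear L \<Longrightarrow> smooth_on S L"
  using times_differentiable_on_bounded_linear[OF S] unfolding smooth_on_def by metis

lemma smooth_on_bounded_linear_compose:
  "bounded_linear L \<Longrightarrow> smooth_on S f \<Longrightarrow> smooth_on S (\<lambda>x. L (f x))"
  using times_differentiable_on_bounded_linear_compose[OF S] unfolding smooth_on_def by metis

lemma smooth_on_add: "smooth_on S f \<Longrightarrow> smooth_on S g \<Longrightarrow> smooth_on S (\<lambda>x. f x + g x)"
  using times_differentiable_on_add[OF S] unfolding smooth_on_def by metis

lemma smooth_on_scaleR: "smooth_on S a \<Longrightarrow> smooth_on S f \<Longrightarrow> smooth_on S (\<lambda>x. a x *\<^sub>R f x)"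
  using times_differentiable_on_scaleR[OF S] unfolding smooth_on_def by metis

lemma smooth_on_mult:
  fixes a b :: "'a \<Rightarrow> real"
  shows "smooth_on S a \<Longrightarrow> smooth_on S b \<Longrightarrow> smooth_on S (\<lambda>x. a x * b x)"
  using smooth_on_scaleR[of a b] by simp

lemma smooth_on_compose:
  fixes f :: "'a \<Rightarrow> 'b::euclidean_space"
  assumes "smooth_on S f" "smooth_on T g" "f ` S \<subseteq> T" "open T"
  shows "smooth_on S (\<lambda>x. g (f x))"
  using assms times_differentiable_on_compose[OF S, of T f] unfolding smooth_on_def by metis

lemma smooth_on_differentiable: "smooth_on S f \<Longrightarrow> x \<in> S \<Longrightarrow> f differentiable (at x)"
  unfolding smooth_on_def by (metis times_differentiable_on.simps(2))

lemma smooth_on_continuous: "smooth_on S f \<Longrightarrow> continuous_on S f"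
  unfolding smooth_on_def by (metis times_differentiable_on.simps(1))

lemma smooth_on_has_derivative:
  "smooth_on S f \<Longrightarrow> x \<in> S \<Longrightarrow> (f has_derivative frechet_derivative f (at x)) (at x)"
  using smooth_on_differentiable frechet_derivative_works by blast

lemma smooth_on_frechet_derivative:
  "smooth_on S f \<Longrightarrow> smooth_on S (\<lambda>x. frechet_derivative f (at x) v)"
  unfolding smooth_on_def by (metis times_differentiable_on.simps(2))

end

lemma smooth_on_const: "smooth_on S (\<lambda>_. c)"
  by (simp add: smooth_on_def times_differentiable_on_const)

lemma smooth_on_subset: "smooth_on S f \<Longrightarrow> T \<subseteq> S \<Longrightarrow> smooth_on T f"
  by (auto simp: smooth_on_def intro: times_differentiable_on_subset)

lemma smooth_on_local:
  assumes "\<And>x. x \<in> S \<Longrightarrow> \<exists>T. open T \<and> x \<in> T \<and> smooth_on (S \<inter> T) f"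
  shows "smooth_on S f"
  unfolding smooth_on_def
  by (metis assms smooth_on_def times_differentiable_on_local)

lemma smooth_on_powr: "smooth_on {0<..} (\<lambda>x::real. x powr a)"
  using times_differentiable_on_powr[of 1 a] by (simp add: smooth_on_def)

text \<open>A linear map on the reals is multiplication by its value at 1, which identifies
  \<open>frechet_derivative\<close> in direction 1 with \<open>deriv\<close>.\<close>

lemma smooth_on_deriv:
  assumes "open I" "smooth_on I (f :: real \<Rightarrow> real)"
  shows "t \<in> I \<Longrightarrow> (f has_real_derivative deriv f t) (at t)"
    and "smooth_on I (deriv f)"
proof -
  have d: "(f has_real_derivative frechet_derivative f (at t) 1) (at t)" if "t \<in> I" for t
  proof -
    have "(f has_derivative frechet_derivative f (at t)) (at t)"
      using smooth_on_has_derivative[OF assms that] .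
    moreover from this have "frechet_derivative f (at t) = (*) (frechet_derivative f (at t) 1)"
      using linear_times_of_real has_derivative_linear
      by (metis (no_types) mult.commute mult.right_neutral real_scaleR_def linear_scale ext)
    ultimately show ?thesis by (simp add: has_field_derivative_def)
  qed
  then show "(f has_real_derivative deriv f t) (at t)" if "t \<in> I"
    using that DERIV_imp_deriv by metis
  show "smooth_on I (deriv f)"
    using smooth_on_cong[OF assms(1), of "\<lambda>t. frechet_derivative f (at t) 1"] d DERIV_imp_deriv
      smooth_on_frechet_derivative[OF assms] by metis
qed

section \<open>Tangent vectors and vector fields on a manifold\<close>

text \<open>The coordinate field with constant components \<open>u\<close>. At a fixed point it is
  the expression that occurs in \<open>tangent_space\<close>; with \<open>p\<close> as an argument
  it is a vector field on \<open>V\<close>, so every tangent vector extends to a local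
  field.\<close>

definition chart_vec ::
  "('a::topological_space, 'e::euclidean_space) atlas \<Rightarrow> 'a set \<Rightarrow> ('a \<Rightarrow> 'e) \<Rightarrow> 'e \<Rightarrow> 'a vfield" where
  "chart_vec A V \<phi> u p = (\<lambda>h.
     if smooth_near A p h then frechet_derivative (\<lambda>y. h (inv_into V \<phi> y)) (at (\<phi> p)) u else 0)"

locale smooth_mfd =
  fixes A :: "('a::{t2_space, second_countable_topology}, 'e::euclidean_space) atlas"
  assumes mfd: "smooth_manifold A"
begin

lemma
  assumes "(V, \<phi>) \<in> A"
  shows chart_open: "open V" and chart_image: "open (\<phi> ` V)"
    and chart_homeomorphism: "homeomorphism V (\<phi> ` V) \<phi> (inv_into V \<phi>)"
    and chart_subset: "V \<subseteq> carrier A"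
    and chart_transition: "(W, \<psi>) \<in> A \<Longrightarrow> smooth_on (\<phi> ` (V \<inter> W)) (\<lambda>y. \<psi> (inv_into V \<phi> y))"
  using assms mfd by (fastforce simp: smooth_manifold_def carrier_def comp_def)+

lemma carrier_chart:
  assumes "p \<in> carrier A"
  obtains V \<phi> where "(V, \<phi>) \<in> A" "p \<in> V"
  using assms by (auto simp: carrier_def)

lemma open_carrier: "open (carrier A)"
  using chart_open by (auto simp: carrier_def)

lemma chart_inv: "(V, \<phi>) \<in> A \<Longrightarrow> x \<in> V \<Longrightarrow> inv_into V \<phi> (\<phi> x) = x"
  using chart_homeomorphism by (metis homeomorphism_apply1)

lemma chart_image_open:
  assumes "(V, \<phi>) \<in> A" "open U"
  shows "open (\<phi> ` (U \<inter> V))"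
proof -
  have "openin (top_of_set V) (U \<inter> V)"
    using assms(2) by (auto simp: openin_open)
  then have "openin (top_of_set (\<phi> ` V)) (\<phi> ` (U \<inter> V))"
    by (rule homeomorphism_imp_open_map[OF chart_homeomorphism[OF assms(1)]])
  then show ?thesis
    using chart_image[OF assms(1)] by (simp add: openin_open_eq)
qed

section \<open>Smooth functions read in charts\<close>

lemma smooth_funI:
  "(\<And>V \<phi>. (V, \<phi>) \<in> A \<Longrightarrow> smooth_on (\<phi> ` (U \<inter> V)) (\<lambda>y. h (inv_into V \<phi> y))) \<Longrightarrow> smooth_fun A U h"
  by (auto simp: smooth_fun_def comp_def)

lemma smooth_funD:
  "smooth_fun A U h \<Longrightarrow> (V, \<phi>) \<in> A \<Longrightarrow> smooth_on (\<phi> ` (U \<inter> V)) (\<lambda>y. h (inv_into V \<phi> y))"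
  by (auto simp: smooth_fun_def comp_def)

lemma smooth_fun_subset: "smooth_fun A U h \<Longrightarrow> W \<subseteq> U \<Longrightarrow> smooth_fun A W h"
  by (meson smooth_funI smooth_funD smooth_on_subset image_mono Int_mono order_refl)

lemma smooth_fun_cong:
  assumes "open U" "\<And>p. p \<in> U \<Longrightarrow> h p = k p" "smooth_fun A U h"
  shows "smooth_fun A U k"
proof (rule smooth_funI)
  fix V \<phi> assume c: "(V, \<phi>) \<in> A"
  show "smooth_on (\<phi> ` (U \<inter> V)) (\<lambda>y. k (inv_into V \<phi> y))"
    by (rule smooth_on_cong[OF chart_image_open[OF c assms(1)] _ smooth_funD[OF assms(3) c]])
      (auto simp: chart_inv[OF c] assms(2))
qed

lemma smooth_fun_const: "smooth_fun A U (\<lambda>_. c)"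
  by (intro smooth_funI smooth_on_const)

lemma smooth_fun_compose:
  assumes "open U" "open T" "smooth_on T \<rho>" "smooth_fun A U h" "\<And>p. p \<in> U \<Longrightarrow> h p \<in> T"
  shows "smooth_fun A U (\<lambda>p. \<rho> (h p))"
proof (rule smooth_funI)
  fix V \<phi> assume c: "(V, \<phi>) \<in> A"
  show "smooth_on (\<phi> ` (U \<inter> V)) (\<lambda>y. \<rho> (h (inv_into V \<phi> y)))"
    by (rule smooth_on_compose[OF chart_image_open[OF c assms(1)] smooth_funD[OF assms(4) c] assms(3) _ assms(2)])
      (auto simp: chart_inv[OF c] assms(5))
qed

lemma smooth_fun_add:
  "open U \<Longrightarrow> smooth_fun A U h \<Longrightarrow> smooth_fun A U k \<Longrightarrow> smooth_fun A U (\<lambda>p. h p + k p)"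
  by (rule smooth_funI, rule smooth_on_add[OF chart_image_open]; (assumption | erule smooth_funD))

lemma smooth_fun_mult:
  "open U \<Longrightarrow> smooth_fun A U h \<Longrightarrow> smooth_fun A U k \<Longrightarrow> smooth_fun A U (\<lambda>p. h p * k p)"
  by (rule smooth_funI, rule smooth_on_mult[OF chart_image_open]; (assumption | erule smooth_funD))

lemma smooth_fun_cmult: "open U \<Longrightarrow> smooth_fun A U h \<Longrightarrow> smooth_fun A U (\<lambda>p. c * h p)"
  by (intro smooth_fun_mult smooth_fun_const)

lemma smooth_fun_minus: "open U \<Longrightarrow> smooth_fun A U h \<Longrightarrow> smooth_fun A U (\<lambda>p. - h p)"
  using smooth_fun_cmult[of U h "-1"] by simp

lemma smooth_fun_diff:
  "open U \<Longrightarrow> smooth_fun A U h \<Longrightarrow> smooth_fun A U k \<Longrightarrow> smooth_fun A U (\<lambda>p. h p - k p)"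
  using smooth_fun_add[of U h "\<lambda>p. - k p"] smooth_fun_minus[of U k] by simp

lemma smooth_fun_sum:
  assumes "open U" "finite J" "\<And>j. j \<in> J \<Longrightarrow> smooth_fun A U (h j)"
  shows "smooth_fun A U (\<lambda>p. \<Sum>j\<in>J. h j p)"
  using assms(2,3)
  by (induction J) (auto intro: smooth_fun_const smooth_fun_add[OF assms(1)])

lemma smooth_fun_powr:
  "open U \<Longrightarrow> smooth_fun A U h \<Longrightarrow> (\<And>p. p \<in> U \<Longrightarrow> h p > 0) \<Longrightarrow> smooth_fun A U (\<lambda>p. h p powr a)"
  using smooth_fun_compose[OF _ open_greaterThan smooth_on_powr] by auto

lemma smooth_fun_local:
  assumes "open U" "\<And>p. p \<in> U \<Longrightarrow> \<exists>W. open W \<and> p \<in> W \<and> smooth_fun A (U \<inter> W) h"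
  shows "smooth_fun A U h"
proof (intro smooth_funI smooth_on_local)
  fix V \<phi> y assume c: "(V, \<phi>) \<in> A" and "y \<in> \<phi> ` (U \<inter> V)"
  then obtain p where p: "p \<in> U" "p \<in> V" "y = \<phi> p" by auto
  obtain W where W: "open W" "p \<in> W" "smooth_fun A (U \<inter> W) h" using assms(2)[OF p(1)] by auto
  have "smooth_on (\<phi> ` (U \<inter> V) \<inter> \<phi> ` (W \<inter> V)) (\<lambda>y. h (inv_into V \<phi> y))"
    using smooth_funD[OF W(3) c]
    by (rule smooth_on_subset) (auto, metis IntI chart_inv[OF c] imageI)
  then show "\<exists>T. open T \<and> y \<in> T \<and> smooth_on (\<phi> ` (U \<inter> V) \<inter> T) (\<lambda>y. h (inv_into V \<phi> y))"
    using chart_image_open[OF c W(1)] W(2) p by blast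
qed

text \<open>Smoothness is demanded in every chart of the atlas; the transition maps carry it from
  the one chart that contains \<open>U\<close> to all others.\<close>

lemma smooth_funI_chart:
  assumes c: "(V, \<phi>) \<in> A" and "open U" "U \<subseteq> V" "smooth_on (\<phi> ` U) (\<lambda>y. h (inv_into V \<phi> y))"
  shows "smooth_fun A U h"
proof (rule smooth_funI)
  fix W \<psi> assume d: "(W, \<psi>) \<in> A"
  have o: "open (\<psi> ` (U \<inter> W))" by (rule chart_image_open[OF d assms(2)])
  have U: "open (\<phi> ` U)" using chart_image_open[OF c assms(2)] assms(3) by (simp add: Int_absorb2)
  have t: "smooth_on (\<psi> ` (U \<inter> W)) (\<lambda>y. \<phi> (inv_into W \<psi> y))"
    by (rule smooth_on_subset[OF chart_transition[OF d c]]) (use assms(3) in auto)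
  have "smooth_on (\<psi> ` (U \<inter> W)) (\<lambda>y. h (inv_into V \<phi> (\<phi> (inv_into W \<psi> y))))"
    by (rule smooth_on_compose[OF o t assms(4) _ U]) (auto simp: chart_inv[OF d])
  then show "smooth_on (\<psi> ` (U \<inter> W)) (\<lambda>y. h (inv_into W \<psi> y))"
    by (rule smooth_on_cong[OF o, rotated])
      (use assms(3) in \<open>auto simp: chart_inv[OF d] chart_inv[OF c] subset_iff\<close>)
qed

lemma smooth_fun_coord:
  assumes c: "(V, \<phi>) \<in> A"
  shows "smooth_fun A V (\<lambda>x. \<phi> x \<bullet> b)"
proof (rule smooth_funI_chart[OF c chart_open[OF c] order_refl])
  show "smooth_on (\<phi> ` V) (\<lambda>y. \<phi> (inv_into V \<phi> y) \<bullet> b)"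
    by (rule smooth_on_cong[OF chart_image[OF c] _
          smooth_on_bounded_linear[OF chart_image[OF c] bounded_linear_inner_left]])
      (auto simp: chart_inv[OF c])
qed

lemma smooth_fun_continuous:
  assumes "smooth_fun A U h" "open U" "U \<subseteq> carrier A"
  shows "continuous_on U h"
proof (rule continuous_at_imp_continuous_on, rule ballI)
  fix p assume p: "p \<in> U"
  then obtain V \<phi> where c: "(V, \<phi>) \<in> A" "p \<in> V" using assms(3) carrier_chart by blast
  have "continuous_on (U \<inter> V) (\<lambda>x. h (inv_into V \<phi> (\<phi> x)))"
    using smooth_on_continuous[OF chart_image_open[OF c(1) assms(2)] smooth_funD[OF assms(1) c(1)]]
    by (rule continuous_on_compose2)
      (use chart_homeomorphism[OF c(1)] in \<open>auto simp: homeomorphism_def intro: continuous_on_subset\<close>)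
  then have "continuous_on (U \<inter> V) h"
    by (rule continuous_on_cong[THEN iffD1, rotated -1]) (auto simp: chart_inv[OF c(1)])
  then show "isCont h p"
    using p c(2) assms(2) chart_open[OF c(1)] by (simp add: continuous_on_eq_continuous_at open_Int)
qed

section \<open>Germs of smooth functions\<close>

lemma smooth_nearI: "smooth_fun A U h \<Longrightarrow> open U \<Longrightarrow> p \<in> U \<Longrightarrow> U \<subseteq> carrier A \<Longrightarrow> smooth_near A p h"
  by (auto simp: smooth_near_def)

lemma smooth_near_within:
  assumes "smooth_near A p h" "open W" "p \<in> W"
  obtains U where "open U" "p \<in> U" "U \<subseteq> W" "U \<subseteq> carrier A" "smooth_fun A U h"
proof -
  obtain U where U: "open U" "p \<in> U" "U \<subseteq> carrier A" "smooth_fun A U h"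
    using assms(1) by (auto simp: smooth_near_def)
  show thesis
    by (rule that[of "U \<inter> W"]) (use U assms smooth_fun_subset[OF U(4)] in auto)
qed

text \<open>Tangent vectors are 0 on functions that are not smooth near \<open>p\<close>. For them
  to depend on germs only, smoothness near \<open>p\<close> must itself be a property of the
  germ.\<close>

lemma smooth_near_germ:
  assumes "open W" "p \<in> W" "\<And>q. q \<in> W \<Longrightarrow> h q = k q"
  shows "smooth_near A p h \<longleftrightarrow> smooth_near A p k"
proof -
  have *: "smooth_near A p k" if h: "smooth_near A p h" and eq: "\<And>q. q \<in> W \<Longrightarrow> h q = k q" for h k
  proof -
    obtain U where U: "open U" "p \<in> U" "U \<subseteq> W" "U \<subseteq> carrier A" "smooth_fun A U h"
      using smooth_near_within[OF h assms(1,2)] by metis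
    then have "smooth_fun A U k" using eq by (intro smooth_fun_cong[OF U(1) _ U(5)]) auto
    then show ?thesis using U by (intro smooth_nearI)
  qed
  show ?thesis using *[of h k] *[of k h] assms(3) by auto
qed

lemma smooth_near_const: "p \<in> carrier A \<Longrightarrow> smooth_near A p (\<lambda>_. c)"
  using smooth_fun_const open_carrier smooth_nearI by blast

lemma
  assumes "smooth_near A p h" "smooth_near A p k"
  shows smooth_near_add: "smooth_near A p (\<lambda>q. h q + k q)"
    and smooth_near_mult: "smooth_near A p (\<lambda>q. h q * k q)"
proof -
  obtain U where U: "open U" "p \<in> U" "U \<subseteq> carrier A" "smooth_fun A U h"
    using assms(1) by (auto simp: smooth_near_def)
  obtain W where W: "open W" "p \<in> W" "W \<subseteq> U" "smooth_fun A W k"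
    using smooth_near_within[OF assms(2) U(1,2)] by metis
  have h: "smooth_fun A W h" using U W smooth_fun_subset by blast
  show "smooth_near A p (\<lambda>q. h q + k q)" "smooth_near A p (\<lambda>q. h q * k q)"
    using smooth_fun_add[OF W(1) h W(4)] smooth_fun_mult[OF W(1) h W(4)] W U
    by (auto intro: smooth_nearI)
qed

lemma smooth_near_coord: "(V, \<phi>) \<in> A \<Longrightarrow> p \<in> V \<Longrightarrow> smooth_near A p (\<lambda>x. \<phi> x \<bullet> b)"
  using smooth_nearI smooth_fun_coord chart_open chart_subset by blast

section \<open>Tangent vectors as directional derivatives in charts\<close>

lemma chart_vec_has_derivative:
  assumes c: "(V, \<phi>) \<in> A" "p \<in> V" and h: "smooth_near A p h"
  shows "((\<lambda>y. h (inv_into V \<phi> y)) has_derivative (\<lambda>u. chart_vec A V \<phi> u p h)) (at (\<phi> p))"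
proof -
  obtain U where U: "open U" "p \<in> U" "U \<subseteq> V" "smooth_fun A U h"
    using smooth_near_within[OF h chart_open[OF c(1)] c(2)] by metis
  have "((\<lambda>y. h (inv_into V \<phi> y)) has_derivative
      frechet_derivative (\<lambda>y. h (inv_into V \<phi> y)) (at (\<phi> p))) (at (\<phi> p))"
    by (rule smooth_on_has_derivative[OF chart_image_open[OF c(1) U(1)] smooth_funD[OF U(4) c(1)]])
      (use U c in auto)
  then show ?thesis using h by (simp add: chart_vec_def)
qed

lemma chart_vec_eqI:
  assumes "(V, \<phi>) \<in> A" "p \<in> V" "smooth_near A p h"
    and "((\<lambda>y. h (inv_into V \<phi> y)) has_derivative d) (at (\<phi> p))"
  shows "chart_vec A V \<phi> u p h = d u"
  using has_derivative_unique[OF chart_vec_has_derivative[OF assms(1-3)] assms(4)] by meson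

lemma chart_vec_not_smooth: "\<not> smooth_near A p h \<Longrightarrow> chart_vec A V \<phi> u p h = 0"
  by (simp add: chart_vec_def)

lemma chart_vec_linear:
  assumes c: "(V, \<phi>) \<in> A" "p \<in> V"
  shows "linear (\<lambda>u. chart_vec A V \<phi> u p h)"
proof (cases "smooth_near A p h")
  case True
  then show ?thesis using chart_vec_has_derivative[OF c] has_derivative_linear by blast
next
  case False
  then show ?thesis by (simp add: chart_vec_not_smooth linear_zero module_hom_zero)
qed

lemma chart_vec_coord:
  assumes c: "(V, \<phi>) \<in> A" "p \<in> V"
  shows "chart_vec A V \<phi> u p (\<lambda>x. \<phi> x \<bullet> b) = u \<bullet> b"
proof (rule chart_vec_eqI[OF c smooth_near_coord[OF c]])
  have "((\<lambda>y. y \<bullet> b) has_derivative (\<lambda>u. u \<bullet> b)) (at (\<phi> p))"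
    by (auto intro!: derivative_eq_intros)
  then show "((\<lambda>y. \<phi> (inv_into V \<phi> y) \<bullet> b) has_derivative (\<lambda>u. u \<bullet> b)) (at (\<phi> p))"
    by (rule has_derivative_transform_within_open[OF _ chart_image[OF c(1)]])
      (use c in \<open>auto simp: chart_inv\<close>)
qed

text \<open>Chain rule through the transition map: components are multiplied by its Jacobian. Hence
  a single chart around \<open>p\<close> already gives the whole tangent space.\<close>

lemma chart_vec_change:
  assumes c: "(V, \<phi>) \<in> A" "p \<in> V" and d: "(W, \<psi>) \<in> A" "p \<in> W"
  shows "chart_vec A W \<psi> u p =
    chart_vec A V \<phi> (frechet_derivative (\<lambda>y. \<phi> (inv_into W \<psi> y)) (at (\<psi> p)) u) p"
proof
  fix h
  let ?\<tau> = "\<lambda>y. \<phi> (inv_into W \<psi> y)"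
  show "chart_vec A W \<psi> u p h = chart_vec A V \<phi> (frechet_derivative ?\<tau> (at (\<psi> p)) u) p h"
  proof (cases "smooth_near A p h")
    case True
    have o: "open (\<psi> ` (V \<inter> W))" by (rule chart_image_open[OF d(1) chart_open[OF c(1)]])
    have t: "(?\<tau> has_derivative frechet_derivative ?\<tau> (at (\<psi> p))) (at (\<psi> p))"
      using chart_transition[OF d(1) c(1)] o c d
      by (intro smooth_on_has_derivative[OF o]) (auto simp: Int_commute)
    have "((\<lambda>y. h (inv_into V \<phi> (?\<tau> y))) has_derivative
        (\<lambda>u. chart_vec A V \<phi> (frechet_derivative ?\<tau> (at (\<psi> p)) u) p h)) (at (\<psi> p))"
      by (rule has_derivative_compose[OF t])
        (use chart_vec_has_derivative[OF c True] in \<open>simp add: chart_inv[OF d]\<close>)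
    then have "((\<lambda>y. h (inv_into W \<psi> y)) has_derivative
        (\<lambda>u. chart_vec A V \<phi> (frechet_derivative ?\<tau> (at (\<psi> p)) u) p h)) (at (\<psi> p))"
      by (rule has_derivative_transform_within_open[OF _ o])
        (use c d in \<open>auto simp: chart_inv\<close>)
    then show ?thesis by (rule chart_vec_eqI[OF d True])
  qed (simp add: chart_vec_not_smooth)
qed

lemma chart_vec_tangent: "(V, \<phi>) \<in> A \<Longrightarrow> p \<in> V \<Longrightarrow> chart_vec A V \<phi> u p \<in> tangent_space A p"
  by (force simp: tangent_space_def chart_vec_def comp_def)

lemma tangent_chart_vec:
  assumes "v \<in> tangent_space A p" "(V, \<phi>) \<in> A" "p \<in> V"
  obtains u where "v = chart_vec A V \<phi> u p"
proof -
  obtain W \<psi> u where "(W, \<psi>) \<in> A" "p \<in> W" "v = chart_vec A W \<psi> u p"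
    using assms(1) unfolding tangent_space_def chart_vec_def comp_def by blast
  then show thesis using that chart_vec_change[OF assms(2,3)] by metis
qed

lemma tangent_carrier: "v \<in> tangent_space A p \<Longrightarrow> p \<in> carrier A"
  by (auto simp: tangent_space_def carrier_def)

lemma tangent_repr:
  assumes "v \<in> tangent_space A p"
  obtains V \<phi> u where "(V, \<phi>) \<in> A" "p \<in> V" "v = chart_vec A V \<phi> u p"
  using assms by (metis carrier_chart tangent_carrier tangent_chart_vec)

lemma tangent_not_smooth: "v \<in> tangent_space A p \<Longrightarrow> \<not> smooth_near A p h \<Longrightarrow> v h = 0"
  by (metis chart_vec_not_smooth tangent_repr)

lemma tangent_germ:
  assumes "v \<in> tangent_space A p" "open W" "p \<in> W" "\<And>q. q \<in> W \<Longrightarrow> h q = k q"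
  shows "v h = v k"
proof (cases "smooth_near A p h")
  case True
  then have k: "smooth_near A p k" using smooth_near_germ[OF assms(2-4)] by simp
  obtain V \<phi> u where c: "(V, \<phi>) \<in> A" "p \<in> V" and v: "v = chart_vec A V \<phi> u p"
    using tangent_repr[OF assms(1)] by metis
  have "((\<lambda>y. h (inv_into V \<phi> y)) has_derivative (\<lambda>u. chart_vec A V \<phi> u p k)) (at (\<phi> p))"
    by (rule has_derivative_transform_within_open[OF chart_vec_has_derivative[OF c k]
          chart_image_open[OF c(1) assms(2)]])
      (use c assms in \<open>auto simp: chart_inv\<close>)
  then show ?thesis using chart_vec_eqI[OF c True] v by simp
next
  case False
  then show ?thesis
    using smooth_near_germ[OF assms(2-4)] tangent_not_smooth[OF assms(1)] by simp
qed

lemma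
  assumes v: "v \<in> tangent_space A p"
  shows tangent_const: "v (\<lambda>_. a) = 0"
    and tangent_add_fun: "smooth_near A p h \<Longrightarrow> smooth_near A p k \<Longrightarrow> v (\<lambda>q. h q + k q) = v h + v k"
    and tangent_mult_fun: "smooth_near A p h \<Longrightarrow> smooth_near A p k \<Longrightarrow>
      v (\<lambda>q. h q * k q) = h p * v k + v h * k p"
proof -
  obtain V \<phi> u where c: "(V, \<phi>) \<in> A" "p \<in> V" and v: "v = chart_vec A V \<phi> u p"
    using tangent_repr[OF v] by metis
  note d = chart_vec_has_derivative[OF c]
  show "v (\<lambda>_. a) = 0"
    unfolding v using c chart_subset
    by (intro chart_vec_eqI[OF c, where d="\<lambda>_. 0"] smooth_near_const) auto
  show "v (\<lambda>q. h q + k q) = v h + v k" if "smooth_near A p h" "smooth_near A p k"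
    unfolding v using chart_vec_eqI[OF c smooth_near_add[OF that] has_derivative_add[OF d d]] that by simp
  show "v (\<lambda>q. h q * k q) = h p * v k + v h * k p" if "smooth_near A p h" "smooth_near A p k"
    unfolding v using chart_vec_eqI[OF c smooth_near_mult[OF that] has_derivative_mult[OF d d]] that
    by (simp add: chart_inv[OF c])
qed

lemma tangent_cmult_fun:
  assumes "v \<in> tangent_space A p" "smooth_near A p h"
  shows "v (\<lambda>q. c * h q) = c * v h"
  using tangent_mult_fun[OF assms(1) smooth_near_const[OF tangent_carrier[OF assms(1)]] assms(2), of c]
  by (simp add: tangent_const[OF assms(1)])

lemma tangent_add:
  assumes "v \<in> tangent_space A p" "w \<in> tangent_space A p"
  shows "v + w \<in> tangent_space A p"
proof -
  obtain V \<phi> where c: "(V, \<phi>) \<in> A" "p \<in> V" using assms(1) tangent_repr by metis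
  obtain u u' where "v = chart_vec A V \<phi> u p" "w = chart_vec A V \<phi> u' p"
    using tangent_chart_vec[OF _ c] assms by metis
  then have "v + w = chart_vec A V \<phi> (u + u') p"
    by (auto simp: linear_add[OF chart_vec_linear[OF c]])
  then show ?thesis using chart_vec_tangent[OF c] by simp
qed

lemma tangent_scale:
  assumes "v \<in> tangent_space A p"
  shows "(\<lambda>h. a * v h) \<in> tangent_space A p"
proof -
  obtain V \<phi> u where c: "(V, \<phi>) \<in> A" "p \<in> V" and v: "v = chart_vec A V \<phi> u p"
    using assms(1) tangent_repr by metis
  then have "(\<lambda>h. a * v h) = chart_vec A V \<phi> (a *\<^sub>R u) p"
    by (auto simp: linear_scale[OF chart_vec_linear[OF c]])
  then show ?thesis using chart_vec_tangent[OF c] by simp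
qed

lemma tangent_zero: "p \<in> carrier A \<Longrightarrow> (\<lambda>h. 0) \<in> tangent_space A p"
  by (elim carrier_chart, drule tangent_scale[OF chart_vec_tangent, where a=0]) simp_all

lemma tangent_sum:
  assumes "p \<in> carrier A" "finite J" "\<And>j. j \<in> J \<Longrightarrow> v j \<in> tangent_space A p"
  shows "(\<lambda>h. \<Sum>j\<in>J. a j * v j h) \<in> tangent_space A p"
  using assms(2,3)
proof (induction J)
  case empty
  then show ?case using tangent_zero[OF assms(1)] by simp
next
  case (insert j J)
  then show ?case
    using tangent_add[OF tangent_scale[of "v j" p "a j"], of "\<lambda>h. \<Sum>j\<in>J. a j * v j h"]
    by (simp add: plus_fun_def)
qed

lemma tangent_diff:
  assumes "v \<in> tangent_space A p" "w \<in> tangent_space A p"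
  shows "v - w \<in> tangent_space A p"
  using tangent_add[OF assms(1) tangent_scale[OF assms(2), of "-1"]]
  by (simp add: plus_fun_def fun_diff_def)

text \<open>The components of \<open>v\<close> in the coordinate basis are its values on the
  coordinate functions, so a tangent vector is determined by finitely many numbers.\<close>

lemma tangent_expand:
  assumes "v \<in> tangent_space A p" and c: "(V, \<phi>) \<in> A" "p \<in> V"
  shows "v h = (\<Sum>b\<in>Basis. v (\<lambda>x. \<phi> x \<bullet> b) * chart_vec A V \<phi> b p h)"
proof -
  obtain u where v: "v = chart_vec A V \<phi> u p" using tangent_chart_vec[OF assms] by metis
  note l = chart_vec_linear[OF c, of h]
  have "chart_vec A V \<phi> u p h = chart_vec A V \<phi> (\<Sum>b\<in>Basis. (u \<bullet> b) *\<^sub>R b) p h"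
    by (simp only: euclidean_representation)
  also have "\<dots> = (\<Sum>b\<in>Basis. (u \<bullet> b) * chart_vec A V \<phi> b p h)"
    by (subst linear_sum[OF l]) (simp only: linear_scale[OF l] real_scaleR_def)
  finally show ?thesis by (simp only: v chart_vec_coord[OF c])
qed

lemma tangent_eqI:
  assumes "v \<in> tangent_space A p" "w \<in> tangent_space A p" "(V, \<phi>) \<in> A" "p \<in> V"
    and "\<And>b. b \<in> Basis \<Longrightarrow> v (\<lambda>x. \<phi> x \<bullet> b) = w (\<lambda>x. \<phi> x \<bullet> b)"
  shows "v = w"
proof
  fix h
  have "v h = (\<Sum>b\<in>Basis. v (\<lambda>x. \<phi> x \<bullet> b) * chart_vec A V \<phi> b p h)"
    by (rule tangent_expand[OF assms(1,3,4)])
  also have "\<dots> = (\<Sum>b\<in>Basis. w (\<lambda>x. \<phi> x \<bullet> b) * chart_vec A V \<phi> b p h)"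
    by (intro sum.cong) (auto simp only: assms(5))
  also have "\<dots> = w h"
    by (rule tangent_expand[OF assms(2,3,4), symmetric])
  finally show "v h = w h" .
qed

section \<open>Vector fields\<close>

lemma vf_tangent: "X \<in> vector_fields A U \<Longrightarrow> p \<in> U \<Longrightarrow> X p \<in> tangent_space A p"
  by (simp add: vector_fields_def)

lemma vf_smooth:
  "X \<in> vector_fields A U \<Longrightarrow> open W \<Longrightarrow> W \<subseteq> U \<Longrightarrow> smooth_fun A W h \<Longrightarrow> smooth_fun A W (\<lambda>p. X p h)"
  by (simp add: vector_fields_def)

lemma vf_smooth_near:
  assumes "X \<in> vector_fields A U" "open U" "p \<in> U" "smooth_near A p h"
  shows "smooth_near A p (\<lambda>q. X q h)"
proof -
  obtain W where W: "open W" "p \<in> W" "W \<subseteq> U" "W \<subseteq> carrier A" "smooth_fun A W h"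
    using smooth_near_within[OF assms(4,2,3)] by metis
  then show ?thesis using vf_smooth[OF assms(1)] by (blast intro: smooth_nearI)
qed

lemma vf_subset: "X \<in> vector_fields A U \<Longrightarrow> W \<subseteq> U \<Longrightarrow> X \<in> vector_fields A W"
  by (auto simp: vector_fields_def)

lemma vf_cong:
  assumes "\<And>p. p \<in> U \<Longrightarrow> X p = Y p" "X \<in> vector_fields A U"
  shows "Y \<in> vector_fields A U"
  unfolding vector_fields_def
proof (safe)
  show "Y p \<in> tangent_space A p" if "p \<in> U" for p
    using that assms vf_tangent by metis
  show "smooth_fun A V (\<lambda>p. Y p h)" if "open V" "V \<subseteq> U" "smooth_fun A V h" for V h
    by (rule smooth_fun_cong[OF that(1) _ vf_smooth[OF assms(2) that]])
      (use assms that in auto)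
qed

lemma vf_add: "X \<in> vector_fields A U \<Longrightarrow> Y \<in> vector_fields A U \<Longrightarrow> X + Y \<in> vector_fields A U"
  by (auto simp: vector_fields_def intro: tangent_add smooth_fun_add)

lemma vf_diff: "X \<in> vector_fields A U \<Longrightarrow> Y \<in> vector_fields A U \<Longrightarrow> X - Y \<in> vector_fields A U"
  by (auto simp: vector_fields_def intro: tangent_diff smooth_fun_diff)

lemma vf_smult:
  "X \<in> vector_fields A U \<Longrightarrow> smooth_fun A U a \<Longrightarrow> (\<lambda>q h. a q * X q h) \<in> vector_fields A U"
  by (auto simp: vector_fields_def intro!: tangent_scale smooth_fun_mult intro: smooth_fun_subset)

lemma vf_sum:
  assumes "U \<subseteq> carrier A" "finite J" "\<And>j. j \<in> J \<Longrightarrow> X j \<in> vector_fields A U"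
    "\<And>j. j \<in> J \<Longrightarrow> smooth_fun A U (a j)"
  shows "(\<lambda>q h. \<Sum>j\<in>J. a j q * X j q h) \<in> vector_fields A U"
  unfolding vector_fields_def
proof safe
  show "(\<lambda>h. \<Sum>j\<in>J. a j p * X j p h) \<in> tangent_space A p" if "p \<in> U" for p
    using that assms(1,2) vf_tangent[OF assms(3)] by (intro tangent_sum) auto
  show "smooth_fun A V (\<lambda>p. \<Sum>j\<in>J. a j p * X j p h)" if V: "open V" "V \<subseteq> U" "smooth_fun A V h" for V h
    by (rule smooth_fun_sum[OF V(1) assms(2)], rule smooth_fun_mult[OF V(1)])
      (use V in \<open>auto intro: smooth_fun_subset[OF assms(4)] vf_smooth[OF assms(3)]\<close>)
qed

lemma chart_vec_vf:
  assumes c: "(V, \<phi>) \<in> A"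
  shows "chart_vec A V \<phi> u \<in> vector_fields A V"
  unfolding vector_fields_def
proof (safe intro!: chart_vec_tangent[OF c])
  fix W h assume W: "open W" "W \<subseteq> V" "smooth_fun A W h"
  have "W \<inter> V = W" using W by auto
  then have o: "open (\<phi> ` W)" and s: "smooth_on (\<phi> ` W) (\<lambda>y. h (inv_into V \<phi> y))"
    using chart_image_open[OF c W(1)] smooth_funD[OF W(3) c] by auto
  have n: "smooth_near A p h" if "p \<in> W" for p
    using that W chart_subset[OF c] by (blast intro: smooth_nearI)
  show "smooth_fun A W (\<lambda>p. chart_vec A V \<phi> u p h)"
    by (rule smooth_funI_chart[OF c W(1,2)],
        rule smooth_on_cong[OF o _ smooth_on_frechet_derivative[OF o s, of u]])
      (use W in \<open>auto simp: chart_inv[OF c] chart_vec_def n subset_iff\<close>)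
qed

text \<open>By \<open>tangent_expand\<close>, \<open>X p h\<close> is locally a finite sum of
  components of \<open>X\<close> times coordinate fields applied to \<open>h\<close>; smooth
  components therefore make it smooth for every smooth \<open>h\<close>.\<close>

lemma vf_criterion:
  assumes U: "open U" and t: "\<And>p. p \<in> U \<Longrightarrow> X p \<in> tangent_space A p"
    and s: "\<And>p. p \<in> U \<Longrightarrow> \<exists>V \<phi>. (V, \<phi>) \<in> A \<and> p \<in> V \<and>
      (\<forall>b\<in>Basis. smooth_fun A (U \<inter> V) (\<lambda>q. X q (\<lambda>x. \<phi> x \<bullet> b)))"
  shows "X \<in> vector_fields A U"
  unfolding vector_fields_def
proof (safe intro!: t)
  fix W h assume W: "open W" "W \<subseteq> U" "smooth_fun A W h"
  show "smooth_fun A W (\<lambda>p. X p h)"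
  proof (rule smooth_fun_local[OF W(1)])
    fix p assume "p \<in> W"
    then obtain V \<phi> where c: "(V, \<phi>) \<in> A" "p \<in> V"
      and s: "\<And>b. b \<in> Basis \<Longrightarrow> smooth_fun A (U \<inter> V) (\<lambda>q. X q (\<lambda>x. \<phi> x \<bullet> b))"
      using s[of p] W by blast
    have o: "open (W \<inter> V)" using W chart_open[OF c(1)] by auto
    have "smooth_fun A (W \<inter> V) (\<lambda>q. \<Sum>b\<in>Basis. X q (\<lambda>x. \<phi> x \<bullet> b) * chart_vec A V \<phi> b q h)"
      using W by (intro smooth_fun_sum smooth_fun_mult o smooth_fun_subset[OF s]
          vf_smooth[OF chart_vec_vf[OF c(1)]] smooth_fun_subset[OF W(3)]) auto
    then have "smooth_fun A (W \<inter> V) (\<lambda>p. X p h)"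
      by (rule smooth_fun_cong[OF o, rotated])
        (use W in \<open>auto simp: tangent_expand[OF t c(1), symmetric] subset_iff\<close>)
    then show "\<exists>V. open V \<and> p \<in> V \<and> smooth_fun A (W \<inter> V) (\<lambda>p. X p h)"
      using chart_open[OF c(1)] c(2) by blast
  qed
qed

section \<open>Lie brackets\<close>

lemma lie_bracket_apply:
  "smooth_near A p h \<Longrightarrow> lie_bracket A X Y p h = X p (\<lambda>q. Y q h) - Y p (\<lambda>q. X q h)"
  by (simp add: lie_bracket_def)

lemma lie_bracket_not_smooth: "\<not> smooth_near A p h \<Longrightarrow> lie_bracket A X Y p h = 0"
  by (simp add: lie_bracket_def)

lemma lie_bracket_flip: "lie_bracket A Y X p h = - lie_bracket A X Y p h"
  by (simp add: lie_bracket_def)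

lemma lie_bracket_add_left:
  assumes "X \<in> vector_fields A U" "Y \<in> vector_fields A U" "Z \<in> vector_fields A U" "open U" "p \<in> U"
  shows "lie_bracket A (X + Y) Z p = lie_bracket A X Z p + lie_bracket A Y Z p"
proof
  fix h
  show "lie_bracket A (X + Y) Z p h = (lie_bracket A X Z p + lie_bracket A Y Z p) h"
  proof (cases "smooth_near A p h")
    case True
    then show ?thesis
      using tangent_add_fun[OF vf_tangent[OF assms(3,5)] vf_smooth_near[OF assms(1,4,5) True]
          vf_smooth_near[OF assms(2,4,5) True]]
      by (simp add: lie_bracket_apply)
  qed (simp add: lie_bracket_not_smooth)
qed

text \<open>In the first term of the bracket \<open>a p\<close> is a mere factor; in the second,
  \<open>Z\<close> also differentiates \<open>a\<close>, which produces
  \<open>- Z p a\<close>.\<close>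

lemma lie_bracket_smult_left:
  assumes "X \<in> vector_fields A U" "Z \<in> vector_fields A U" "smooth_fun A U a" "open U" "p \<in> U" "U \<subseteq> carrier A"
  shows "lie_bracket A (\<lambda>q h. a q * X q h) Z p = (\<lambda>h. a p * lie_bracket A X Z p h - Z p a * X p h)"
proof
  fix h
  show "lie_bracket A (\<lambda>q h. a q * X q h) Z p h = a p * lie_bracket A X Z p h - Z p a * X p h"
  proof (cases "smooth_near A p h")
    case True
    then show ?thesis
      using tangent_mult_fun[OF vf_tangent[OF assms(2,5)] smooth_nearI[OF assms(3-6)]
          vf_smooth_near[OF assms(1,4,5) True]]
      by (simp add: lie_bracket_apply algebra_simps)
  qed (simp add: lie_bracket_not_smooth tangent_not_smooth[OF vf_tangent[OF assms(1,5)]])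
qed

end

section \<open>Orthonormal frames and tensors\<close>

locale pseudo_riemannian_mfd = smooth_mfd A
  for A :: "('a::{t2_space, second_countable_topology}, 'e::euclidean_space) atlas" +
  fixes g :: "'a metric"
  assumes metric: "pseudo_riemannian_metric A g"
begin

section \<open>Linear algebra of the metric\<close>

lemma
  assumes "u \<in> tangent_space A p" "v \<in> tangent_space A p"
  shows g_sym: "g p u v = g p v u"
    and g_scale_left: "g p (\<lambda>h. c * u h) v = c * g p u v"
    and g_add_left: "w \<in> tangent_space A p \<Longrightarrow> g p (u + v) w = g p u w + g p v w"
proof -
  note m = metric[unfolded pseudo_riemannian_metric_def, THEN conjunct1, THEN bspec, OF tangent_carrier[OF assms(1)],
    THEN bspec, OF assms(1), THEN bspec, OF assms(2)]
  show "g p u v = g p v u" "g p (\<lambda>h. c * u h) v = c * g p u v" using m by auto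
  show "g p (u + v) w = g p u w + g p v w" if "w \<in> tangent_space A p" using m that by auto
qed

lemma g_nondegenerate:
  assumes "u \<in> tangent_space A p" "\<And>v. v \<in> tangent_space A p \<Longrightarrow> g p u v = 0"
  shows "u = 0"
  by (rule metric[unfolded pseudo_riemannian_metric_def, THEN conjunct2, THEN conjunct1, THEN bspec,
        OF tangent_carrier[OF assms(1)], THEN bspec, OF assms(1), THEN mp])
    (use assms(2) in simp)

lemma g_smooth:
  assumes "X \<in> vector_fields A U" "Y \<in> vector_fields A U" "open U" "U \<subseteq> carrier A"
  shows "smooth_fun A U (\<lambda>p. g p (X p) (Y p))"
  using metric[unfolded pseudo_riemannian_metric_def, THEN conjunct2, THEN conjunct2, THEN spec, of U] assms
  by simp

lemma g_scale_right:
  "u \<in> tangent_space A p \<Longrightarrow> v \<in> tangent_space A p \<Longrightarrow> g p u (\<lambda>h. c * v h) = c * g p u v"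
  using g_sym g_scale_left tangent_scale by metis

lemma g_add_right:
  "u \<in> tangent_space A p \<Longrightarrow> v \<in> tangent_space A p \<Longrightarrow> w \<in> tangent_space A p \<Longrightarrow>
    g p w (u + v) = g p w u + g p w v"
  using g_sym g_add_left tangent_add by metis

lemma g_diff_left:
  assumes "u \<in> tangent_space A p" "v \<in> tangent_space A p" "w \<in> tangent_space A p"
  shows "g p (u - v) w = g p u w - g p v w"
  using g_add_left[OF assms(1) tangent_scale[OF assms(2), of "-1"] assms(3)]
    g_scale_left[OF assms(2,3), of "-1"]
  by (simp add: plus_fun_def fun_diff_def)

lemma g_zero_left: "v \<in> tangent_space A p \<Longrightarrow> g p (\<lambda>h. 0) v = 0"
  using g_scale_left[of v p v 0] by simp

lemma g_sum_left:
  assumes "finite J" "\<And>j. j \<in> J \<Longrightarrow> v j \<in> tangent_space A p" "w \<in> tangent_space A p"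
  shows "g p (\<lambda>h. \<Sum>j\<in>J. a j * v j h) w = (\<Sum>j\<in>J. a j * g p (v j) w)"
  using assms(1,2)
proof (induction J)
  case empty
  then show ?case using g_zero_left[OF assms(3)] by simp
next
  case (insert j J)
  have "(\<lambda>h. \<Sum>j\<in>insert j J. a j * v j h) = (\<lambda>h. a j * v j h) + (\<lambda>h. \<Sum>j\<in>J. a j * v j h)"
    using insert by (auto simp: plus_fun_def)
  then show ?case
    using insert assms(3) tangent_carrier[OF assms(3)]
    by (simp add: g_add_left g_scale_left tangent_scale tangent_sum)
qed

text \<open>The component of \<open>z\<close> along \<open>e i\<close> is
  \<open>g p z (e i) / \<epsilon> i\<close>, and \<open>1 / \<epsilon> i = \<epsilon> i\<close>.
  What remains after subtracting all components is orthogonal to the family.\<close>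

lemma projection:
  fixes k :: nat
  assumes e: "\<forall>i<k. e i \<in> tangent_space A p \<and> \<epsilon> i \<in> {1, -1}"
    and orth: "\<forall>i<k. \<forall>j<k. g p (e i) (e j) = (if i = j then \<epsilon> i else 0)"
    and z: "z \<in> tangent_space A p"
  shows "(\<lambda>h. z h - (\<Sum>i<k. \<epsilon> i * g p z (e i) * e i h)) \<in> tangent_space A p" (is "?z \<in> _")
    and "w \<in> tangent_space A p \<Longrightarrow>
      g p (\<lambda>h. z h - (\<Sum>i<k. \<epsilon> i * g p z (e i) * e i h)) w = g p z w - (\<Sum>i<k. \<epsilon> i * g p z (e i) * g p (e i) w)"
    and "j < k \<Longrightarrow> g p (\<lambda>h. z h - (\<Sum>i<k. \<epsilon> i * g p z (e i) * e i h)) (e j) = 0"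
proof -
  have s: "(\<lambda>h. \<Sum>i<k. \<epsilon> i * g p z (e i) * e i h) \<in> tangent_space A p"
    using e by (intro tangent_sum tangent_carrier[OF z]) auto
  then show "?z \<in> tangent_space A p"
    using tangent_diff[OF z] by (simp add: fun_diff_def)
  show *: "g p ?z w = g p z w - (\<Sum>i<k. \<epsilon> i * g p z (e i) * g p (e i) w)"
    if w: "w \<in> tangent_space A p" for w
    using g_diff_left[OF z s w] g_sum_left[OF _ _ w, of "{..<k}" e] e by (simp add: fun_diff_def)
  show "g p ?z (e j) = 0" if j: "j < k"
  proof -
    have "(\<Sum>i<k. \<epsilon> i * g p z (e i) * g p (e i) (e j)) = (\<Sum>i<k. if i = j then g p z (e j) else 0)"
      using e orth j by (intro sum.cong) auto
    then show ?thesis using *[of "e j"] e j by simp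
  qed
qed

text \<open>One step of Gram-Schmidt.  The orthogonal complement of the given vectors at \<open>p\<close> contains a
  non-null vector: otherwise \<open>g\<close> would vanish on it by polarization, so it would be \<open>0\<close> by nondegeneracy,
  and fewer than \<open>DIM('e)\<close> vectors would span the tangent space.\<close>

lemma frame_extend:
  assumes U: "open U" "p \<in> U" "U \<subseteq> carrier A" and k: "k < DIM('e)"
    and E': "\<forall>i<k. \<epsilon> i \<in> {1, -1} \<and> E i \<in> vector_fields A U"
    and orth': "\<forall>i<k. \<forall>j<k. \<forall>q\<in>U. g q (E i q) (E j q) = (if i = j then \<epsilon> i else 0)"
  obtains W s Y where "open W" "p \<in> W" "W \<subseteq> U" "s \<in> {1, -1}" "Y \<in> vector_fields A W"
    "\<And>q. q \<in> W \<Longrightarrow> g q (Y q) (Y q) = s" "\<And>i q. i < k \<Longrightarrow> q \<in> W \<Longrightarrow> g q (Y q) (E i q) = 0"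
proof -
  note E = E'[rule_format] and orth = orth'[rule_format]
  obtain V \<phi> where c: "(V, \<phi>) \<in> A" "p \<in> V" using U carrier_chart by blast
  let ?T = "tangent_space A p"
  have Ep: "\<forall>i<k. E i p \<in> ?T \<and> \<epsilon> i \<in> {1, -1}" using E vf_tangent U(2) by metis
  have op: "\<forall>i<k. \<forall>j<k. g p (E i p) (E j p) = (if i = j then \<epsilon> i else 0)" using orth U(2) by metis
  note proj = projection[of k "\<lambda>i. E i p" p \<epsilon>, OF Ep op]
  have "\<exists>w\<in>?T. (\<forall>i<k. g p w (E i p) = 0) \<and> g p w w \<noteq> 0"
  proof (rule ccontr)
    assume *: "\<not> (\<exists>w\<in>?T. (\<forall>i<k. g p w (E i p) = 0) \<and> g p w w \<noteq> 0)"
    have polar: "g p w w' = 0" if w: "w \<in> ?T" "\<forall>i<k. g p w (E i p) = 0" "w' \<in> ?T" "\<forall>i<k. g p w' (E i p) = 0" for w w'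
    proof -
      have "\<forall>i<k. g p (w + w') (E i p) = 0" using w Ep by (simp add: g_add_left)
      then have "g p (w + w') (w + w') = 0" using * tangent_add[OF w(1,3)] by blast
      moreover have "g p w w = 0" "g p w' w' = 0" using * w by blast+
      ultimately show ?thesis
        using w by (simp add: g_add_left g_add_right tangent_add g_sym[of w' p w])
    qed
    have null: "w = 0" if w: "w \<in> ?T" "\<forall>i<k. g p w (E i p) = 0" for w
    proof (rule g_nondegenerate[OF w(1)])
      fix z assume z: "z \<in> ?T"
      \<comment> \<open>Only the part of \<open>z\<close> orthogonal to the family falls under
        \<open>polar\<close>; the part along the family is orthogonal to \<open>w\<close> by
        assumption.\<close>
      have "g p (\<lambda>h. z h - (\<Sum>i<k. \<epsilon> i * g p z (E i p) * E i p h)) w = 0"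
        by (rule polar) (use proj z w in auto)
      moreover have "g p (E i p) w = 0" if "i < k" for i
        using g_sym[OF w(1), of "E i p"] w(2) Ep that by simp
      ultimately show "g p w z = 0"
        using proj(2)[OF z w(1)] g_sym[OF w(1) z] by simp
    qed
    have pz: "(\<lambda>h. z h - (\<Sum>i<k. \<epsilon> i * g p z (E i p) * E i p h)) = 0" if "z \<in> ?T" for z
      by (intro null proj(1)[OF that] allI impI proj(3)[OF that])
    then have exp: "z h = (\<Sum>i<k. \<epsilon> i * g p z (E i p) * E i p h)" if "z \<in> ?T" for z h
      using fun_cong[OF pz[OF that], of h] by simp
    have "\<exists>y. i < k \<longrightarrow> E i p = chart_vec A V \<phi> y p" for i
      using tangent_chart_vec[OF _ c, of "E i p"] Ep by metis
    then obtain u where u: "\<And>i. i < k \<Longrightarrow> E i p = chart_vec A V \<phi> (u i) p" by metis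
    have "y \<in> span (u ` {..<k})" for y
    proof -
      let ?z = "chart_vec A V \<phi> y p"
      have "y = (\<Sum>i<k. (\<epsilon> i * g p ?z (E i p)) *\<^sub>R u i)"
      proof (rule euclidean_eqI)
        fix b :: 'e
        show "y \<bullet> b = (\<Sum>i<k. (\<epsilon> i * g p ?z (E i p)) *\<^sub>R u i) \<bullet> b"
          using exp[OF chart_vec_tangent[OF c], of y "\<lambda>x. \<phi> x \<bullet> b"]
          by (simp add: u chart_vec_coord[OF c] inner_sum_left)
      qed
      also have "\<dots> \<in> span (u ` {..<k})" by (intro span_sum span_scale span_base) auto
      finally show ?thesis .
    qed
    then have "DIM('e) \<le> card (u ` {..<k})"
      using dim_le_card[of "UNIV :: 'e set" "u ` {..<k}"] by auto
    then show False using card_image_le[of "{..<k}" u] k by simp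
  qed
  then obtain w where w: "w \<in> ?T" "\<And>i. i < k \<Longrightarrow> g p w (E i p) = 0" "g p w w \<noteq> 0" by blast
  obtain u where u: "w = chart_vec A V \<phi> u p" using tangent_chart_vec[OF w(1) c] .
  define X where "X = chart_vec A V \<phi> u"
  define U1 where "U1 = U \<inter> V"
  have U1: "open U1" "p \<in> U1" "U1 \<subseteq> U" "U1 \<subseteq> carrier A"
    using U c chart_open by (auto simp: U1_def)
  have X: "X \<in> vector_fields A U1"
    unfolding X_def U1_def by (rule vf_subset[OF chart_vec_vf[OF c(1)]]) auto
  have E1: "E i \<in> vector_fields A U1" if "i < k" for i
    using E[OF that] U1(3) vf_subset by blast
  \<comment> \<open>The extension \<open>X\<close> of \<open>w\<close> is orthogonal to the family
    at \<open>p\<close> only. Projecting with coefficients that vary with \<open>q\<close> makes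
    this hold on all of \<open>U1\<close> and leaves the value at \<open>p\<close>
    unchanged.\<close>
  define Z where "Z = (\<lambda>q h. X q h - (\<Sum>i<k. \<epsilon> i * g q (X q) (E i q) * E i q h))"
  have "(\<lambda>q h. \<Sum>i<k. (\<epsilon> i * g q (X q) (E i q)) * E i q h) \<in> vector_fields A U1"
    using E1 X U1 by (intro vf_sum smooth_fun_cmult g_smooth) auto
  then have Z: "Z \<in> vector_fields A U1"
    using vf_diff[OF X] by (simp add: Z_def fun_diff_def)
  have Zp: "Z p = w" using w(2) by (auto simp: Z_def X_def u)
  have ZE: "g q (Z q) (E i q) = 0" if "q \<in> U1" "i < k" for q i
    unfolding Z_def
    by (rule projection(3)[where e="\<lambda>i. E i q"]) (use that E orth U1 vf_tangent[OF E1] vf_tangent[OF X] in auto)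
  define s where "s = sgn (g p w w)"
  define G where "G = (\<lambda>q. s * g q (Z q) (Z q))"
  have s: "s \<in> {1, -1}" using w(3) by (auto simp: s_def sgn_real_def)
  have G: "smooth_fun A U1 G" unfolding G_def using Z U1 by (intro smooth_fun_cmult g_smooth) auto
  \<comment> \<open>By the choice of the sign \<open>s\<close>, \<open>G\<close> is positive at
    \<open>p\<close>, hence on an open neighbourhood, where its power \<open>-1/2\<close> is
    smooth.\<close>
  define W where "W = {q \<in> U1. G q > 0}"
  have "open W"
    using continuous_open_preimage[OF smooth_fun_continuous[OF G U1(1,4)] U1(1), of "{0<..}"]
    by (simp add: W_def vimage_def Int_def)
  have W: "open W" "p \<in> W" "W \<subseteq> U1"
    using \<open>open W\<close> U1 w(3) by (auto simp: W_def G_def Zp s_def sgn_real_def)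
  define Y where "Y = (\<lambda>q h. G q powr (-1/2) * Z q h)"
  have tan: "Z q \<in> tangent_space A q" if "q \<in> W" for q using that vf_tangent[OF Z] W by auto
  show thesis
  proof (rule that[OF W(1,2) _ s])
    show "W \<subseteq> U" using W U1 by auto
    show "Y \<in> vector_fields A W"
      unfolding Y_def
      by (intro vf_smult smooth_fun_powr W vf_subset[OF Z] smooth_fun_subset[OF G]) (auto simp: W_def)
    show "g q (Y q) (E i q) = 0" if "i < k" "q \<in> W" for i q
      using that ZE W vf_tangent[OF E1] tan by (auto simp: Y_def g_scale_left subset_iff)
    show "g q (Y q) (Y q) = s" if q: "q \<in> W" for q
    proof -
      have "G q > 0" using q by (simp add: W_def)
      then have "G q powr (-1/2) * (G q powr (-1/2) * G q) = 1"
        by (simp add: powr_minus powr_half_sqrt field_simps flip: power2_eq_square)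
      moreover have "g q (Z q) (Z q) = s * G q" using s by (auto simp: G_def)
      moreover have "g q (Y q) (Y q) = G q powr (-1/2) * (G q powr (-1/2) * g q (Z q) (Z q))"
        using tan[OF q] by (simp add: Y_def g_scale_left g_scale_right tangent_scale)
      ultimately show ?thesis by (metis mult.commute mult.left_commute mult.right_neutral)
    qed
  qed
qed

lemma frame_exists:
  assumes "p \<in> carrier A"
  obtains U \<epsilon> E where "orthonormal_frame A g U \<epsilon> E" "p \<in> U"
proof -
  \<comment> \<open>The neighbourhood is quantified inside the induction because each Gram-Schmidt
    step may shrink it.\<close>
  have "\<exists>U \<epsilon> E. open U \<and> p \<in> U \<and> U \<subseteq> carrier A \<and>
      (\<forall>i<k. \<epsilon> i \<in> {1, -1} \<and> E i \<in> vector_fields A U) \<and>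
      (\<forall>i<k. \<forall>j<k. \<forall>q\<in>U. g q (E i q) (E j q) = (if i = j then \<epsilon> i else 0))"
    if "k \<le> DIM('e)" for k
    using that
  proof (induction k)
    case 0
    then show ?case using assms open_carrier by auto
  next
    case (Suc k)
    then obtain U \<epsilon> E where U: "open U" "p \<in> U" "U \<subseteq> carrier A"
      and E': "\<forall>i<k. \<epsilon> i \<in> {1, -1} \<and> E i \<in> vector_fields A U"
      and orth': "\<forall>i<k. \<forall>j<k. \<forall>q\<in>U. g q (E i q) (E j q) = (if i = j then \<epsilon> i else 0)"
      by fastforce
    note E = E'[rule_format] and orth = orth'[rule_format]
    obtain W s Y where W: "open W" "p \<in> W" "W \<subseteq> U" "s \<in> {1, -1}" "Y \<in> vector_fields A W"
      and Y: "\<And>q. q \<in> W \<Longrightarrow> g q (Y q) (Y q) = s" "\<And>i q. i < k \<Longrightarrow> q \<in> W \<Longrightarrow> g q (Y q) (E i q) = 0"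
      using frame_extend[OF U _ E' orth'] Suc.prems by (metis Suc_le_eq)
    have YE: "g q (E i q) (Y q) = 0" if "i < k" "q \<in> W" for i q
      using Y(2)[OF that] g_sym[of "E i q" q "Y q"] vf_tangent[OF W(5)] E[OF that(1)] vf_tangent that W(3)
      by (metis subsetD)
    have EW: "E i \<in> vector_fields A W" if "i < k" for i using E[OF that] vf_subset W(3) by blast
    show ?case
      by (rule exI[of _ W], rule exI[of _ "\<epsilon>(k := s)"], rule exI[of _ "E(k := Y)"])
        (use W U E EW orth Y YE in \<open>auto simp: less_Suc_eq subset_iff\<close>)
  qed
  from this[OF order_refl] obtain U \<epsilon> E where "open U" "p \<in> U" "U \<subseteq> carrier A"
    "\<forall>i<DIM('e). \<epsilon> i \<in> {1, -1} \<and> E i \<in> vector_fields A U"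
    "\<forall>i<DIM('e). \<forall>j<DIM('e). \<forall>q\<in>U. g q (E i q) (E j q) = (if i = j then \<epsilon> i else 0)"
    by blast
  then show thesis by (intro that[of U \<epsilon> E]) (simp_all add: orthonormal_frame_def)
qed

text \<open>The map \<open>N\<close> sends chart components to the inner products with the frame. It
  is onto, since a vector with prescribed inner products can be written down from the frame, hence
  injective by finite dimension. The remainder of \<open>z\<close> after projection has vanishing
  inner products, so it is zero. The bijection \<open>\<beta>\<close> only carries frame indices to
  basis vectors.\<close>

lemma frame_expand:
  assumes fr: "orthonormal_frame A g U \<epsilon> E" "p \<in> U" and z: "z \<in> tangent_space A p"
  shows "z = (\<lambda>h. \<Sum>i<DIM('e). \<epsilon> i * g p z (E i p) * E i p h)"
proof -
  let ?n = "DIM('e)"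
  have e: "\<forall>i<?n. E i p \<in> tangent_space A p \<and> \<epsilon> i \<in> {1, -1}"
    and orth: "\<forall>i<?n. \<forall>j<?n. g p (E i p) (E j p) = (if i = j then \<epsilon> i else 0)"
    using fr by (auto simp: orthonormal_frame_def intro: vf_tangent)
  note proj = projection[of ?n "\<lambda>i. E i p" p \<epsilon>, OF e orth z]
  obtain V \<phi> where c: "(V, \<phi>) \<in> A" "p \<in> V" using tangent_carrier[OF z] carrier_chart by blast
  have "\<exists>y. i < ?n \<longrightarrow> E i p = chart_vec A V \<phi> y p" for i
    using tangent_chart_vec[OF _ c, of "E i p"] e by metis
  then obtain u where u: "\<And>i. i < ?n \<Longrightarrow> E i p = chart_vec A V \<phi> (u i) p" by metis
  obtain \<beta> where \<beta>: "bij_betw \<beta> {..<?n} (Basis :: 'e set)"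
    using ex_bij_betw_nat_finite[of "Basis :: 'e set"] by (auto simp: atLeast0LessThan)
  define N where "N = (\<lambda>y. \<Sum>i<?n. g p (chart_vec A V \<phi> y p) (E i p) *\<^sub>R \<beta> i)"
  note l = chart_vec_linear[OF c]
  have gl: "linear (\<lambda>y. g p (chart_vec A V \<phi> y p) (E i p))" if "i < ?n" for i
  proof (rule linearI)
    show "g p (chart_vec A V \<phi> (x + y) p) (E i p) = g p (chart_vec A V \<phi> x p) (E i p) + g p (chart_vec A V \<phi> y p) (E i p)" for x y
      using g_add_left[OF chart_vec_tangent[OF c] chart_vec_tangent[OF c], of "E i p" x y] e that
      by (simp add: plus_fun_def flip: linear_add[OF l])
    show "g p (chart_vec A V \<phi> (r *\<^sub>R x) p) (E i p) = r *\<^sub>R g p (chart_vec A V \<phi> x p) (E i p)" for r x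
      using g_scale_left[OF chart_vec_tangent[OF c], of "E i p" r x] e that
      by (simp flip: linear_scale[OF l, unfolded real_scaleR_def])
  qed
  have "linear N"
    unfolding N_def
    by (intro linear_compose_sum ballI linear_compose[OF gl linear_scaleR_left, unfolded o_def]) simp
  moreover have "surj N"
  proof (rule surjI)
    fix y :: 'e
    have "N (\<Sum>i<?n. (\<epsilon> i * (y \<bullet> \<beta> i)) *\<^sub>R u i) = (\<Sum>j<?n. (y \<bullet> \<beta> j) *\<^sub>R \<beta> j)"
      unfolding N_def
    proof (intro sum.cong refl arg_cong[where f="\<lambda>r. r *\<^sub>R _"])
      fix j assume j: "j \<in> {..<?n}"
      have "g p (chart_vec A V \<phi> (\<Sum>i<?n. (\<epsilon> i * (y \<bullet> \<beta> i)) *\<^sub>R u i) p) (E j p)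
          = (\<Sum>i<?n. \<epsilon> i * (y \<bullet> \<beta> i) * g p (E i p) (E j p))"
        using j by (subst linear_sum[OF gl]) (auto simp: linear_scale[OF gl] simp flip: u)
      also have "\<dots> = (\<Sum>i<?n. if i = j then y \<bullet> \<beta> j else 0)"
        using j e orth by (intro sum.cong) auto
      finally show "g p (chart_vec A V \<phi> (\<Sum>i<?n. (\<epsilon> i * (y \<bullet> \<beta> i)) *\<^sub>R u i) p) (E j p) = y \<bullet> \<beta> j"
        using j by simp
    qed
    also have "\<dots> = (\<Sum>b\<in>Basis. (y \<bullet> b) *\<^sub>R b)"
      using \<beta> by (rule sum.reindex_bij_betw)
    finally show "N (\<Sum>i<?n. (\<epsilon> i * (y \<bullet> \<beta> i)) *\<^sub>R u i) = y"
      by (simp only: euclidean_representation)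
  qed
  ultimately have "inj N" by (rule linear_surjective_imp_injective) simp
  obtain y where y: "(\<lambda>h. z h - (\<Sum>i<?n. \<epsilon> i * g p z (E i p) * E i p h)) = chart_vec A V \<phi> y p"
    using tangent_chart_vec[OF proj(1) c] .
  have "N y = 0" unfolding N_def y[symmetric] using proj(3) by simp
  then have "y = 0" using \<open>inj N\<close> \<open>linear N\<close> linear_0 by (metis injD)
  then have "chart_vec A V \<phi> y p h = 0" for h using linear_0[OF l] by simp
  then show ?thesis using y by (metis (no_types, lifting) eq_iff_diff_eq_0 ext)
qed

end

section \<open>Tensoriality and traces over frames\<close>

definition near_vf :: "('a::topological_space, 'e::euclidean_space) atlas \<Rightarrow> 'a \<Rightarrow> 'a vfield set" where
  "near_vf A p = {X. \<exists>U. open U \<and> p \<in> U \<and> U \<subseteq> carrier A \<and> X \<in> vector_fields A U}"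

text \<open>Linearity over smooth functions, evaluated at one point, for functionals on fields
  rather than on tangent vectors. The open set is quantified because fields at \<open>p\<close> are
  smooth on different neighbourhoods.\<close>

definition tensorial :: "('a::topological_space, 'e::euclidean_space) atlas \<Rightarrow> 'a \<Rightarrow> ('a vfield \<Rightarrow> real) \<Rightarrow> bool" where
  "tensorial A p \<Phi> \<longleftrightarrow> (\<forall>U X Y a. open U \<and> p \<in> U \<and> U \<subseteq> carrier A \<and>
     X \<in> vector_fields A U \<and> Y \<in> vector_fields A U \<and> smooth_fun A U a \<longrightarrow>
     \<Phi> (X + Y) = \<Phi> X + \<Phi> Y \<and> \<Phi> (\<lambda>q h. a q * X q h) = a p * \<Phi> X)"

context smooth_mfd
begin

text \<open>Smoothness on \<open>U\<close> only concerns points of \<open>U\<close>, where the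
  indicator is the constant 1; so it can take the place of a bump function.\<close>

lemma smooth_fun_indicator: "open U \<Longrightarrow> smooth_fun A U (indicator U)"
  by (rule smooth_fun_cong[OF _ _ smooth_fun_const[of U 1]]) auto

text \<open>Multiplying with an indicator function turns fields that agree on \<open>U\<close> into equal ones.\<close>

lemma indicator_vf_eq:
  fixes X Y :: "'a vfield"
  assumes "\<And>q. q \<in> U \<Longrightarrow> X q = Y q"
  shows "(\<lambda>q h. indicator U q * X q h) = (\<lambda>q h. indicator U q * Y q h)"
  using assms by (auto simp: fun_eq_iff indicator_def)

lemma tensorial_add:
  assumes "tensorial A p \<Phi>" "open U" "p \<in> U" "U \<subseteq> carrier A" "X \<in> vector_fields A U" "Y \<in> vector_fields A U"
  shows "\<Phi> (X + Y) = \<Phi> X + \<Phi> Y"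
  using assms smooth_fun_const unfolding tensorial_def by blast

lemma tensorial_smult:
  assumes "tensorial A p \<Phi>" "open U" "p \<in> U" "U \<subseteq> carrier A" "X \<in> vector_fields A U" "smooth_fun A U a"
  shows "\<Phi> (\<lambda>q h. a q * X q h) = a p * \<Phi> X"
  using assms unfolding tensorial_def by blast

lemma tensorialI:
  assumes V: "open V" "p \<in> V"
    and *: "\<And>U X Y a. open U \<Longrightarrow> p \<in> U \<Longrightarrow> U \<subseteq> V \<Longrightarrow> U \<subseteq> carrier A \<Longrightarrow> X \<in> vector_fields A U \<Longrightarrow>
      Y \<in> vector_fields A U \<Longrightarrow> smooth_fun A U a \<Longrightarrow>
      \<Phi> (X + Y) = \<Phi> X + \<Phi> Y \<and> \<Phi> (\<lambda>q h. a q * X q h) = a p * \<Phi> X"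
  shows "tensorial A p \<Phi>"
  unfolding tensorial_def
proof (intro allI impI, elim conjE)
  fix U X Y a assume "open U" "p \<in> U" "U \<subseteq> carrier A" "X \<in> vector_fields A U" "Y \<in> vector_fields A U" "smooth_fun A U a"
  then show "\<Phi> (X + Y) = \<Phi> X + \<Phi> Y \<and> \<Phi> (\<lambda>q h. a q * X q h) = a p * \<Phi> X"
    using V by (intro *[of "U \<inter> V"]) (auto intro: vf_subset smooth_fun_subset)
qed

lemma tensorial_cong:
  assumes "tensorial A p \<Phi>" "open U" "p \<in> U" "U \<subseteq> carrier A" "X \<in> vector_fields A U"
    and "\<And>q. q \<in> U \<Longrightarrow> X q = Y q"
  shows "\<Phi> X = \<Phi> Y"
  using tensorial_smult[OF assms(1-5) smooth_fun_indicator[OF assms(2)]]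
    tensorial_smult[OF assms(1-4) vf_cong[OF assms(6,5)] smooth_fun_indicator[OF assms(2)]]
    indicator_vf_eq[OF assms(6)] assms(3) by simp

lemma tensorial_sum:
  assumes t: "tensorial A p \<Phi>" "open U" "p \<in> U" "U \<subseteq> carrier A"
    and "finite J" "\<And>j. j \<in> J \<Longrightarrow> X j \<in> vector_fields A U" "\<And>j. j \<in> J \<Longrightarrow> smooth_fun A U (a j)"
    and J: "J \<noteq> {}"
  shows "\<Phi> (\<lambda>q h. \<Sum>j\<in>J. a j q * X j q h) = (\<Sum>j\<in>J. a j p * \<Phi> (X j))"
  using assms(5) J assms(6,7)
proof (induction J rule: finite_ne_induct)
  case (singleton j)
  then show ?case using tensorial_smult[OF t] by simp
next
  case (insert j J)
  have "(\<lambda>q h. \<Sum>j\<in>insert j J. a j q * X j q h) = (\<lambda>q h. a j q * X j q h) + (\<lambda>q h. \<Sum>j\<in>J. a j q * X j q h)"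
    using insert by (auto simp: plus_fun_def)
  then show ?case
    using insert tensorial_add[OF t, of "\<lambda>q h. a j q * X j q h" "\<lambda>q h. \<Sum>j\<in>J. a j q * X j q h"]
      vf_smult[of "X j" U "a j"] vf_sum[of U J X a] tensorial_smult[OF t, of "X j" "a j"] t(4)
    by simp
qed

end

context pseudo_riemannian_mfd
begin

text \<open>Near \<open>p\<close> the field equals its frame expansion, whose coefficients are
  smooth, and the functional takes them out with their values at \<open>p\<close>. So
  \<open>\<Phi> X\<close> depends on \<open>X p\<close> alone.\<close>

lemma tensorial_frame:
  assumes t: "tensorial A p \<Phi>" and fr: "orthonormal_frame A g U \<epsilon> E" "p \<in> U" and X: "X \<in> near_vf A p"
  shows "\<Phi> X = (\<Sum>k<DIM('e). \<epsilon> k * g p (X p) (E k p) * \<Phi> (E k))"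
proof -
  obtain W where W: "open W" "p \<in> W" "W \<subseteq> carrier A" "X \<in> vector_fields A W"
    using X by (auto simp: near_vf_def)
  let ?U = "U \<inter> W"
  have U: "open ?U" "p \<in> ?U" "?U \<subseteq> carrier A" and XU: "X \<in> vector_fields A ?U"
    using W fr by (auto simp: orthonormal_frame_def intro: vf_subset[OF W(4)])
  have EU: "E k \<in> vector_fields A ?U" if "k < DIM('e)" for k
    using fr that by (auto simp: orthonormal_frame_def intro: vf_subset)
  have a: "smooth_fun A ?U (\<lambda>q. \<epsilon> k * g q (X q) (E k q))" if "k < DIM('e)" for k
    using U XU EU[OF that] by (intro smooth_fun_cmult g_smooth)
  have "X q = (\<lambda>h. \<Sum>k<DIM('e). \<epsilon> k * g q (X q) (E k q) * E k q h)" if "q \<in> ?U" for q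
    using frame_expand[OF fr(1), of q "X q"] that vf_tangent[OF XU that] by auto
  then have "\<Phi> X = \<Phi> (\<lambda>q h. \<Sum>k<DIM('e). \<epsilon> k * g q (X q) (E k q) * E k q h)"
    by (rule tensorial_cong[OF t U XU])
  also have "\<dots> = (\<Sum>k<DIM('e). \<epsilon> k * g p (X p) (E k p) * \<Phi> (E k))"
    by (rule tensorial_sum[OF t U, of "{..<DIM('e)}" E "\<lambda>k q. \<epsilon> k * g q (X q) (E k q)"])
      (use EU a in \<open>auto simp: lessThan_empty_iff\<close>)
  finally show ?thesis .
qed

lemma frame_near: "orthonormal_frame A g U \<epsilon> E \<Longrightarrow> p \<in> U \<Longrightarrow> k < DIM('e) \<Longrightarrow> E k \<in> near_vf A p"
  by (auto simp: orthonormal_frame_def near_vf_def)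

text \<open>Expand the first argument \<open>E' k\<close> in the frame \<open>E\<close> and swap the
  sums. The inner sum over \<open>k\<close> is then the expansion of \<open>E i\<close> in the frame
  \<open>E'\<close>, standing in the second argument, and collapses to
  \<open>\<Phi> (E i) (E i)\<close>.\<close>

lemma trace_frame_independent:
  assumes t: "\<And>X. X \<in> near_vf A p \<Longrightarrow> tensorial A p (\<Phi> X)" "\<And>X. X \<in> near_vf A p \<Longrightarrow> tensorial A p (\<lambda>Y. \<Phi> Y X)"
    and fr: "orthonormal_frame A g U \<epsilon> E" "p \<in> U"
    and fr': "orthonormal_frame A g U' \<epsilon>' E'" "p \<in> U'"
  shows "(\<Sum>k<DIM('e). \<epsilon>' k * \<Phi> (E' k) (E' k)) = (\<Sum>k<DIM('e). \<epsilon> k * \<Phi> (E k) (E k))"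
proof -
  let ?n = "DIM('e)"
  note n = frame_near[OF fr] and n' = frame_near[OF fr']
  have sym: "g p (E' k p) (E i p) = g p (E i p) (E' k p)" if "i < ?n" "k < ?n" for i k
    using fr fr' that by (intro g_sym) (auto simp: orthonormal_frame_def intro: vf_tangent)
  have "(\<Sum>k<?n. \<epsilon>' k * \<Phi> (E' k) (E' k)) =
      (\<Sum>k<?n. \<Sum>i<?n. \<epsilon> i * (\<epsilon>' k * g p (E i p) (E' k p) * \<Phi> (E i) (E' k)))"
    by (intro sum.cong refl) (simp add: tensorial_frame[OF t(2) fr] n' sym sum_distrib_left mult_ac)
  also have "\<dots> = (\<Sum>i<?n. \<epsilon> i * (\<Sum>k<?n. \<epsilon>' k * g p (E i p) (E' k p) * \<Phi> (E i) (E' k)))"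
    by (subst sum.swap) (simp add: sum_distrib_left)
  also have "\<dots> = (\<Sum>i<?n. \<epsilon> i * \<Phi> (E i) (E i))"
    by (intro sum.cong refl) (simp add: tensorial_frame[OF t(1) fr', symmetric] n)
  finally show ?thesis .
qed

end

section \<open>Connections and curvature\<close>

text \<open>Closure under brackets is an assumption so that connections with torsion fit as well. A
  Levi-Civita connection provides it by writing the bracket as \<open>D X Y - D Y X\<close>; the
  quarter-symmetric connection takes it over from there.\<close>

locale connection_mfd = pseudo_riemannian_mfd A g
  for A :: "('a::{t2_space, second_countable_topology}, 'e::euclidean_space) atlas" and g +
  fixes D :: "'a connection"
  assumes conn: "affine_connection A D"
    and lie_bracket_vf: "\<And>U X Y. open U \<Longrightarrow> U \<subseteq> carrier A \<Longrightarrow>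
      X \<in> vector_fields A U \<Longrightarrow> Y \<in> vector_fields A U \<Longrightarrow> lie_bracket A X Y \<in> vector_fields A U"
begin

context
  fixes U
  assumes U: "open U" "U \<subseteq> carrier A"
begin

lemma D_vf: "X \<in> vector_fields A U \<Longrightarrow> Y \<in> vector_fields A U \<Longrightarrow> D X Y \<in> vector_fields A U"
  using conn[unfolded affine_connection_def, THEN spec, of U] U by simp

lemma
  assumes "X \<in> vector_fields A U" "Y \<in> vector_fields A U" "p \<in> U"
  shows D_add_left: "Z \<in> vector_fields A U \<Longrightarrow> D (X + Y) Z p = D X Z p + D Y Z p"
    and D_add_right: "Z \<in> vector_fields A U \<Longrightarrow> D X (Y + Z) p = D X Y p + D X Z p"
    and D_smult_left: "smooth_fun A U a \<Longrightarrow> D (\<lambda>q h. a q * X q h) Y p = (\<lambda>h. a p * D X Y p h)"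
    and D_smult_right: "smooth_fun A U a \<Longrightarrow>
      D X (\<lambda>q h. a q * Y q h) p = (\<lambda>h. X p a * Y p h + a p * D X Y p h)"
  using conn[unfolded affine_connection_def, THEN spec, of U, THEN mp, OF conjI[OF U],
      THEN bspec, OF assms(1), THEN bspec, OF assms(2)] assms(3)
  by auto

end

text \<open>The factor \<open>indicator U\<close> can be inserted in either argument without
  changing the value at \<open>p\<close>: it is 1 at \<open>p\<close>, and its derivative there
  vanishes because it is constant on \<open>U\<close>. Once it is inserted, fields that agree on
  \<open>U\<close> are the same function.\<close>

lemma D_cong:
  assumes U: "open U" "U \<subseteq> carrier A" "p \<in> U"
    and X: "X \<in> vector_fields A U" "\<And>q. q \<in> U \<Longrightarrow> X q = X' q"
    and Y: "Y \<in> vector_fields A U" "\<And>q. q \<in> U \<Longrightarrow> Y q = Y' q"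
  shows "D X Y p = D X' Y' p"
proof -
  note i = smooth_fun_indicator[OF U(1)]
  have X': "X' \<in> vector_fields A U" and Y': "Y' \<in> vector_fields A U"
    using vf_cong X Y by metis+
  have 0: "Z p (indicator U) = 0" if "Z \<in> vector_fields A U" for Z
    using tangent_germ[OF vf_tangent[OF that U(3)] U(1,3), of "indicator U" "\<lambda>_. 1"]
      tangent_const[OF vf_tangent[OF that U(3)]] by simp
  have l: "D Z W p = D (\<lambda>q h. indicator U q * Z q h) W p"
    and r: "D Z W p = D Z (\<lambda>q h. indicator U q * W q h) p"
    if "Z \<in> vector_fields A U" "W \<in> vector_fields A U" for Z W
    using D_smult_left[OF U(1,2) that U(3) i] D_smult_right[OF U(1,2) that U(3) i] 0[OF that(1)] U(3)
    by simp_all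
  have "D X Y p = D (\<lambda>q h. indicator U q * X' q h) Y p"
    using l[OF X(1) Y(1)] indicator_vf_eq[OF X(2)] by simp
  also have "\<dots> = D X' (\<lambda>q h. indicator U q * Y' q h) p"
    using l[OF X' Y(1)] r[OF X' Y(1)] indicator_vf_eq[OF Y(2)] by simp
  also have "\<dots> = D X' Y' p"
    using r[OF X' Y'] by simp
  finally show ?thesis .
qed

section \<open>Linearity of the curvature over smooth functions\<close>

lemma curvature_apply:
  "curvature A D X Y Z p h = D X (D Y Z) p h - D Y (D X Z) p h - D (lie_bracket A X Y) Z p h"
  by (simp add: curvature_def)

context
  fixes U
  assumes U: "open U" "U \<subseteq> carrier A"
begin

lemma curvature_vf:
  "X \<in> vector_fields A U \<Longrightarrow> Y \<in> vector_fields A U \<Longrightarrow> Z \<in> vector_fields A U \<Longrightarrow>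
    curvature A D X Y Z \<in> vector_fields A U"
  unfolding curvature_def by (intro vf_diff D_vf lie_bracket_vf U)

text \<open>Reduces linearity in the second slot to linearity in the first.\<close>

lemma curvature_flip:
  assumes "X \<in> vector_fields A U" "Y \<in> vector_fields A U" "Z \<in> vector_fields A U" "p \<in> U"
  shows "curvature A D Y X Z p = (\<lambda>h. - curvature A D X Y Z p h)"
proof -
  have "lie_bracket A Y X = (\<lambda>q h. -1 * lie_bracket A X Y q h)"
    by (intro ext) (simp add: lie_bracket_flip[where X=X and Y=Y])
  then have "D (lie_bracket A Y X) Z p = (\<lambda>h. -1 * D (lie_bracket A X Y) Z p h)"
    using D_smult_left[OF U lie_bracket_vf[OF U assms(1,2)] assms(3,4) smooth_fun_const[of U "-1"]] by simp
  then show ?thesis by (auto simp: curvature_apply)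
qed

text \<open>The derivative \<open>Y p a\<close> arises twice, from \<open>D Y\<close> acting on
  \<open>a * D X Z\<close> and from the bracket of \<open>a * X\<close> with \<open>Y\<close>, which
  is \<open>a\<close> times the bracket minus \<open>Y a\<close> times \<open>X\<close>; the two
  contributions cancel.\<close>

lemma curvature_smult_1:
  assumes "X \<in> vector_fields A U" "Y \<in> vector_fields A U" "Z \<in> vector_fields A U" "p \<in> U" "smooth_fun A U a"
  shows "curvature A D (\<lambda>q h. a q * X q h) Y Z p = (\<lambda>h. a p * curvature A D X Y Z p h)"
proof -
  let ?aX = "\<lambda>q h. a q * X q h"
  have aX: "?aX \<in> vector_fields A U" by (intro vf_smult assms)
  have xy: "lie_bracket A X Y \<in> vector_fields A U" by (intro lie_bracket_vf U assms)
  have Ya: "smooth_fun A U (\<lambda>q. - Y q a)"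
    by (rule smooth_fun_minus[OF U(1) vf_smooth[OF assms(2) U(1) order_refl assms(5)]])
  have 1: "D ?aX (D Y Z) p = (\<lambda>h. a p * D X (D Y Z) p h)"
    by (intro D_smult_left[OF U] D_vf U assms)
  have "D Y (D ?aX Z) p = D Y (\<lambda>q h. a q * D X Z q h) p"
    using assms aX by (intro D_cong[OF U] D_vf[OF U] D_smult_left[OF U]) auto
  also have "\<dots> = (\<lambda>h. Y p a * D X Z p h + a p * D Y (D X Z) p h)"
    using assms by (intro D_smult_right[OF U] D_vf[OF U]) auto
  finally have 2: "D Y (D ?aX Z) p = (\<lambda>h. Y p a * D X Z p h + a p * D Y (D X Z) p h)" .
  have "lie_bracket A ?aX Y q = ((\<lambda>q h. a q * lie_bracket A X Y q h) + (\<lambda>q h. - Y q a * X q h)) q" if "q \<in> U" for q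
    using lie_bracket_smult_left[OF assms(1,2,5) U(1) that U(2)] by (auto simp: plus_fun_def)
  then have "D (lie_bracket A ?aX Y) Z p = D ((\<lambda>q h. a q * lie_bracket A X Y q h) + (\<lambda>q h. - Y q a * X q h)) Z p"
    using assms aX by (intro D_cong[OF U] lie_bracket_vf[OF U]) auto
  also have "\<dots> = D (\<lambda>q h. a q * lie_bracket A X Y q h) Z p + D (\<lambda>q h. - Y q a * X q h) Z p"
    using assms xy Ya by (intro D_add_left[OF U] vf_smult) auto
  also have "\<dots> = (\<lambda>h. a p * D (lie_bracket A X Y) Z p h) + (\<lambda>h. - Y p a * D X Z p h)"
    using D_smult_left[OF U xy assms(3,4,5)] D_smult_left[OF U assms(1,3,4) Ya] by simp
  finally show ?thesis
    using 1 2 by (auto simp: curvature_apply algebra_simps)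
qed

lemma curvature_add_1:
  assumes "X \<in> vector_fields A U" "Y \<in> vector_fields A U" "Z \<in> vector_fields A U" "X' \<in> vector_fields A U" "p \<in> U"
  shows "curvature A D (X + X') Y Z p = curvature A D X Y Z p + curvature A D X' Y Z p"
proof -
  have 1: "D (X + X') (D Y Z) p = D X (D Y Z) p + D X' (D Y Z) p"
    using assms by (intro D_add_left[OF U] D_vf[OF U]) auto
  have "D Y (D (X + X') Z) p = D Y (D X Z + D X' Z) p"
    using assms by (intro D_cong[OF U] D_vf[OF U] vf_add) (auto simp: D_add_left[OF U])
  also have "\<dots> = D Y (D X Z) p + D Y (D X' Z) p"
    using assms by (intro D_add_right[OF U] D_vf[OF U]) auto
  finally have 2: "D Y (D (X + X') Z) p = D Y (D X Z) p + D Y (D X' Z) p" .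
  have "D (lie_bracket A (X + X') Y) Z p = D (lie_bracket A X Y + lie_bracket A X' Y) Z p"
    using assms by (intro D_cong[OF U] lie_bracket_vf[OF U] vf_add)
      (auto simp: lie_bracket_add_left[OF assms(1,4,2) U(1)])
  also have "\<dots> = D (lie_bracket A X Y) Z p + D (lie_bracket A X' Y) Z p"
    using assms by (intro D_add_left[OF U] lie_bracket_vf[OF U]) auto
  finally show ?thesis
    using 1 2 by (auto simp: curvature_apply)
qed

lemma curvature_smult_2:
  assumes "X \<in> vector_fields A U" "Y \<in> vector_fields A U" "Z \<in> vector_fields A U" "p \<in> U" "smooth_fun A U a"
  shows "curvature A D X (\<lambda>q h. a q * Y q h) Z p = (\<lambda>h. a p * curvature A D X Y Z p h)"
  using curvature_flip[OF vf_smult[OF assms(2,5)] assms(1,3,4)]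
    curvature_smult_1[OF assms(2,1,3,4,5)] curvature_flip[OF assms(1-4)] by simp

lemma curvature_add_2:
  assumes "X \<in> vector_fields A U" "Y \<in> vector_fields A U" "Z \<in> vector_fields A U" "Y' \<in> vector_fields A U" "p \<in> U"
  shows "curvature A D X (Y + Y') Z p = curvature A D X Y Z p + curvature A D X Y' Z p"
  using curvature_flip[OF vf_add[OF assms(2,4)] assms(1,3,5)] curvature_add_1[OF assms(2,1,3,4,5)]
    curvature_flip[OF assms(1-3,5)] curvature_flip[OF assms(1,4,3,5)] by (auto simp: plus_fun_def)

text \<open>The products of one derivative of \<open>a\<close> with one derivative of
  \<open>Z\<close> are symmetric in \<open>X\<close> and \<open>Y\<close> and cancel. The second
  derivatives of \<open>a\<close> leave the commutator of \<open>X\<close> and \<open>Y\<close> on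
  \<open>a\<close>, which the bracket term removes.\<close>

lemma curvature_smult_3:
  assumes "X \<in> vector_fields A U" "Y \<in> vector_fields A U" "Z \<in> vector_fields A U" "p \<in> U" "smooth_fun A U a"
  shows "curvature A D X Y (\<lambda>q h. a q * Z q h) p = (\<lambda>h. a p * curvature A D X Y Z p h)"
proof -
  let ?aZ = "\<lambda>q h. a q * Z q h"
  have aZ: "?aZ \<in> vector_fields A U" by (intro vf_smult assms)
  have 1: "D X (D Y ?aZ) p h = X p (\<lambda>q. Y q a) * Z p h + Y p a * D X Z p h + (X p a * D Y Z p h + a p * D X (D Y Z) p h)"
    if X: "X \<in> vector_fields A U" and Y: "Y \<in> vector_fields A U" for X Y h
  proof -
    have Ya: "smooth_fun A U (\<lambda>q. Y q a)" by (rule vf_smooth[OF Y U(1) order_refl assms(5)])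
    have "D X (D Y ?aZ) p = D X ((\<lambda>q h. Y q a * Z q h) + (\<lambda>q h. a q * D Y Z q h)) p"
      using X Y aZ assms(3-5) by (intro D_cong[OF U] D_vf[OF U]) (auto simp: D_smult_right[OF U] plus_fun_def)
    also have "\<dots> = D X (\<lambda>q h. Y q a * Z q h) p + D X (\<lambda>q h. a q * D Y Z q h) p"
      using X Y assms(3-5) Ya by (intro D_add_right[OF U] vf_smult D_vf[OF U]) auto
    finally show ?thesis
      using D_smult_right[OF U X assms(3,4) Ya] D_smult_right[OF U X D_vf[OF U Y assms(3)] assms(4,5)] by simp
  qed
  have "D (lie_bracket A X Y) ?aZ p h = (X p (\<lambda>q. Y q a) - Y p (\<lambda>q. X q a)) * Z p h + a p * D (lie_bracket A X Y) Z p h" for h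
    using D_smult_right[OF U lie_bracket_vf[OF U assms(1,2)] assms(3,4,5)]
      lie_bracket_apply[OF smooth_nearI[OF assms(5) U(1) assms(4) U(2)]] by simp
  then show ?thesis
    using 1[OF assms(1,2)] 1[OF assms(2,1)] by (auto simp: curvature_apply algebra_simps)
qed

lemma curvature_add_3:
  assumes "X \<in> vector_fields A U" "Y \<in> vector_fields A U" "Z \<in> vector_fields A U" "Z' \<in> vector_fields A U" "p \<in> U"
  shows "curvature A D X Y (Z + Z') p = curvature A D X Y Z p + curvature A D X Y Z' p"
proof -
  have 1: "D X (D Y (Z + Z')) p = D X (D Y Z) p + D X (D Y Z') p"
    if X: "X \<in> vector_fields A U" and Y: "Y \<in> vector_fields A U" for X Y
  proof -
    have "D X (D Y (Z + Z')) p = D X (D Y Z + D Y Z') p"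
      using X Y assms(3-5) by (intro D_cong[OF U] D_vf[OF U] vf_add) (auto simp: D_add_right[OF U])
    also have "\<dots> = D X (D Y Z) p + D X (D Y Z') p"
      using X Y assms(3-5) by (intro D_add_right[OF U] D_vf[OF U]) auto
    finally show ?thesis .
  qed
  show ?thesis
    using 1[OF assms(1,2)] 1[OF assms(2,1)] D_add_right[OF U lie_bracket_vf[OF U assms(1,2)] assms(3,5,4)]
    by (auto simp: curvature_apply)
qed

end

lemma curvature_tensorial:
  assumes near: "X \<in> near_vf A p" "Y \<in> near_vf A p" "Z \<in> near_vf A p" "W \<in> near_vf A p"
  shows "tensorial A p (\<lambda>X. g p (curvature A D X Y Z p) (W p))"
    and "tensorial A p (\<lambda>Y. g p (curvature A D X Y Z p) (W p))"
    and "tensorial A p (\<lambda>Z. g p (curvature A D X Y Z p) (W p))"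
    and "tensorial A p (\<lambda>W. g p (curvature A D X Y Z p) (W p))"
proof -
  obtain V1 V2 V3 V4 where V: "open V1" "p \<in> V1" "V1 \<subseteq> carrier A" "X \<in> vector_fields A V1"
      "open V2" "p \<in> V2" "Y \<in> vector_fields A V2" "open V3" "p \<in> V3" "Z \<in> vector_fields A V3"
      "open V4" "p \<in> V4" "W \<in> vector_fields A V4"
    using near by (auto simp: near_vf_def)
  \<comment> \<open>The four arguments are smooth on different neighbourhoods of \<open>p\<close>;
    by \<open>tensorialI\<close> it is enough to test inside their intersection.\<close>
  define V where "V = V1 \<inter> V2 \<inter> V3 \<inter> V4"
  have V0: "open V" "p \<in> V" using V by (auto simp: V_def)
  have vf: "X \<in> vector_fields A U" "Y \<in> vector_fields A U" "Z \<in> vector_fields A U" "W \<in> vector_fields A U"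
    if "U \<subseteq> V" for U
    using that by (auto simp: V_def intro: vf_subset[OF V(4)] vf_subset[OF V(7)] vf_subset[OF V(10)] vf_subset[OF V(13)])
  show "tensorial A p (\<lambda>X. g p (curvature A D X Y Z p) (W p))"
  proof (rule tensorialI[OF V0], goal_cases)
    case (1 U)
    note u = 1(1,4) and t = vf_tangent[OF _ 1(2)]
    show ?case
      using 1 vf[OF 1(3)] t[OF curvature_vf[OF u]] t
      by (simp add: curvature_add_1[OF u] curvature_smult_1[OF u] g_add_left g_scale_left)
  qed
  show "tensorial A p (\<lambda>Y. g p (curvature A D X Y Z p) (W p))"
  proof (rule tensorialI[OF V0], goal_cases)
    case (1 U)
    note u = 1(1,4) and t = vf_tangent[OF _ 1(2)]
    show ?case
      using 1 vf[OF 1(3)] t[OF curvature_vf[OF u]] t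
      by (simp add: curvature_add_2[OF u] curvature_smult_2[OF u] g_add_left g_scale_left)
  qed
  show "tensorial A p (\<lambda>Z. g p (curvature A D X Y Z p) (W p))"
  proof (rule tensorialI[OF V0], goal_cases)
    case (1 U)
    note u = 1(1,4) and t = vf_tangent[OF _ 1(2)]
    show ?case
      using 1 vf[OF 1(3)] t[OF curvature_vf[OF u]] t
      by (simp add: curvature_add_3[OF u] curvature_smult_3[OF u] g_add_left g_scale_left)
  qed
  show "tensorial A p (\<lambda>W. g p (curvature A D X Y Z p) (W p))"
  proof (rule tensorialI[OF V0], goal_cases)
    case (1 U)
    note u = 1(1,4) and t = vf_tangent[OF _ 1(2)]
    show ?case
      using 1 vf[OF 1(3)] t[OF curvature_vf[OF u]] t
      by (simp add: g_add_right g_scale_right)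
  qed
qed

section \<open>Ricci tensor and scalar curvature in a frame\<close>

lemma ricci_frame:
  assumes "X \<in> near_vf A p" "Z \<in> near_vf A p" and fr: "orthonormal_frame A g U \<epsilon> E" "p \<in> U"
  shows "ricci A g D X Z p = (\<Sum>k<DIM('e). \<epsilon> k * g p (curvature A D X (E k) Z p) (E k p))"
  unfolding ricci_def
proof (rule the_equality)
  show "\<exists>U \<epsilon>' E'. orthonormal_frame A g U \<epsilon>' E' \<and> p \<in> U \<and>
      (\<Sum>k<DIM('e). \<epsilon> k * g p (curvature A D X (E k) Z p) (E k p)) =
      (\<Sum>k<DIM('e). \<epsilon>' k * g p (curvature A D X (E' k) Z p) (E' k p))"
    using fr by blast
next
  fix r assume "\<exists>U \<epsilon> E. orthonormal_frame A g U \<epsilon> E \<and> p \<in> U \<and>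
      r = (\<Sum>k<DIM('e). \<epsilon> k * g p (curvature A D X (E k) Z p) (E k p))"
  then obtain U' \<epsilon>' E' where fr': "orthonormal_frame A g U' \<epsilon>' E'" "p \<in> U'"
    and r: "r = (\<Sum>k<DIM('e). \<epsilon>' k * g p (curvature A D X (E' k) Z p) (E' k p))" by blast
  \<comment> \<open>For fixed \<open>X\<close> and \<open>Z\<close> the pairing is tensorial in the
    two slots over which the trace runs, so every frame gives the same number.\<close>
  show "r = (\<Sum>k<DIM('e). \<epsilon> k * g p (curvature A D X (E k) Z p) (E k p))"
    unfolding r
    by (rule trace_frame_independent[OF _ _ fr fr', where \<Phi>="\<lambda>Y W. g p (curvature A D X Y Z p) (W p)"])
      (use assms curvature_tensorial(2,4) in blast)+
qed

lemma tensorial_linear_combination: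
  assumes "\<And>k. k \<in> J \<Longrightarrow> tensorial A p (\<Phi> k)"
  shows "tensorial A p (\<lambda>X. \<Sum>k\<in>J. c k * \<Phi> k X)"
  unfolding tensorial_def
proof (intro allI impI, elim conjE)
  fix U X Y a assume a: "open U" "p \<in> U" "U \<subseteq> carrier A" "X \<in> vector_fields A U" "Y \<in> vector_fields A U" "smooth_fun A U a"
  show "(\<Sum>k\<in>J. c k * \<Phi> k (X + Y)) = (\<Sum>k\<in>J. c k * \<Phi> k X) + (\<Sum>k\<in>J. c k * \<Phi> k Y) \<and>
      (\<Sum>k\<in>J. c k * \<Phi> k (\<lambda>q h. a q * X q h)) = a p * (\<Sum>k\<in>J. c k * \<Phi> k X)"
    using tensorial_add[OF assms a(1-5)] tensorial_smult[OF assms a(1-4) a(6)]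
    by (simp add: distrib_left sum.distrib sum_distrib_left mult.left_commute)
qed

text \<open>\<open>ricci\<close> is a description and is known to equal the trace formula only for
  fields smooth near \<open>p\<close>; tensoriality tests no others.\<close>

lemma tensorial_cong_near:
  assumes "tensorial A p \<Phi>" "\<And>X. X \<in> near_vf A p \<Longrightarrow> \<Psi> X = \<Phi> X"
  shows "tensorial A p \<Psi>"
  unfolding tensorial_def
proof (intro allI impI, elim conjE)
  fix U X Y a assume a: "open U" "p \<in> U" "U \<subseteq> carrier A" "X \<in> vector_fields A U" "Y \<in> vector_fields A U" "smooth_fun A U a"
  have "X \<in> near_vf A p" "Y \<in> near_vf A p" "X + Y \<in> near_vf A p" "(\<lambda>q h. a q * X q h) \<in> near_vf A p"
    using a vf_add[OF a(4,5)] vf_smult[OF a(4,6)] by (auto simp: near_vf_def)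
  then show "\<Psi> (X + Y) = \<Psi> X + \<Psi> Y \<and> \<Psi> (\<lambda>q h. a q * X q h) = a p * \<Psi> X"
    using assms(2) tensorial_add[OF assms(1) a(1-5)] tensorial_smult[OF assms(1) a(1-4) a(6)] by simp
qed

lemma ricci_tensorial:
  assumes "X \<in> near_vf A p"
  shows "tensorial A p (\<lambda>Z. ricci A g D X Z p)" "tensorial A p (\<lambda>Z. ricci A g D Z X p)"
proof -
  have "p \<in> carrier A" using assms by (auto simp: near_vf_def)
  then obtain U \<epsilon> E where fr: "orthonormal_frame A g U \<epsilon> E" "p \<in> U" using frame_exists by blast
  note n = frame_near[OF fr]
  show "tensorial A p (\<lambda>Z. ricci A g D X Z p)"
    by (rule tensorial_cong_near[OF tensorial_linear_combination[of "{..<DIM('e)}"] ricci_frame[OF assms _ fr]])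
      (use n assms curvature_tensorial(3) in blast)+
  show "tensorial A p (\<lambda>Z. ricci A g D Z X p)"
    by (rule tensorial_cong_near[OF tensorial_linear_combination[of "{..<DIM('e)}"] ricci_frame[OF _ assms fr]])
      (use n assms curvature_tensorial(1) in blast)+
qed

text \<open>Each Ricci value may be evaluated in the frame of the outer trace, which turns the two
  nested descriptions into one double sum.\<close>

lemma scalar_curvature_frame:
  assumes fr: "orthonormal_frame A g U \<epsilon> E" "p \<in> U"
  shows "scalar_curvature A g D p =
    (\<Sum>j<DIM('e). \<Sum>k<DIM('e). \<epsilon> j * \<epsilon> k * g p (curvature A D (E j) (E k) (E j) p) (E k p))"
proof -
  have "scalar_curvature A g D p = (\<Sum>k<DIM('e). \<epsilon> k * ricci A g D (E k) (E k) p)"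
    unfolding scalar_curvature_def
  proof (rule the_equality)
    show "\<exists>U \<epsilon>' E'. orthonormal_frame A g U \<epsilon>' E' \<and> p \<in> U \<and>
        (\<Sum>k<DIM('e). \<epsilon> k * ricci A g D (E k) (E k) p) = (\<Sum>k<DIM('e). \<epsilon>' k * ricci A g D (E' k) (E' k) p)"
      using fr by blast
  next
    fix r assume "\<exists>U \<epsilon> E. orthonormal_frame A g U \<epsilon> E \<and> p \<in> U \<and>
        r = (\<Sum>k<DIM('e). \<epsilon> k * ricci A g D (E k) (E k) p)"
    then obtain U' \<epsilon>' E' where fr': "orthonormal_frame A g U' \<epsilon>' E'" "p \<in> U'"
      and r: "r = (\<Sum>k<DIM('e). \<epsilon>' k * ricci A g D (E' k) (E' k) p)" by blast
    show "r = (\<Sum>k<DIM('e). \<epsilon> k * ricci A g D (E k) (E k) p)"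
      unfolding r
      by (rule trace_frame_independent[OF _ _ fr fr', where \<Phi>="\<lambda>Y W. ricci A g D Y W p"])
        (use ricci_tensorial in blast)+
  qed
  also have "\<dots> = (\<Sum>j<DIM('e). \<Sum>k<DIM('e). \<epsilon> j * \<epsilon> k * g p (curvature A D (E j) (E k) (E j) p) (E k p))"
    by (intro sum.cong refl) (simp add: ricci_frame[OF _ _ fr] frame_near[OF fr] sum_distrib_left mult.assoc)
  finally show ?thesis .
qed

end

section \<open>Warped products\<close>

lemma smooth_on_fst:
  fixes h :: "'a::euclidean_space \<Rightarrow> 'c::real_normed_vector"
  assumes "open S" "open (T :: 'b::euclidean_space set)" "smooth_on S h"
  shows "smooth_on (S \<times> T) (\<lambda>z. h (fst z))"
  using assms
  by (intro smooth_on_compose[OF _ smooth_on_bounded_linear[OF _ bounded_linear_fst] assms(3)] open_Times) auto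

lemma smooth_on_snd:
  fixes h :: "'b::euclidean_space \<Rightarrow> 'c::real_normed_vector"
  assumes "open (S :: 'a::euclidean_space set)" "open T" "smooth_on T h"
  shows "smooth_on (S \<times> T) (\<lambda>z. h (snd z))"
  using assms
  by (intro smooth_on_compose[OF _ smooth_on_bounded_linear[OF _ bounded_linear_snd] assms(3)] open_Times) auto

lemma smooth_on_Pair:
  fixes h :: "'a::euclidean_space \<Rightarrow> 'b::euclidean_space" and k :: "'a \<Rightarrow> 'c::euclidean_space"
  assumes "open S" "smooth_on S h" "smooth_on S k"
  shows "smooth_on S (\<lambda>z. (h z, k z))"
proof -
  have "smooth_on S (\<lambda>z. (h z, 0) + (0, k z))"
    by (intro smooth_on_add[OF assms(1)] smooth_on_bounded_linear_compose[OF assms(1) _ assms(2)]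
        smooth_on_bounded_linear_compose[OF assms(1) _ assms(3)]
        bounded_linear_Pair bounded_linear_ident bounded_linear_zero)
  then show ?thesis by simp
qed

locale warped_product = F: pseudo_riemannian_mfd F gF
  for F :: "('a::{t2_space, second_countable_topology}, 'e::euclidean_space) atlas" and gF +
  fixes I :: "real set" and f :: "real \<Rightarrow> real"
  assumes open_I: "open I" and smooth_f: "smooth_on I f" and f_pos: "\<And>t. t \<in> I \<Longrightarrow> f t > 0"
begin

abbreviation "M \<equiv> interval_times I F"
abbreviation "g \<equiv> warped_metric f gF"
abbreviation prod_chart :: "('a \<Rightarrow> 'e) \<Rightarrow> real \<times> 'a \<Rightarrow> real \<times> 'e" where
  "prod_chart \<phi> \<equiv> (\<lambda>(t, x). (t, \<phi> x))"

lemma prod_chart_mem: "(V, \<phi>) \<in> F \<Longrightarrow> (I \<times> V, prod_chart \<phi>) \<in> M"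
  by (force simp: interval_times_def)

lemma prod_chart_cases:
  assumes "(V', \<phi>') \<in> M"
  obtains V \<phi> where "(V, \<phi>) \<in> F" "V' = I \<times> V" "\<phi>' = prod_chart \<phi>"
  using assms by (auto simp: interval_times_def)

lemma carrier_M: "carrier M = I \<times> carrier F"
  by (auto simp: carrier_def interval_times_def)

lemma prod_chart_image: "prod_chart \<phi> ` (I \<times> V) = I \<times> \<phi> ` V"
  by auto

lemma prod_chart_inv:
  assumes "(V, \<phi>) \<in> F" "t \<in> I" "y \<in> \<phi> ` V"
  shows "inv_into (I \<times> V) (prod_chart \<phi>) (t, y) = (t, inv_into V \<phi> y)"
proof -
  have "inj_on \<phi> V" using F.chart_inv[OF assms(1)] by (metis inj_onI)
  then have "inj_on (prod_chart \<phi>) (I \<times> V)" by (auto simp: inj_on_def)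
  then show ?thesis
    using assms(2,3) F.chart_inv[OF assms(1)] by (auto intro!: inv_into_f_eq)
qed

lemma smooth_manifold_M: "smooth_manifold M"
  unfolding smooth_manifold_def
proof (safe)
  fix V' \<phi>' assume "(V', \<phi>') \<in> M"
  then obtain V \<phi> where c: "(V, \<phi>) \<in> F" "V' = I \<times> V" "\<phi>' = prod_chart \<phi>"
    by (rule prod_chart_cases)
  note h = F.chart_homeomorphism[OF c(1)]
  show "open V'" using F.chart_open[OF c(1)] open_I by (simp add: c open_Times)
  show "open (\<phi>' ` V')" using F.chart_image[OF c(1)] open_I by (simp add: c prod_chart_image open_Times)
  have "continuous_on (I \<times> V) (prod_chart \<phi>)"
    unfolding case_prod_unfold
    by (intro continuous_on_Pair continuous_on_fst continuous_on_id
        continuous_on_compose2[OF homeomorphism_cont1[OF h], of _ snd] continuous_on_snd) auto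
  moreover have "continuous_on (I \<times> \<phi> ` V) (\<lambda>z. (fst z, inv_into V \<phi> (snd z)))"
    by (intro continuous_on_Pair continuous_on_fst continuous_on_id
        continuous_on_compose2[OF homeomorphism_cont2[OF h], of _ snd] continuous_on_snd) auto
  then have "continuous_on (I \<times> \<phi> ` V) (inv_into (I \<times> V) (prod_chart \<phi>))"
    by (rule continuous_on_cong[THEN iffD1, rotated -1]) (auto simp: prod_chart_inv[OF c(1)])
  ultimately show "homeomorphism V' (\<phi>' ` V') \<phi>' (inv_into V' \<phi>')"
    unfolding c prod_chart_image
    by (intro homeomorphismI) (auto simp: prod_chart_inv[OF c(1)] F.chart_inv[OF c(1)])
  fix W' \<psi>' assume "(W', \<psi>') \<in> M"
  then obtain W \<psi> where d: "(W, \<psi>) \<in> F" "W' = I \<times> W" "\<psi>' = prod_chart \<psi>"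
    by (rule prod_chart_cases)
  have eq: "\<phi>' ` (V' \<inter> W') = I \<times> \<phi> ` (V \<inter> W)" unfolding c d by auto
  have o: "open (\<phi> ` (V \<inter> W))"
    using F.chart_image_open[OF c(1) F.chart_open[OF d(1)]] by (simp add: Int_commute)
  have "smooth_on (I \<times> \<phi> ` (V \<inter> W)) (\<lambda>z. (fst z, \<psi> (inv_into V \<phi> (snd z))))"
    by (intro smooth_on_Pair open_Times open_I o smooth_on_bounded_linear bounded_linear_fst
        smooth_on_snd F.chart_transition c d)
  then show "smooth_on (\<phi>' ` (V' \<inter> W')) (\<psi>' \<circ> inv_into V' \<phi>')"
    unfolding eq
    by (rule smooth_on_cong[OF open_Times[OF open_I o], rotated])
      (auto simp: c d prod_chart_inv[OF c(1)])
qed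

sublocale M: smooth_mfd M
  by unfold_locales (rule smooth_manifold_M)

lemma smooth_fun_snd:
  assumes "smooth_fun F U k" "open U"
  shows "smooth_fun M (I \<times> U) (k \<circ> snd)"
proof (rule M.smooth_funI)
  fix V' \<phi>' assume "(V', \<phi>') \<in> M"
  then obtain V \<phi> where c: "(V, \<phi>) \<in> F" "V' = I \<times> V" "\<phi>' = prod_chart \<phi>"
    by (rule prod_chart_cases)
  have eq: "\<phi>' ` ((I \<times> U) \<inter> V') = I \<times> \<phi> ` (U \<inter> V)" unfolding c by auto
  note o = F.chart_image_open[OF c(1) assms(2)]
  show "smooth_on (\<phi>' ` ((I \<times> U) \<inter> V')) (\<lambda>z. (k \<circ> snd) (inv_into V' \<phi>' z))"
    unfolding eq
    by (rule smooth_on_cong[OF open_Times[OF open_I o] _ smooth_on_snd[OF open_I o F.smooth_funD[OF assms(1) c(1)]]])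
      (auto simp: c prod_chart_inv[OF c(1)])
qed

lemma smooth_fun_fst:
  assumes "smooth_on I a" "open U"
  shows "smooth_fun M (I \<times> U) (\<lambda>q. a (fst q))"
proof (rule M.smooth_funI)
  fix V' \<phi>' assume "(V', \<phi>') \<in> M"
  then obtain V \<phi> where c: "(V, \<phi>) \<in> F" "V' = I \<times> V" "\<phi>' = prod_chart \<phi>"
    by (rule prod_chart_cases)
  have eq: "\<phi>' ` ((I \<times> U) \<inter> V') = I \<times> \<phi> ` (U \<inter> V)" unfolding c by auto
  note o = F.chart_image_open[OF c(1) assms(2)]
  show "smooth_on (\<phi>' ` ((I \<times> U) \<inter> V')) (\<lambda>z. a (fst (inv_into V' \<phi>' z)))"
    unfolding eq
    by (rule smooth_on_cong[OF open_Times[OF open_I o] _ smooth_on_fst[OF open_I o assms(1)]])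
      (auto simp: c prod_chart_inv[OF c(1)])
qed

lemma smooth_near_fst:
  assumes "smooth_on I a" "t \<in> I" "x \<in> carrier F"
  shows "smooth_near M (t, x) (\<lambda>q. a (fst q))"
  using assms by (intro M.smooth_nearI[OF smooth_fun_fst[OF assms(1) F.open_carrier]])
    (auto simp: carrier_M open_Times open_I F.open_carrier)

text \<open>In a product chart a slice is the composition with \<open>\<lambda>y. (t, y)\<close>.
  This lets vector fields of \<open>F\<close> act on functions of \<open>M\<close> with time
  frozen.\<close>

lemma smooth_fun_slice:
  assumes "smooth_fun M W h" "open W" "t \<in> I"
  shows "smooth_fun F {y. (t, y) \<in> W} (\<lambda>y. h (t, y))" "open {y. (t, y) \<in> W}"
proof -
  show o: "open {y. (t, y) \<in> W}"
    using open_vimage[OF assms(2), of "\<lambda>y. (t, y)"] by (simp add: vimage_def continuous_on_Pair)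
  show "smooth_fun F {y. (t, y) \<in> W} (\<lambda>y. h (t, y))"
  proof (rule F.smooth_funI)
    fix V \<phi> assume c: "(V, \<phi>) \<in> F"
    note c' = prod_chart_mem[OF c]
    note o1 = F.chart_image_open[OF c o]
    have p: "smooth_on (\<phi> ` ({y. (t, y) \<in> W} \<inter> V)) (\<lambda>y. (t, y))"
      by (intro smooth_on_Pair o1 smooth_on_const smooth_on_bounded_linear bounded_linear_ident)
    have "smooth_on (\<phi> ` ({y. (t, y) \<in> W} \<inter> V)) (\<lambda>y. h (inv_into (I \<times> V) (prod_chart \<phi>) (t, y)))"
      by (rule smooth_on_compose[OF o1 p M.smooth_funD[OF assms(1) c'] _ M.chart_image_open[OF c' assms(2)]])
        (use assms(3) in force)
    then show "smooth_on (\<phi> ` ({y. (t, y) \<in> W} \<inter> V)) (\<lambda>y. h (t, inv_into V \<phi> y))"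
      by (rule smooth_on_cong[OF o1, rotated]) (auto simp: prod_chart_inv[OF c assms(3)])
  qed
qed

lemma smooth_near_slice:
  assumes "smooth_near M (t, x) h"
  shows "smooth_near F x (\<lambda>y. h (t, y))"
proof -
  obtain W where W: "open W" "(t, x) \<in> W" "W \<subseteq> carrier M" "smooth_fun M W h"
    using assms by (auto simp: smooth_near_def)
  then have "t \<in> I" by (auto simp: carrier_M)
  show ?thesis
    using smooth_fun_slice[OF W(4,1) \<open>t \<in> I\<close>] W(2,3) by (auto intro!: F.smooth_nearI simp: carrier_M)
qed

text \<open>Keeps the default value 0 consistent: a function on \<open>F\<close> and its pullback to
  \<open>M\<close> are non-smooth over the same points of \<open>F\<close>.\<close>

lemma smooth_near_snd:
  assumes "t \<in> I"
  shows "smooth_near M (t, x) (k \<circ> snd) \<longleftrightarrow> smooth_near F x k"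
proof
  show "smooth_near F x k" if "smooth_near M (t, x) (k \<circ> snd)"
    using smooth_near_slice[OF that] by simp
  assume "smooth_near F x k"
  then obtain U where U: "open U" "x \<in> U" "U \<subseteq> carrier F" "smooth_fun F U k"
    by (auto simp: smooth_near_def)
  show "smooth_near M (t, x) (k \<circ> snd)"
    using U assms by (intro M.smooth_nearI[OF smooth_fun_snd[OF U(4,1)]])
      (auto simp: carrier_M open_Times open_I)
qed

text \<open>The field tangent to the slices of constant time that projects to \<open>X\<close>. The
  case distinction is there because a slice of \<open>h\<close> can be smooth where \<open>h\<close>
  is not, and tangent vectors of \<open>M\<close> must vanish on such \<open>h\<close>.\<close>

definition lift :: "'a vfield \<Rightarrow> (real \<times> 'a) vfield" where
  "lift X = (\<lambda>(t, x) h. if smooth_near M (t, x) h then X x (\<lambda>y. h (t, y)) else 0)"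

abbreviation "push w \<equiv> (\<lambda>k. w (k \<circ> snd))"

lemma lift_apply: "lift X (t, x) h = (if smooth_near M (t, x) h then X x (\<lambda>y. h (t, y)) else 0)"
  by (simp add: lift_def)

text \<open>In a product chart the two kinds of fields point in the directions \<open>(0, u)\<close>
  and \<open>(1, 0)\<close>: a partial derivative is the total derivative composed with the
  inclusion of a slice. Tangency to \<open>M\<close> follows.\<close>

lemma chart_vec_prod:
  assumes c: "(V, \<phi>) \<in> F" "x \<in> V" and t: "t \<in> I"
  shows "X x = chart_vec F V \<phi> u x \<Longrightarrow> lift X (t, x) = chart_vec M (I \<times> V) (prod_chart \<phi>) (0, u) (t, x)"
    and "time_field I F (t, x) = chart_vec M (I \<times> V) (prod_chart \<phi>) (1, 0) (t, x)"
proof -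
  note c' = prod_chart_mem[OF c(1)]
  have x: "(t, x) \<in> I \<times> V" using c t by simp
  let ?d = "\<lambda>h w. chart_vec M (I \<times> V) (prod_chart \<phi>) w (t, x) h"
  show "lift X (t, x) = chart_vec M (I \<times> V) (prod_chart \<phi>) (0, u) (t, x)" if X: "X x = chart_vec F V \<phi> u x"
  proof
    fix h
    show "lift X (t, x) h = ?d h (0, u)"
    proof (cases "smooth_near M (t, x) h")
      case True
      have "((\<lambda>z. h (inv_into (I \<times> V) (prod_chart \<phi>) z)) has_derivative ?d h) (at (t, \<phi> x))"
        using M.chart_vec_has_derivative[OF c' x True] by simp
      then have "((\<lambda>y. h (inv_into (I \<times> V) (prod_chart \<phi>) (t, y))) has_derivative (\<lambda>u. ?d h (0, u))) (at (\<phi> x))"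
        by (rule has_derivative_compose[where f="\<lambda>y. (t, y)", rotated]) (auto intro!: derivative_eq_intros)
      then have "((\<lambda>y. h (t, inv_into V \<phi> y)) has_derivative (\<lambda>u. ?d h (0, u))) (at (\<phi> x))"
        by (rule has_derivative_transform_within_open[OF _ F.chart_image[OF c(1)]])
          (use c in \<open>auto simp: prod_chart_inv[OF c(1) t]\<close>)
      then have "chart_vec F V \<phi> u x (\<lambda>y. h (t, y)) = ?d h (0, u)"
        by (rule F.chart_vec_eqI[OF c smooth_near_slice[OF True]])
      then show ?thesis using True X by (simp add: lift_apply)
    qed (simp add: lift_apply M.chart_vec_not_smooth)
  qed
  show "time_field I F (t, x) = chart_vec M (I \<times> V) (prod_chart \<phi>) (1, 0) (t, x)"
  proof
    fix h
    show "time_field I F (t, x) h = ?d h (1, 0)"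
    proof (cases "smooth_near M (t, x) h")
      case True
      have "((\<lambda>z. h (inv_into (I \<times> V) (prod_chart \<phi>) z)) has_derivative ?d h) (at (t, \<phi> x))"
        using M.chart_vec_has_derivative[OF c' x True] by simp
      then have "((\<lambda>s. h (inv_into (I \<times> V) (prod_chart \<phi>) (s, \<phi> x))) has_derivative (\<lambda>r. ?d h (r, 0))) (at t)"
        by (rule has_derivative_compose[where f="\<lambda>s. (s, \<phi> x)", rotated]) (auto intro!: derivative_eq_intros)
      then have "((\<lambda>s. h (s, x)) has_derivative (\<lambda>r. ?d h (r, 0))) (at t)"
        by (rule has_derivative_transform_within_open[OF _ open_I t])
          (use c in \<open>auto simp: prod_chart_inv[OF c(1)] F.chart_inv[OF c(1)]\<close>)
      moreover have "(\<lambda>r. ?d h (r, 0)) = (*) (?d h (1, 0))"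
      proof
        show "?d h (r, 0) = ?d h (1, 0) * r" for r
          using linear_scale[OF M.chart_vec_linear[OF c' x, of h], of r "(1, 0)"] by simp
      qed
      ultimately have "((\<lambda>s. h (s, x)) has_field_derivative ?d h (1, 0)) (at t)"
        by (simp only: has_field_derivative_def)
      then show ?thesis using True DERIV_imp_deriv by (simp add: time_field_def)
    qed (simp add: time_field_def M.chart_vec_not_smooth)
  qed
qed

lemma prod_chart_coord: "(\<lambda>z. prod_chart \<phi> z \<bullet> b) = (\<lambda>z. fst b * fst z + ((\<lambda>y. \<phi> y \<bullet> snd b) \<circ> snd) z)"
  by (auto simp: inner_prod_def)

lemma
  assumes "x \<in> carrier F" "t \<in> I"
  shows time_tangent: "time_field I F (t, x) \<in> tangent_space M (t, x)"
    and lift_tangent: "X x \<in> tangent_space F x \<Longrightarrow> lift X (t, x) \<in> tangent_space M (t, x)"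
proof -
  obtain V \<phi> where c: "(V, \<phi>) \<in> F" "x \<in> V" using assms F.carrier_chart by blast
  note c' = prod_chart_mem[OF c(1)]
  have x: "(t, x) \<in> I \<times> V" using c assms by simp
  show "time_field I F (t, x) \<in> tangent_space M (t, x)"
    unfolding chart_vec_prod(2)[OF c assms(2)] by (rule M.chart_vec_tangent[OF c' x])
  assume "X x \<in> tangent_space F x"
  then obtain u where u: "X x = chart_vec F V \<phi> u x" using F.tangent_chart_vec[OF _ c] by metis
  show "lift X (t, x) \<in> tangent_space M (t, x)"
    unfolding chart_vec_prod(1)[where X=X, OF c assms(2) u] by (rule M.chart_vec_tangent[OF c' x])
qed

lemma
  shows time_snd: "time_field I F (t, x) (k \<circ> snd) = 0"
    and time_fst: "smooth_on I a \<Longrightarrow> t \<in> I \<Longrightarrow> x \<in> carrier F \<Longrightarrow> time_field I F (t, x) (\<lambda>q. a (fst q)) = deriv a t"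
  using smooth_near_fst by (auto simp: time_field_def)

lemma
  assumes "X x \<in> tangent_space F x"
  shows lift_snd: "t \<in> I \<Longrightarrow> lift X (t, x) (k \<circ> snd) = X x k"
    and lift_fst: "lift X (t, x) (\<lambda>q. a (fst q)) = 0"
  using F.tangent_const[OF assms] F.tangent_not_smooth[OF assms, of k]
  by (auto simp: lift_apply smooth_near_snd)

lemma smooth_on_ident: "smooth_on I (\<lambda>t. t)"
  using smooth_on_bounded_linear[OF open_I bounded_linear_ident] by simp

lemma time_fst': "t \<in> I \<Longrightarrow> x \<in> carrier F \<Longrightarrow> time_field I F (t, x) fst = 1"
  using time_fst[OF smooth_on_ident] by simp

lemma lift_fst': "X x \<in> tangent_space F x \<Longrightarrow> lift X (t, x) fst = 0"
  using lift_fst[where a="\<lambda>t. t"] by simp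

lemma tangent_M_coord:
  assumes "w \<in> tangent_space M (t, x)" "(V, \<phi>) \<in> F" "x \<in> V"
  shows "w (\<lambda>z. prod_chart \<phi> z \<bullet> b) = fst b * w fst + push w (\<lambda>y. \<phi> y \<bullet> snd b)"
proof -
  have t: "t \<in> I" "x \<in> carrier F" using M.tangent_carrier[OF assms(1)] by (auto simp: carrier_M)
  have n: "smooth_near M (t, x) fst" using smooth_near_fst[OF smooth_on_ident t] by simp
  have "smooth_near M (t, x) (\<lambda>z. fst b * fst z)"
    by (intro M.smooth_near_mult M.smooth_near_const n) (simp add: t carrier_M)
  then show ?thesis
    unfolding prod_chart_coord
    using M.tangent_add_fun[OF assms(1), of "\<lambda>z. fst b * fst z" "(\<lambda>y. \<phi> y \<bullet> snd b) \<circ> snd"]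
      M.tangent_cmult_fun[OF assms(1) n] smooth_near_snd[OF t(1)] F.smooth_near_coord[OF assms(2,3)]
    by simp
qed

text \<open>By \<open>prod_chart_coord\<close> the coordinate functions of a product chart are
  multiples of \<open>fst\<close> plus functions pulled back from \<open>F\<close>, so these two
  kinds of functions separate tangent vectors.\<close>

lemma tangent_M_eqI:
  assumes "w \<in> tangent_space M (t, x)" "w' \<in> tangent_space M (t, x)"
    and "w fst = w' fst" "\<And>k. smooth_near F x k \<Longrightarrow> push w k = push w' k"
  shows "w = w'"
proof -
  have t: "t \<in> I" "x \<in> carrier F" using M.tangent_carrier[OF assms(1)] by (auto simp: carrier_M)
  then obtain V \<phi> where c: "(V, \<phi>) \<in> F" "x \<in> V" using F.carrier_chart by blast
  show ?thesis
    by (rule M.tangent_eqI[OF assms(1,2) prod_chart_mem[OF c(1)]])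
      (use c t assms(3) assms(4)[OF F.smooth_near_coord[OF c]] in
        \<open>simp_all add: tangent_M_coord[OF assms(1) c] tangent_M_coord[OF assms(2) c]\<close>)
qed

text \<open>If \<open>w\<close> has components \<open>(a, u)\<close> in a product chart, its
  push-forward has components \<open>u\<close>.\<close>

lemma push_tangent:
  assumes "w \<in> tangent_space M (t, x)"
  shows "push w \<in> tangent_space F x"
proof -
  have t: "t \<in> I" "x \<in> carrier F" using M.tangent_carrier[OF assms(1)] by (auto simp: carrier_M)
  then obtain V \<phi> where c: "(V, \<phi>) \<in> F" "x \<in> V" using F.carrier_chart by blast
  note c' = prod_chart_mem[OF c(1)]
  have x: "(t, x) \<in> I \<times> V" using c t by simp
  obtain a u where w: "w = chart_vec M (I \<times> V) (prod_chart \<phi>) (a, u) (t, x)"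
    using M.tangent_chart_vec[OF assms c' x] by (metis surj_pair)
  have "push w = chart_vec F V \<phi> u x"
  proof
    fix k
    show "push w k = chart_vec F V \<phi> u x k"
    proof (cases "smooth_near F x k")
      case True
      then have n: "smooth_near M (t, x) (k \<circ> snd)" by (simp add: smooth_near_snd[OF t(1)])
      have "((\<lambda>z. k (inv_into V \<phi> (snd z))) has_derivative (\<lambda>z. chart_vec F V \<phi> (snd z) x k)) (at (t, \<phi> x))"
        by (rule has_derivative_compose[OF has_derivative_snd[OF has_derivative_ident]])
          (use F.chart_vec_has_derivative[OF c True] in simp)
      then have "((\<lambda>z. (k \<circ> snd) (inv_into (I \<times> V) (prod_chart \<phi>) z)) has_derivative
          (\<lambda>z. chart_vec F V \<phi> (snd z) x k)) (at (prod_chart \<phi> (t, x)))"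
        unfolding case_prod_conv
        by (rule has_derivative_transform_within_open[OF _ open_Times[OF open_I F.chart_image[OF c(1)]]])
          (use c t in \<open>auto simp: prod_chart_inv\<close>)
      then show ?thesis
        unfolding w by (simp add: M.chart_vec_eqI[OF c' x n])
    next
      case False
      then show ?thesis
        unfolding w by (simp add: F.chart_vec_not_smooth M.chart_vec_not_smooth smooth_near_snd[OF t(1)])
    qed
  qed
  then show ?thesis using F.chart_vec_tangent[OF c] by simp
qed

lemma time_vf: "W \<subseteq> carrier M \<Longrightarrow> open W \<Longrightarrow> time_field I F \<in> vector_fields M W"
proof (rule M.vf_criterion)
  fix p assume W: "W \<subseteq> carrier M" "p \<in> W"
  then obtain t x where p: "p = (t, x)" "t \<in> I" "x \<in> carrier F" by (auto simp: carrier_M)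
  then show "time_field I F p \<in> tangent_space M p" using time_tangent by simp
  obtain V \<phi> where c: "(V, \<phi>) \<in> F" "x \<in> V" using p F.carrier_chart by blast
  note c' = prod_chart_mem[OF c(1)]
  assume o: "open W"
  have "smooth_fun M (W \<inter> I \<times> V) (\<lambda>q. time_field I F q (\<lambda>z. prod_chart \<phi> z \<bullet> b))" for b
    by (rule M.smooth_fun_cong[OF _ _ M.smooth_fun_const[of _ "fst b"]])
      (use o open_I F.chart_open[OF c(1)] F.chart_subset[OF c(1)]
        in \<open>auto simp: open_Times open_Int tangent_M_coord[OF time_tangent c(1)] time_fst' time_snd subset_iff\<close>)
  then show "\<exists>V \<phi>. (V, \<phi>) \<in> M \<and> p \<in> V \<and> (\<forall>b\<in>Basis. smooth_fun M (W \<inter> V) (\<lambda>q. time_field I F q (\<lambda>z. \<phi> z \<bullet> b)))"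
    using c' c(2) p by blast
qed

lemma lift_vf:
  assumes X: "X \<in> vector_fields F U" and U: "open U" "U \<subseteq> carrier F"
  shows "lift X \<in> vector_fields M (I \<times> U)"
proof (rule M.vf_criterion)
  show "open (I \<times> U)" using U open_I by (simp add: open_Times)
  fix p assume "p \<in> I \<times> U"
  then obtain t x where p: "p = (t, x)" "t \<in> I" "x \<in> U" by auto
  then show "lift X p \<in> tangent_space M p" using lift_tangent F.vf_tangent[OF X] U by auto
  obtain V \<phi> where c: "(V, \<phi>) \<in> F" "x \<in> V" using p U F.carrier_chart by blast
  note c' = prod_chart_mem[OF c(1)]
  have UV: "open (U \<inter> V)" using U F.chart_open[OF c(1)] by auto
  have "smooth_fun M (I \<times> U \<inter> I \<times> V) (\<lambda>q. lift X q (\<lambda>z. prod_chart \<phi> z \<bullet> b))" for b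
  proof -
    have "smooth_fun F (U \<inter> V) (\<lambda>y. X y (\<lambda>y. \<phi> y \<bullet> snd b))"
      by (rule F.vf_smooth[OF X UV]) (auto intro: F.smooth_fun_subset[OF F.smooth_fun_coord[OF c(1)]])
    from smooth_fun_snd[OF this UV]
    have "smooth_fun M (I \<times> U \<inter> I \<times> V) ((\<lambda>y. X y (\<lambda>y. \<phi> y \<bullet> snd b)) \<circ> snd)"
      by (simp add: Times_Int_distrib1 flip: Sigma_Int_distrib2)
    then show ?thesis
      by (rule M.smooth_fun_cong[rotated -1])
        (use U open_I F.chart_open[OF c(1)] F.vf_tangent[OF X]
          in \<open>auto simp: open_Times open_Int tangent_M_coord[OF lift_tangent c(1)] lift_fst' lift_snd subset_iff\<close>)
  qed
  then show "\<exists>V \<phi>. (V, \<phi>) \<in> M \<and> p \<in> V \<and> (\<forall>b\<in>Basis. smooth_fun M (I \<times> U \<inter> V) (\<lambda>q. lift X q (\<lambda>z. \<phi> z \<bullet> b)))"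
    using c' c(2) p by blast
qed

lemma g_apply: "g (t, x) w w' = - (w fst * w' fst) + (f t)\<^sup>2 * gF x (push w) (push w')"
  by (simp add: warped_metric_def)

lemma push_time: "push (time_field I F (t, x)) = (\<lambda>k. 0)"
  by (simp add: time_snd)

lemma push_lift: "t \<in> I \<Longrightarrow> X x \<in> tangent_space F x \<Longrightarrow> push (lift X (t, x)) = X x"
  by (auto simp: lift_snd)

lemma
  assumes "t \<in> I" "w \<in> tangent_space M (t, x)"
  shows g_time: "g (t, x) w (time_field I F (t, x)) = - w fst"
    and g_lift: "X x \<in> tangent_space F x \<Longrightarrow> g (t, x) w (lift X (t, x)) = (f t)\<^sup>2 * gF x (push w) (X x)"
proof -
  have x: "x \<in> carrier F" using M.tangent_carrier[OF assms(2)] by (simp add: carrier_M)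
  show "g (t, x) w (time_field I F (t, x)) = - w fst"
    using F.g_zero_left[OF push_tangent[OF assms(2)]]
      F.g_sym[OF push_tangent[OF assms(2)] F.tangent_zero[OF x]]
    by (simp add: g_apply time_fst'[OF assms(1) x] push_time)
  show "g (t, x) w (lift X (t, x)) = (f t)\<^sup>2 * gF x (push w) (X x)" if "X x \<in> tangent_space F x"
    using lift_fst'[where X=X and x=x, OF that] push_lift[where X=X and x=x, OF assms(1) that] by (simp add: g_apply)
qed

lemma pseudo_riemannian_metric_M: "pseudo_riemannian_metric M g"
  unfolding pseudo_riemannian_metric_def
proof (intro conjI ballI allI impI)
  fix p u v assume p: "p \<in> carrier M" and uv: "u \<in> tangent_space M p" "v \<in> tangent_space M p"
  obtain t x where tx: "p = (t, x)" "t \<in> I" "x \<in> carrier F" using p by (auto simp: carrier_M)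
  note T = uv[unfolded tx, THEN push_tangent]
  show "g p u v = g p v u" using F.g_sym[OF T] by (simp add: tx g_apply mult.commute)
  show "g p (\<lambda>h. c * u h) v = c * g p u v" for c
    using F.g_scale_left[OF T] by (simp add: tx g_apply algebra_simps)
  fix w assume "w \<in> tangent_space M p"
  note T' = this[unfolded tx, THEN push_tangent]
  have "push (u + v) = push u + push v" by (auto simp: plus_fun_def)
  then show "g p (u + v) w = g p u w + g p v w"
    using F.g_add_left[OF T T'] unfolding tx g_apply by (simp add: algebra_simps)
next
  fix p u assume p: "p \<in> carrier M" and u: "u \<in> tangent_space M p" and *: "\<forall>v\<in>tangent_space M p. g p u v = 0"
  obtain t x where tx: "p = (t, x)" "t \<in> I" "x \<in> carrier F" using p by (auto simp: carrier_M)
  note u = u[unfolded tx] and * = *[unfolded tx]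
  \<comment> \<open>Pairing with the time field detects the time component, pairing with lifts
    detects the push-forward; together they determine \<open>u\<close>.\<close>
  have 1: "u fst = 0" using * time_tangent[OF tx(3,2)] g_time[OF tx(2) u] by auto
  have "push u = 0"
  proof (rule F.g_nondegenerate[OF push_tangent[OF u]])
    fix v assume v: "v \<in> tangent_space F x"
    \<comment> \<open>A constant function serves as the field to be lifted: at the single point
      \<open>(t, x)\<close> only its value at \<open>x\<close> matters, so \<open>v\<close> is not
      extended smoothly.\<close>
    have "g (t, x) u (lift (\<lambda>_. v) (t, x)) = 0"
      using * lift_tangent[OF tx(3,2), of "\<lambda>_. v"] v by auto
    then show "gF x (push u) v = 0"
      using g_lift[OF tx(2) u, of "\<lambda>_. v"] v f_pos[OF tx(2)] by simp
  qed
  then have "push u k = 0" for k by (metis zero_fun_apply)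
  then show "u = 0"
    using tangent_M_eqI[OF u M.tangent_zero, simplified] 1 p tx(1) by (auto simp: zero_fun_def)
next
  fix U X Y assume "open U \<and> U \<subseteq> carrier M" and X: "X \<in> vector_fields M U" and Y: "Y \<in> vector_fields M U"
  then have U: "open U" "U \<subseteq> carrier M" by auto
  show "smooth_fun M U (\<lambda>p. g p (X p) (Y p))"
  proof (rule M.smooth_fun_local[OF U(1)])
    fix p assume "p \<in> U"
    then obtain t x where tx: "p = (t, x)" "t \<in> I" "x \<in> carrier F" using U by (auto simp: carrier_M)
    obtain V \<phi> where c: "(V, \<phi>) \<in> F" "x \<in> V" using tx F.carrier_chart by blast
    let ?W = "U \<inter> (I \<times> V)"
    have oV: "open (I \<times> V)" "open V" using open_I F.chart_open[OF c(1)] by (simp_all add: open_Times)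
    have W: "open ?W" using U oV by auto
    have fst: "smooth_fun M ?W (\<lambda>q. Z q fst)" if "Z \<in> vector_fields M U" for Z
      by (rule M.vf_smooth[OF that W], simp, rule M.smooth_fun_subset[OF smooth_fun_fst[OF smooth_on_ident oV(2)]]) auto
    have crd: "smooth_fun M ?W (\<lambda>q. push (Z q) (\<lambda>y. \<phi> y \<bullet> b))" if "Z \<in> vector_fields M U" for Z b
      by (rule M.vf_smooth[OF that W], simp,
          rule M.smooth_fun_subset[OF smooth_fun_snd[OF F.smooth_fun_coord[OF c(1)] oV(2)]]) auto
    have gb: "smooth_fun M ?W ((\<lambda>y. gF y (chart_vec F V \<phi> b y) (chart_vec F V \<phi> b' y)) \<circ> snd)" for b b'
      by (rule M.smooth_fun_subset[OF smooth_fun_snd[OF F.g_smooth[OF F.chart_vec_vf[OF c(1)]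
                F.chart_vec_vf[OF c(1)] oV(2) F.chart_subset[OF c(1)]] oV(2)]]) auto
    have ff: "smooth_fun M ?W (\<lambda>q. f (fst q))"
      by (rule M.smooth_fun_subset[OF smooth_fun_fst[OF smooth_f oV(2)]]) auto
    \<comment> \<open>The vector \<open>push (X q)\<close> varies with time and is not a field on
      \<open>F\<close>, so smoothness of \<open>gF\<close> does not apply to it directly. In the
      coordinate basis \<open>gF\<close> meets only coordinate fields of \<open>F\<close>, and the
      time dependence sits in the components.\<close>
    have "smooth_fun M ?W (\<lambda>q. - (X q fst * Y q fst) + f (fst q) * f (fst q) *
        (\<Sum>b\<in>Basis. push (X q) (\<lambda>y. \<phi> y \<bullet> b) * (\<Sum>b'\<in>Basis. push (Y q) (\<lambda>y. \<phi> y \<bullet> b') *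
          ((\<lambda>y. gF y (chart_vec F V \<phi> b y) (chart_vec F V \<phi> b' y)) \<circ> snd) q)))"
      by (intro M.smooth_fun_add M.smooth_fun_minus M.smooth_fun_mult M.smooth_fun_sum W fst crd gb ff X Y finite_Basis)
    then have "smooth_fun M ?W (\<lambda>p. g p (X p) (Y p))"
    proof (rule M.smooth_fun_cong[OF W, rotated])
      fix q assume q: "q \<in> ?W"
      then obtain s y where sy: "q = (s, y)" "s \<in> I" "y \<in> V" by auto
      have T: "push (X q) \<in> tangent_space F y" "push (Y q) \<in> tangent_space F y"
        using push_tangent[of _ s y] M.vf_tangent[OF X, of q] M.vf_tangent[OF Y, of q] q sy(1) by auto
      have ct: "chart_vec F V \<phi> b y \<in> tangent_space F y" for b by (rule F.chart_vec_tangent[OF c(1) sy(3)])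
      have e: "v = (\<lambda>h. \<Sum>b\<in>Basis. v (\<lambda>y. \<phi> y \<bullet> b) * chart_vec F V \<phi> b y h)" if "v \<in> tangent_space F y" for v
        using F.tangent_expand[OF that c(1) sy(3)] by blast
      have "gF y (chart_vec F V \<phi> b y) (push (Y q)) = (\<Sum>b'\<in>Basis. push (Y q) (\<lambda>y. \<phi> y \<bullet> b') *
          gF y (chart_vec F V \<phi> b y) (chart_vec F V \<phi> b' y))" for b
      proof -
        have "gF y (chart_vec F V \<phi> b y) (push (Y q)) = gF y (push (Y q)) (chart_vec F V \<phi> b y)"
          by (rule F.g_sym[OF ct T(2)])
        also have "\<dots> = gF y (\<lambda>h. \<Sum>b'\<in>Basis. push (Y q) (\<lambda>y. \<phi> y \<bullet> b') * chart_vec F V \<phi> b' y h) (chart_vec F V \<phi> b y)"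
          by (rule arg_cong[OF e[OF T(2)]])
        also have "\<dots> = (\<Sum>b'\<in>Basis. push (Y q) (\<lambda>y. \<phi> y \<bullet> b') * gF y (chart_vec F V \<phi> b' y) (chart_vec F V \<phi> b y))"
          by (intro F.g_sum_left finite_Basis ct)
        also have "\<dots> = (\<Sum>b'\<in>Basis. push (Y q) (\<lambda>y. \<phi> y \<bullet> b') * gF y (chart_vec F V \<phi> b y) (chart_vec F V \<phi> b' y))"
          by (intro sum.cong refl arg_cong2[where f="(*)"] F.g_sym ct)
        finally show ?thesis .
      qed
      moreover have "gF y (push (X q)) (push (Y q)) = (\<Sum>b\<in>Basis. push (X q) (\<lambda>y. \<phi> y \<bullet> b) *
          gF y (chart_vec F V \<phi> b y) (push (Y q)))"
        using F.g_sum_left[where v="\<lambda>b. chart_vec F V \<phi> b y", OF finite_Basis ct T(2), where a="\<lambda>b. push (X q) (\<lambda>y. \<phi> y \<bullet> b)"] e[OF T(1)] by simp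
      ultimately show "- (X q fst * Y q fst) + f (fst q) * f (fst q) *
        (\<Sum>b\<in>Basis. push (X q) (\<lambda>y. \<phi> y \<bullet> b) * (\<Sum>b'\<in>Basis. push (Y q) (\<lambda>y. \<phi> y \<bullet> b') *
          ((\<lambda>y. gF y (chart_vec F V \<phi> b y) (chart_vec F V \<phi> b' y)) \<circ> snd) q)) = g q (X q) (Y q)"
        by (simp add: sy(1) g_apply power2_eq_square)
    qed
    then show "\<exists>V. open V \<and> p \<in> V \<and> smooth_fun M (U \<inter> V) (\<lambda>p. g p (X p) (Y p))"
      using oV tx c by blast
  qed
qed

sublocale M: pseudo_riemannian_mfd M g
  by unfold_locales (rule pseudo_riemannian_metric_M)

end

section \<open>The Levi-Civita connection\<close>

locale levi_civita_mfd = pseudo_riemannian_mfd A g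
  for A :: "('a::{t2_space, second_countable_topology}, 'e::euclidean_space) atlas" and g +
  fixes D :: "'a connection"
  assumes lc: "levi_civita_connection A g D"
begin

lemma
  assumes "open U" "U \<subseteq> carrier A" "X \<in> vector_fields A U" "Y \<in> vector_fields A U" "p \<in> U"
  shows torsion_free: "lie_bracket A X Y p = D X Y p - D Y X p"
    and compatible: "Z \<in> vector_fields A U \<Longrightarrow>
      X p (\<lambda>q. g q (Y q) (Z q)) = g p (D X Y p) (Z p) + g p (Y p) (D X Z p)"
  using lc[unfolded levi_civita_connection_def, THEN conjunct2, THEN spec, of U, THEN mp, OF conjI[OF assms(1,2)],
      THEN bspec, OF assms(3), THEN bspec, OF assms(4), THEN bspec, OF assms(5)]
  by auto

sublocale connection_mfd A g D
proof
  show aff: "affine_connection A D"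
    using lc by (simp add: levi_civita_connection_def)
  fix U X Y
  assume U: "open U" "U \<subseteq> carrier A" and XY: "X \<in> vector_fields A U" "Y \<in> vector_fields A U"
  have D: "D X Y \<in> vector_fields A U" "D Y X \<in> vector_fields A U"
    using aff[unfolded affine_connection_def, THEN spec, of U] U XY by auto
  show "lie_bracket A X Y \<in> vector_fields A U"
    by (rule vf_cong[OF _ vf_diff[OF D]]) (simp add: torsion_free[OF U XY])
qed

text \<open>Compatibility expands the three derivatives of the metric and torsion-freeness the three
  brackets; all but two copies of \<open>g p (D X Y p) (Z p)\<close> cancel. The right-hand side is
  free of \<open>D\<close>, which makes the connection of the warped product computable.\<close>

lemma koszul:
  assumes U: "open U" "U \<subseteq> carrier A" "p \<in> U"
    and X: "X \<in> vector_fields A U" and Y: "Y \<in> vector_fields A U" and Z: "Z \<in> vector_fields A U"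
  shows "2 * g p (D X Y p) (Z p) =
    X p (\<lambda>q. g q (Y q) (Z q)) + Y p (\<lambda>q. g q (X q) (Z q)) - Z p (\<lambda>q. g q (X q) (Y q))
    + g p (lie_bracket A X Y p) (Z p) - g p (lie_bracket A X Z p) (Y p) - g p (lie_bracket A Y Z p) (X p)"
proof -
  note u = U(1,2)
  note T = vf_tangent[OF _ U(3)]
  note t = T[OF X] T[OF Y] T[OF Z] T[OF D_vf[OF u X Y]] T[OF D_vf[OF u Y X]] T[OF D_vf[OF u X Z]]
    T[OF D_vf[OF u Z X]] T[OF D_vf[OF u Y Z]] T[OF D_vf[OF u Z Y]]
  show ?thesis
    using t g_sym[OF t(2) t(6)] g_sym[OF t(1) t(8)] g_sym[OF t(1) t(9)]
    by (simp add: torsion_free[OF u _ _ U(3)] compatible[OF u _ _ U(3)] X Y Z g_diff_left)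
qed

text \<open>The two added terms are linear over smooth functions in both arguments, so the Leibniz
  rule is that of \<open>D\<close>.\<close>

lemma quarter_symmetric_affine:
  assumes P: "P \<in> vector_fields A (carrier A)"
  shows "affine_connection A (quarter_symmetric_connection g P l1 l2 D)" (is "affine_connection A ?D")
  unfolding affine_connection_def
proof (intro allI impI ballI conjI)
  fix U X Y
  assume "open U \<and> U \<subseteq> carrier A" and X: "X \<in> vector_fields A U" and Y: "Y \<in> vector_fields A U"
  then have U: "open U" "U \<subseteq> carrier A" by auto
  have PU: "P \<in> vector_fields A U" using P U vf_subset by blast
  have "D X Y + (\<lambda>q h. (l1 * g q (Y q) (P q)) * X q h) + (\<lambda>q h. (- l2 * g q (X q) (Y q)) * P q h) \<in> vector_fields A U"
    by (intro vf_add D_vf vf_smult smooth_fun_cmult g_smooth X Y PU U)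
  then show "?D X Y \<in> vector_fields A U"
    by (rule vf_cong[rotated]) (auto simp: quarter_symmetric_connection_def)
  fix p assume p: "p \<in> U"
  note T = vf_tangent[OF _ p]
  show "?D (X + Y) Z p = ?D X Z p + ?D Y Z p" if "Z \<in> vector_fields A U" for Z
    using D_add_left[OF U X Y p that] T[OF X] T[OF Y] T[OF that]
    by (auto simp: quarter_symmetric_connection_def g_add_left algebra_simps)
  show "?D X (Y + Z) p = ?D X Y p + ?D X Z p" if "Z \<in> vector_fields A U" for Z
    using D_add_right[OF U X Y p that] T[OF X] T[OF Y] T[OF that] T[OF PU]
    by (auto simp: quarter_symmetric_connection_def g_add_left g_add_right algebra_simps)
  show "?D (\<lambda>q h. a q * X q h) Y p = (\<lambda>h. a p * ?D X Y p h)" if "smooth_fun A U a" for a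
    using D_smult_left[OF U X Y p that] T[OF X] T[OF Y]
    by (auto simp: quarter_symmetric_connection_def g_scale_left algebra_simps)
  show "?D X (\<lambda>q h. a q * Y q h) p = (\<lambda>h. X p a * Y p h + a p * ?D X Y p h)" if "smooth_fun A U a" for a
    using D_smult_right[OF U X Y p that] T[OF X] T[OF Y] T[OF PU]
    by (auto simp: quarter_symmetric_connection_def g_scale_left g_scale_right algebra_simps)
qed

end

section \<open>Curvature of the quarter-symmetric connection\<close>

locale warped_product_connection = warped_product F gF I f + F: levi_civita_mfd F gF DF +
    M: levi_civita_mfd "interval_times I F" "warped_metric f gF" D
  for F :: "('a::{t2_space, second_countable_topology}, 'e::euclidean_space) atlas" and gF I f DF D +
  fixes l1 l2 :: real
begin

abbreviation T where "T \<equiv> time_field I F"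
abbreviation NB where "NB \<equiv> quarter_symmetric_connection g T l1 l2 D"

definition f' where "f' = deriv f"
definition f'' where "f'' = deriv f'"
text \<open>The logarithmic derivative of \<open>f\<close>: for the Levi-Civita connection, both the
  derivative of a lifted field along \<open>T\<close> and that of \<open>T\<close> along it are
  \<open>H\<close> times the lifted field.\<close>

definition H where "H t = f' t / f t"
definition H' where "H' t = (f'' t * f t - (f' t)\<^sup>2) / (f t)\<^sup>2"
text \<open>The coefficient of \<open>gF x (X x) (Y x) * T\<close> in
  \<open>NB (lift X) (lift Y)\<close>. The first summand comes from the Levi-Civita connection, the
  second from the term with \<open>l2\<close>.\<close>

definition B where "B t = f t * f' t - l2 * (f t)\<^sup>2"
definition B' where "B' t = (f' t)\<^sup>2 + f t * f'' t - 2 * l2 * f t * f' t"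

lemma f_deriv: "t \<in> I \<Longrightarrow> (f has_real_derivative f' t) (at t)" and smooth_f': "smooth_on I f'"
  using smooth_on_deriv[OF open_I smooth_f] by (auto simp: f'_def)

lemma f'_deriv: "t \<in> I \<Longrightarrow> (f' has_real_derivative f'' t) (at t)"
  using smooth_on_deriv[OF open_I smooth_f'] by (auto simp: f''_def)

lemma H_deriv: "t \<in> I \<Longrightarrow> (H has_real_derivative H' t) (at t)"
  unfolding H_def[abs_def] H'_def using f_pos[of t]
  by (auto intro!: derivative_eq_intros f_deriv f'_deriv simp: power2_eq_square)

lemma B_deriv: "t \<in> I \<Longrightarrow> (B has_real_derivative B' t) (at t)"
  unfolding B_def[abs_def] B'_def
  by (auto intro!: derivative_eq_intros f_deriv f'_deriv simp: power2_eq_square algebra_simps)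

lemma smooth_inverse_f: "smooth_on I (\<lambda>t. inverse (f t))"
proof (rule smooth_on_cong[OF open_I])
  show "smooth_on I (\<lambda>t. f t powr -1)"
    using f_pos by (intro smooth_on_compose[OF open_I smooth_f smooth_on_powr]) auto
  show "f t powr -1 = inverse (f t)" if "t \<in> I" for t
    using f_pos[OF that] by (simp add: powr_minus)
qed

lemma smooth_H: "smooth_on I H"
  unfolding H_def[abs_def] divide_inverse by (intro smooth_on_mult open_I smooth_f' smooth_inverse_f)

lemma smooth_B: "smooth_on I B"
proof -
  have "smooth_on I (\<lambda>t. f t * f' t + - l2 * (f t * f t))"
    by (intro smooth_on_add smooth_on_mult open_I smooth_f smooth_f' smooth_on_const)
  then show ?thesis by (rule smooth_on_cong[OF open_I, rotated]) (simp add: B_def power2_eq_square)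
qed

section \<open>Brackets and metric coefficients of \<open>T\<close> and of lifted fields\<close>

context
  fixes U
  assumes U: "open U" "U \<subseteq> carrier F"
begin

lemma IU: "open (I \<times> U)" "I \<times> U \<subseteq> carrier M"
  using U open_I by (auto simp: carrier_M open_Times)

lemma T_vf: "T \<in> vector_fields M (I \<times> U)"
  by (rule time_vf[OF IU(2,1)])

lemma L_vf: "X \<in> vector_fields F U \<Longrightarrow> lift X \<in> vector_fields M (I \<times> U)"
  by (rule lift_vf[OF _ U])

text \<open>Metric coefficients of lifts and the \<open>T\<close>-coefficients of the connection
  have this form; \<open>T\<close> differentiates the first factor and lifts the second.\<close>

lemma smooth_prod:
  "smooth_on I a \<Longrightarrow> smooth_fun F U k \<Longrightarrow> smooth_fun M (I \<times> U) (\<lambda>q. a (fst q) * k (snd q))"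
  using M.smooth_fun_mult[OF IU(1) smooth_fun_fst[OF _ U(1)] smooth_fun_snd[OF _ U(1)]] by simp

context
  fixes t x
  assumes t: "t \<in> I" and x: "x \<in> U"
begin

lemma p_mem: "(t, x) \<in> I \<times> U" using t x by simp

lemma T_apply:
  assumes "smooth_on I a" "smooth_fun F U k" "(a has_real_derivative a') (at t)"
  shows "T (t, x) (\<lambda>q. a (fst q) * k (snd q)) = a' * k x"
proof -
  have "smooth_near M (t, x) (\<lambda>q. a (fst q) * k (snd q))"
    by (rule M.smooth_nearI[OF smooth_prod[OF assms(1,2)] IU(1) p_mem IU(2)])
  moreover have "((\<lambda>s. a s * k x) has_real_derivative a' * k x) (at t)"
    by (auto intro!: derivative_eq_intros assms(3))
  ultimately show ?thesis by (simp add: time_field_def DERIV_imp_deriv)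
qed

lemma L_apply:
  assumes "X \<in> vector_fields F U" "smooth_on I a" "smooth_fun F U k"
  shows "lift X (t, x) (\<lambda>q. a (fst q) * k (snd q)) = a t * X x k"
proof -
  have "smooth_near M (t, x) (\<lambda>q. a (fst q) * k (snd q))"
    by (rule M.smooth_nearI[OF smooth_prod[OF assms(2,3)] IU(1) p_mem IU(2)])
  then show ?thesis
    using F.tangent_cmult_fun[OF F.vf_tangent[OF assms(1) x] F.smooth_nearI[OF assms(3) U(1) x U(2)]]
    by (simp add: lift_apply)
qed

lemma g_TT: "g (t, x) (T (t, x)) (T (t, x)) = -1"
  and g_TL: "X \<in> vector_fields F U \<Longrightarrow> g (t, x) (T (t, x)) (lift X (t, x)) = 0"
  and g_LT: "X \<in> vector_fields F U \<Longrightarrow> g (t, x) (lift X (t, x)) (T (t, x)) = 0"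
  and g_LL: "X \<in> vector_fields F U \<Longrightarrow> Y \<in> vector_fields F U \<Longrightarrow>
    g (t, x) (lift X (t, x)) (lift Y (t, x)) = (f t)\<^sup>2 * gF x (X x) (Y x)"
proof -
  have xF: "x \<in> carrier F" using U x by auto
  note tT = time_tangent[OF xF t]
  show "g (t, x) (T (t, x)) (T (t, x)) = -1"
    by (simp add: g_time[OF t tT] time_fst'[OF t xF])
  assume X: "X \<in> vector_fields F U"
  note Xx = F.vf_tangent[OF X x]
  note LX = lift_tangent[where X=X, OF xF t Xx]
  show "g (t, x) (lift X (t, x)) (T (t, x)) = 0"
    by (simp add: g_time[OF t LX] lift_fst'[where X=X, OF Xx])
  then show "g (t, x) (T (t, x)) (lift X (t, x)) = 0"
    using M.g_sym[OF tT LX] by simp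
  assume Y: "Y \<in> vector_fields F U"
  show "g (t, x) (lift X (t, x)) (lift Y (t, x)) = (f t)\<^sup>2 * gF x (X x) (Y x)"
    using g_lift[where X=Y, OF t LX F.vf_tangent[OF Y x]] push_lift[where X=X, OF t Xx] by simp
qed

text \<open>The brackets are tangent vectors because the connections are torsion free; hence it suffices to
  test them on \<open>fst\<close> and on functions from \<open>F\<close>, and no symmetry of second derivatives is needed.\<close>

lemma bracket_TL:
  assumes X: "X \<in> vector_fields F U"
  shows "lie_bracket M T (lift X) (t, x) = (\<lambda>h. 0)"
proof -
  note b = M.vf_tangent[OF M.lie_bracket_vf[OF IU T_vf L_vf[OF X]] p_mem]
  have xF: "x \<in> carrier F" using U x by auto
  have gT: "T (t, x) h = T (t, x) k" and gL: "lift X (t, x) h = lift X (t, x) k"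
    if "\<And>q. q \<in> I \<times> U \<Longrightarrow> h q = k q" for h k
    using M.tangent_germ[OF M.vf_tangent[OF T_vf p_mem] IU(1) p_mem that]
      M.tangent_germ[OF M.vf_tangent[OF L_vf[OF X] p_mem] IU(1) p_mem that] by auto
  have nf: "smooth_near M (t, x) fst" using smooth_near_fst[OF smooth_on_ident t xF] by simp
  show ?thesis
  proof (rule tangent_M_eqI[OF b M.tangent_zero])
    have "T (t, x) (\<lambda>q. lift X q fst) = T (t, x) (\<lambda>q. 0)"
      by (rule gT) (use lift_fst'[where X=X] F.vf_tangent[OF X] in auto)
    moreover have "lift X (t, x) (\<lambda>q. T q fst) = lift X (t, x) (\<lambda>q. 1)"
      by (rule gL) (use time_fst' U in auto)
    ultimately show "lie_bracket M T (lift X) (t, x) fst = 0"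
      by (simp add: M.lie_bracket_apply[OF nf] M.tangent_const[OF M.vf_tangent[OF T_vf p_mem]]
          M.tangent_const[OF M.vf_tangent[OF L_vf[OF X] p_mem]])
    fix k assume k: "smooth_near F x k"
    have "T (t, x) (\<lambda>q. lift X q (k \<circ> snd)) = T (t, x) ((\<lambda>y. X y k) \<circ> snd)"
      by (rule gT) (use lift_snd[where X=X] F.vf_tangent[OF X] in auto)
    moreover have "lift X (t, x) (\<lambda>q. T q (k \<circ> snd)) = lift X (t, x) (\<lambda>q. 0)"
      by (rule gL) (use time_snd in auto)
    ultimately show "push (lie_bracket M T (lift X) (t, x)) k = 0"
      using k by (simp add: M.lie_bracket_apply smooth_near_snd[OF t] time_snd
          M.tangent_const[OF M.vf_tangent[OF L_vf[OF X] p_mem]])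
  qed (use p_mem IU in auto)
qed

lemma bracket_LT:
  assumes X: "X \<in> vector_fields F U"
  shows "lie_bracket M (lift X) T (t, x) = (\<lambda>h. 0)"
  using bracket_TL[OF X] M.lie_bracket_flip[of "lift X" T] by (metis (no_types, lifting) ext minus_zero)

lemma bracket_LL:
  assumes X: "X \<in> vector_fields F U" and Y: "Y \<in> vector_fields F U"
  shows "lie_bracket M (lift X) (lift Y) (t, x) = lift (lie_bracket F X Y) (t, x)"
proof -
  note b = M.vf_tangent[OF M.lie_bracket_vf[OF IU L_vf[OF X] L_vf[OF Y]] p_mem]
  note XY = F.lie_bracket_vf[OF U X Y]
  note c = M.vf_tangent[OF L_vf[OF XY] p_mem]
  have xF: "x \<in> carrier F" using U x by auto
  have gL: "lift Z (t, x) h = lift Z (t, x) k"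
    if "\<And>q. q \<in> I \<times> U \<Longrightarrow> h q = k q" and Z: "Z \<in> vector_fields F U" for Z h k
    using M.tangent_germ[OF M.vf_tangent[OF L_vf[OF Z] p_mem] IU(1) p_mem that(1)] by auto
  have nf: "smooth_near M (t, x) fst" using smooth_near_fst[OF smooth_on_ident t xF] by simp
  show ?thesis
  proof (rule tangent_M_eqI[OF b c])
    have 0: "lift Z (t, x) (\<lambda>q. lift W q fst) = 0" if Z: "Z \<in> vector_fields F U" and W: "W \<in> vector_fields F U" for Z W
    proof -
      have "lift Z (t, x) (\<lambda>q. lift W q fst) = lift Z (t, x) (\<lambda>q. 0)"
        by (rule gL[OF _ Z]) (use lift_fst'[where X=W] F.vf_tangent[OF W] in auto)
      then show ?thesis by (simp add: M.tangent_const[OF M.vf_tangent[OF L_vf[OF Z] p_mem]])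
    qed
    show "lie_bracket M (lift X) (lift Y) (t, x) fst = lift (lie_bracket F X Y) (t, x) fst"
      using lift_fst'[where X="lie_bracket F X Y", OF F.vf_tangent[OF XY x]]
      by (simp add: M.lie_bracket_apply[OF nf] 0 X Y)
    fix k assume k: "smooth_near F x k"
    have 1: "lift Z (t, x) (\<lambda>q. lift W q (k \<circ> snd)) = Z x (\<lambda>y. W y k)"
      if Z: "Z \<in> vector_fields F U" and W: "W \<in> vector_fields F U" for Z W
    proof -
      have "lift Z (t, x) (\<lambda>q. lift W q (k \<circ> snd)) = lift Z (t, x) ((\<lambda>y. W y k) \<circ> snd)"
        by (rule gL[OF _ Z]) (use lift_snd[where X=W] F.vf_tangent[OF W] in auto)
      then show ?thesis using lift_snd[where X=Z, OF F.vf_tangent[OF Z x] t] by simp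
    qed
    show "push (lie_bracket M (lift X) (lift Y) (t, x)) k = push (lift (lie_bracket F X Y) (t, x)) k"
      using k lift_snd[where X="lie_bracket F X Y", OF F.vf_tangent[OF XY x] t]
      by (simp add: M.lie_bracket_apply smooth_near_snd[OF t] 1 X Y F.lie_bracket_apply)
  qed
qed

text \<open>Nondegeneracy of \<open>gF\<close> separates the push-forwards and pairing with
  \<open>T\<close> the time components. The test fields live on smaller sets \<open>V\<close>
  because a vector at \<open>x\<close> is extended by constant components inside a chart
  domain.\<close>

lemma M_eq_by_metric:
  assumes w: "w \<in> tangent_space M (t, x)" "w' \<in> tangent_space M (t, x)"
    and T: "g (t, x) w (T (t, x)) = g (t, x) w' (T (t, x))"
    and L: "\<And>z V Z. open V \<Longrightarrow> x \<in> V \<Longrightarrow> V \<subseteq> U \<Longrightarrow> Z \<in> vector_fields F V \<Longrightarrow>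
      g (t, x) w (lift Z (t, x)) = g (t, x) w' (lift Z (t, x))"
  shows "w = w'"
proof -
  note d = M.tangent_diff[OF w]
  have xF: "x \<in> carrier F" using U x by auto
  obtain V \<phi> where c: "(V, \<phi>) \<in> F" "x \<in> V" using xF F.carrier_chart by blast
  have V: "open (U \<inter> V)" "x \<in> U \<inter> V" using U x c F.chart_open by auto
  have "push (w - w') = 0"
  proof (rule F.g_nondegenerate[OF push_tangent[OF d]])
    fix v assume "v \<in> tangent_space F x"
    then obtain u where u: "v = chart_vec F V \<phi> u x" using F.tangent_chart_vec[OF _ c] by metis
    let ?Z = "chart_vec F V \<phi> u"
    have Z: "?Z \<in> vector_fields F (U \<inter> V)" by (rule F.vf_subset[OF F.chart_vec_vf[OF c(1)]]) auto
    note Zx = F.vf_tangent[OF Z V(2)]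
    have "g (t, x) (w - w') (lift ?Z (t, x)) = 0"
      using L[OF V _ Z] M.g_diff_left[OF w lift_tangent[where X="?Z", OF xF t Zx]] by simp
    then show "gF x (push (w - w')) v = 0"
      using g_lift[where X="?Z", OF t d Zx] f_pos[OF t] by (simp add: u)
  qed
  then have "push (w - w') k = 0" for k by (metis zero_fun_apply)
  moreover have "w fst = w' fst" using T g_time[OF t w(1)] g_time[OF t w(2)] by simp
  ultimately show ?thesis by (intro tangent_M_eqI[OF w]) (auto simp: fun_diff_def)
qed

end

text \<open>These metric coefficients are constant on \<open>I \<times> U\<close>, with value -1 or
  0, and a tangent vector sees only the germ.\<close>

lemma g_TT_fun: "T (t, x) (\<lambda>q. g q (T q) (T q)) = 0" "X \<in> vector_fields F U \<Longrightarrow> lift X (t, x) (\<lambda>q. g q (T q) (T q)) = 0"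
  "X \<in> vector_fields F U \<Longrightarrow> T (t, x) (\<lambda>q. g q (lift X q) (T q)) = 0"
  "X \<in> vector_fields F U \<Longrightarrow> T (t, x) (\<lambda>q. g q (T q) (lift X q)) = 0"
  "X \<in> vector_fields F U \<Longrightarrow> Y \<in> vector_fields F U \<Longrightarrow> lift Y (t, x) (\<lambda>q. g q (lift X q) (T q)) = 0"
  "X \<in> vector_fields F U \<Longrightarrow> Y \<in> vector_fields F U \<Longrightarrow> lift Y (t, x) (\<lambda>q. g q (T q) (lift X q)) = 0"
  if tx: "t \<in> I" "x \<in> U"
proof -
  have 1: "T (t, x) h = 0" "X \<in> vector_fields F U \<Longrightarrow> lift X (t, x) h = 0" if "\<And>q. q \<in> I \<times> U \<Longrightarrow> h q = c" for h c X
    using M.tangent_germ[OF M.vf_tangent[OF T_vf] IU(1), of "(t, x)" h "\<lambda>_. c"] M.tangent_const[OF M.vf_tangent[OF T_vf]]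
      M.tangent_germ[OF M.vf_tangent[OF L_vf] IU(1), of X "(t, x)" h "\<lambda>_. c"] M.tangent_const[OF M.vf_tangent[OF L_vf], of X]
      that tx by auto
  show "T (t, x) (\<lambda>q. g q (T q) (T q)) = 0" "X \<in> vector_fields F U \<Longrightarrow> lift X (t, x) (\<lambda>q. g q (T q) (T q)) = 0"
    by (rule 1[of _ "-1"]; force simp: g_TT)+
  show "X \<in> vector_fields F U \<Longrightarrow> T (t, x) (\<lambda>q. g q (lift X q) (T q)) = 0"
    "X \<in> vector_fields F U \<Longrightarrow> T (t, x) (\<lambda>q. g q (T q) (lift X q)) = 0"
    "X \<in> vector_fields F U \<Longrightarrow> Y \<in> vector_fields F U \<Longrightarrow> lift Y (t, x) (\<lambda>q. g q (lift X q) (T q)) = 0"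
    "X \<in> vector_fields F U \<Longrightarrow> Y \<in> vector_fields F U \<Longrightarrow> lift Y (t, x) (\<lambda>q. g q (T q) (lift X q)) = 0"
    by (rule 1[of _ 0]; force simp: g_TL g_LT)+
qed

lemma g_LL_fun:
  assumes X: "X \<in> vector_fields F U" and Y: "Y \<in> vector_fields F U" and tx: "t \<in> I" "x \<in> U"
  shows "T (t, x) (\<lambda>q. g q (lift X q) (lift Y q)) = 2 * f t * f' t * gF x (X x) (Y x)"
    and "Z \<in> vector_fields F U \<Longrightarrow>
      lift Z (t, x) (\<lambda>q. g q (lift X q) (lift Y q)) = (f t)\<^sup>2 * Z x (\<lambda>y. gF y (X y) (Y y))"
proof -
  have p: "(t, x) \<in> I \<times> U" using tx by simp
  have eq: "g q (lift X q) (lift Y q) = (f (fst q))\<^sup>2 * gF (snd q) (X (snd q)) (Y (snd q))" if "q \<in> I \<times> U" for q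
    using g_LL[of "fst q" "snd q" X Y] that X Y by auto
  have s: "smooth_on I (\<lambda>t. (f t)\<^sup>2)"
    using smooth_on_mult[OF open_I smooth_f smooth_f] by (simp add: power2_eq_square)
  note k = F.g_smooth[OF X Y U]
  have "T (t, x) (\<lambda>q. g q (lift X q) (lift Y q)) = T (t, x) (\<lambda>q. (f (fst q))\<^sup>2 * gF (snd q) (X (snd q)) (Y (snd q)))"
    by (rule M.tangent_germ[OF M.vf_tangent[OF T_vf p] IU(1) p eq])
  also have "\<dots> = 2 * f t * f' t * gF x (X x) (Y x)"
    by (rule T_apply[OF tx s k]) (use f_deriv[OF tx(1)] in \<open>auto intro!: derivative_eq_intros\<close>)
  finally show "T (t, x) (\<lambda>q. g q (lift X q) (lift Y q)) = 2 * f t * f' t * gF x (X x) (Y x)" .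
  assume Z: "Z \<in> vector_fields F U"
  have "lift Z (t, x) (\<lambda>q. g q (lift X q) (lift Y q)) = lift Z (t, x) (\<lambda>q. (f (fst q))\<^sup>2 * gF (snd q) (X (snd q)) (Y (snd q)))"
    by (rule M.tangent_germ[OF M.vf_tangent[OF L_vf[OF Z] p] IU(1) p eq])
  also have "\<dots> = (f t)\<^sup>2 * Z x (\<lambda>y. gF y (X y) (Y y))"
    by (rule L_apply[OF tx Z s k])
  finally show "lift Z (t, x) (\<lambda>q. g q (lift X q) (lift Y q)) = (f t)\<^sup>2 * Z x (\<lambda>y. gF y (X y) (Y y))" .
qed

end

text \<open>Among derivatives along \<open>T\<close>, only that of the metric coefficient of two
  lifts is nonzero; it brings \<open>2 * f t * f' t\<close>. Half of it is each
  \<open>f t * f' t\<close> below, and its sign depends on whether \<open>T\<close> stands in the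
  last slot. Without \<open>T\<close>, every term of the Koszul formula is
  \<open>(f t)\<^sup>2\<close> times the corresponding term on \<open>F\<close>.\<close>

lemma koszul_L:
  assumes V: "open V" "V \<subseteq> carrier F" "x \<in> V" and t: "t \<in> I"
  shows "g (t, x) (D T T (t, x)) (T (t, x)) = 0"
    and "Z \<in> vector_fields F V \<Longrightarrow> g (t, x) (D T T (t, x)) (lift Z (t, x)) = 0"
    and "X \<in> vector_fields F V \<Longrightarrow> g (t, x) (D (lift X) T (t, x)) (T (t, x)) = 0"
    and "X \<in> vector_fields F V \<Longrightarrow> Z \<in> vector_fields F V \<Longrightarrow>
      g (t, x) (D (lift X) T (t, x)) (lift Z (t, x)) = f t * f' t * gF x (X x) (Z x)"
    and "X \<in> vector_fields F V \<Longrightarrow> Y \<in> vector_fields F V \<Longrightarrow>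
      g (t, x) (D (lift X) (lift Y) (t, x)) (T (t, x)) = - f t * f' t * gF x (X x) (Y x)"
    and "X \<in> vector_fields F V \<Longrightarrow> Y \<in> vector_fields F V \<Longrightarrow> Z \<in> vector_fields F V \<Longrightarrow>
      g (t, x) (D (lift X) (lift Y) (t, x)) (lift Z (t, x)) = (f t)\<^sup>2 * gF x (DF X Y x) (Z x)"
proof -
  note VV = V(1,2)
  have p: "(t, x) \<in> I \<times> V" using t V by simp
  note K = M.koszul[OF IU[OF VV] p]
  note T = T_vf[OF VV] and L = L_vf[OF VV]
  note tT = M.vf_tangent[OF T p] and tL = M.vf_tangent[OF L p]
  note br = bracket_TL[OF VV t V(3)] bracket_LT[OF VV t V(3)] bracket_LL[OF VV t V(3)]
  note fn = g_TT_fun[OF VV t V(3)] g_LL_fun[OF VV _ _ t V(3)]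
  note gs = g_TT[OF VV t V(3)] g_TL[OF VV t V(3)] g_LT[OF VV t V(3)] g_LL[OF VV t V(3)]
  have b0: "lie_bracket M T T = (\<lambda>p h. 0)"
    by (intro ext) (simp add: lie_bracket_def)
  show "g (t, x) (D T T (t, x)) (T (t, x)) = 0"
    using K[OF T T T] by (simp add: fn b0 M.g_zero_left[OF tT])
  note lb = F.lie_bracket_vf[OF VV]
  show "g (t, x) (D T T (t, x)) (lift Z (t, x)) = 0" if Z: "Z \<in> vector_fields F V"
    using K[OF T T L[OF Z]] by (simp add: fn b0 br Z M.g_zero_left[OF tT] M.g_zero_left[OF tL[OF Z]])
  show "g (t, x) (D (lift X) T (t, x)) (T (t, x)) = 0" if X: "X \<in> vector_fields F V"
    using K[OF L[OF X] T T] by (simp add: fn b0 br X M.g_zero_left[OF tT] M.g_zero_left[OF tL[OF X]])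
  show "g (t, x) (D (lift X) T (t, x)) (lift Z (t, x)) = f t * f' t * gF x (X x) (Z x)"
    if X: "X \<in> vector_fields F V" and Z: "Z \<in> vector_fields F V"
    using K[OF L[OF X] T L[OF Z]]
    by (simp add: fn br X Z lb gs M.g_zero_left[OF tL[OF Z]] M.g_zero_left[OF tL[OF X]])
  show "g (t, x) (D (lift X) (lift Y) (t, x)) (T (t, x)) = - f t * f' t * gF x (X x) (Y x)"
    if X: "X \<in> vector_fields F V" and Y: "Y \<in> vector_fields F V"
    using K[OF L[OF X] L[OF Y] T] by (simp add: fn br X Y lb gs M.g_zero_left[OF tL[OF Y]] M.g_zero_left[OF tL[OF X]])
  show "g (t, x) (D (lift X) (lift Y) (t, x)) (lift Z (t, x)) = (f t)\<^sup>2 * gF x (DF X Y x) (Z x)"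
    if X: "X \<in> vector_fields F V" and Y: "Y \<in> vector_fields F V" and Z: "Z \<in> vector_fields F V"
  proof -
    have "2 * g (t, x) (D (lift X) (lift Y) (t, x)) (lift Z (t, x)) = (f t)\<^sup>2 * (2 * gF x (DF X Y x) (Z x))"
      unfolding K[OF L[OF X] L[OF Y] L[OF Z]] F.koszul[OF VV V(3) X Y Z]
      by (simp add: fn br X Y Z lb gs algebra_simps)
    then show ?thesis by simp
  qed
qed

section \<open>The Levi-Civita and the quarter-symmetric connection on \<open>T\<close> and lifted
  fields\<close>

context
  fixes U t x
  assumes U: "open U" "U \<subseteq> carrier F" and t: "t \<in> I" and x: "x \<in> U"
begin

lemma T_tangent: "T (t, x) \<in> tangent_space M (t, x)"
  using time_tangent t x U by auto

lemma L_tangent: "X \<in> vector_fields F U \<Longrightarrow> lift X (t, x) \<in> tangent_space M (t, x)"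
  using lift_tangent[where X=X] F.vf_tangent[of X] t x U by auto

lemma x_carrier: "x \<in> carrier F"
  using U x by auto

lemma p_in: "(t, x) \<in> I \<times> U" "(t, x) \<in> carrier M"
  using t x x_carrier by (auto simp: carrier_M)

lemmas IUU = IU[OF U]
lemmas D_tangent = M.vf_tangent[OF M.D_vf[OF IUU] p_in(1)]
lemmas T_U = T_vf[OF U] and L_U = L_vf[OF U]
lemmas gU = g_TT[OF U t x] g_TL[OF U t x] g_LT[OF U t x] g_LL[OF U t x]
lemmas M_eqI = M_eq_by_metric[OF U t x]

lemma D_TT: "D T T (t, x) = (\<lambda>h. 0)"
proof (rule M_eqI[OF D_tangent[OF T_U T_U] M.tangent_zero[OF p_in(2)]])
  show "g (t, x) (D T T (t, x)) (T (t, x)) = g (t, x) (\<lambda>h. 0) (T (t, x))"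
    using koszul_L(1)[OF U x t] M.g_zero_left[OF T_tangent] by simp
  show "g (t, x) (D T T (t, x)) (lift Z (t, x)) = g (t, x) (\<lambda>h. 0) (lift Z (t, x))"
    if V: "open V" "x \<in> V" "V \<subseteq> U" and Z: "Z \<in> vector_fields F V" for V Z
  proof -
    have VF: "V \<subseteq> carrier F" using V U by auto
    show ?thesis
      using koszul_L(2)[OF V(1) VF V(2) t Z] M.g_zero_left[OF lift_tangent[where X=Z, OF x_carrier t F.vf_tangent[OF Z V(2)]]]
      by simp
  qed
qed

lemma D_LT:
  assumes X: "X \<in> vector_fields F U"
  shows "D (lift X) T (t, x) = (\<lambda>h. H t * lift X (t, x) h)"
proof (rule M_eqI[OF D_tangent[OF L_U[OF X] T_U] M.tangent_scale[OF L_tangent[OF X]]])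
  show "g (t, x) (D (lift X) T (t, x)) (T (t, x)) = g (t, x) (\<lambda>h. H t * lift X (t, x) h) (T (t, x))"
    using koszul_L(3)[OF U x t X] M.g_scale_left[OF L_tangent[OF X] T_tangent] by (simp add: gU X)
  show "g (t, x) (D (lift X) T (t, x)) (lift Z (t, x)) = g (t, x) (\<lambda>h. H t * lift X (t, x) h) (lift Z (t, x))"
    if V: "open V" "x \<in> V" "V \<subseteq> U" and Z: "Z \<in> vector_fields F V" for V Z
  proof -
    have VF: "V \<subseteq> carrier F" and XV: "X \<in> vector_fields F V" using V U F.vf_subset[OF X] by auto
    note LZ = lift_tangent[where X=Z, OF x_carrier t F.vf_tangent[OF Z V(2)]]
    show ?thesis
      using koszul_L(4)[OF V(1) VF V(2) t XV Z] f_pos[OF t]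
      by (subst M.g_scale_left[OF L_tangent[OF X] LZ])
        (simp add: g_LL[OF V(1) VF t V(2) XV Z] H_def power2_eq_square)
  qed
qed

text \<open>The bracket of \<open>T\<close> with a lift vanishes, so torsion-freeness carries over
  the formula for the opposite order.\<close>

lemma D_TL:
  assumes X: "X \<in> vector_fields F U"
  shows "D T (lift X) (t, x) = (\<lambda>h. H t * lift X (t, x) h)"
  using M.torsion_free[OF IUU T_U L_U[OF X] p_in(1)] bracket_TL[OF U t x X] D_LT[OF X]
  by (simp add: fun_eq_iff)

text \<open>Pairing with \<open>T\<close> gives \<open>- f t * f' t * gF x (X x) (Y x)\<close>; the
  coefficient of \<open>T\<close> itself has the opposite sign because \<open>T\<close> has square
  -1.\<close>

lemma D_LL:
  assumes X: "X \<in> vector_fields F U" and Y: "Y \<in> vector_fields F U"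
  shows "D (lift X) (lift Y) (t, x) =
    (\<lambda>h. lift (DF X Y) (t, x) h + f t * f' t * gF x (X x) (Y x) * T (t, x) h)" (is "?l = ?r")
proof -
  note XY = F.D_vf[OF U X Y]
  note c = M.tangent_scale[OF T_tangent, of "f t * f' t * gF x (X x) (Y x)"]
  have r: "?r = lift (DF X Y) (t, x) + (\<lambda>h. f t * f' t * gF x (X x) (Y x) * T (t, x) h)"
    by (auto simp: plus_fun_def)
  have rt: "?r \<in> tangent_space M (t, x)"
    unfolding r by (rule M.tangent_add[OF L_tangent[OF XY] c])
  show ?thesis
  proof (rule M_eqI[OF D_tangent[OF L_U[OF X] L_U[OF Y]] rt])
    show "g (t, x) ?l (T (t, x)) = g (t, x) ?r (T (t, x))"
      unfolding r koszul_L(5)[OF U x t X Y]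
      by (simp add: M.g_add_left[OF L_tangent[OF XY] c T_tangent] M.g_scale_left[OF T_tangent T_tangent] gU XY)
    show "g (t, x) ?l (lift Z (t, x)) = g (t, x) ?r (lift Z (t, x))"
      if V: "open V" "x \<in> V" "V \<subseteq> U" and Z: "Z \<in> vector_fields F V" for V Z
    proof -
      have VF: "V \<subseteq> carrier F" and XV: "X \<in> vector_fields F V" "Y \<in> vector_fields F V" "DF X Y \<in> vector_fields F V"
        using V U F.vf_subset X Y XY by blast+
      note LZ = lift_tangent[where X=Z, OF x_carrier t F.vf_tangent[OF Z V(2)]]
      show ?thesis
        unfolding r koszul_L(6)[OF V(1) VF V(2) t XV(1,2) Z]
        by (simp add: M.g_add_left[OF L_tangent[OF XY] c LZ] M.g_scale_left[OF T_tangent LZ]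
            g_LL[OF V(1) VF t V(2) XV(3) Z] g_TL[OF V(1) VF t V(2) Z])
    qed
  qed
qed

text \<open>In this and the next three formulas, the \<open>l1\<close>-term contributes
  \<open>- l1\<close> times the first argument if the second is \<open>T\<close>, because
  \<open>T\<close> has square -1, and vanishes if the second is a lift. The \<open>l2\<close>-term
  gives \<open>+ l2 * T\<close> for the pair \<open>T\<close>, \<open>T\<close>, nothing for mixed
  pairs by orthogonality, and the second summand of \<open>B\<close> for two lifts.\<close>

lemma NB_TT: "NB T T (t, x) = (\<lambda>h. (l2 - l1) * T (t, x) h)"
  by (simp add: quarter_symmetric_connection_def D_TT gU algebra_simps)

lemma NB_TL: "X \<in> vector_fields F U \<Longrightarrow> NB T (lift X) (t, x) = (\<lambda>h. H t * lift X (t, x) h)"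
  by (simp add: quarter_symmetric_connection_def D_TL gU)

lemma NB_LT: "X \<in> vector_fields F U \<Longrightarrow> NB (lift X) T (t, x) = (\<lambda>h. (H t - l1) * lift X (t, x) h)"
  by (simp add: quarter_symmetric_connection_def D_LT gU algebra_simps)

lemma NB_LL: "X \<in> vector_fields F U \<Longrightarrow> Y \<in> vector_fields F U \<Longrightarrow> NB (lift X) (lift Y) (t, x) =
    (\<lambda>h. lift (DF X Y) (t, x) h + B t * gF x (X x) (Y x) * T (t, x) h)"
  by (simp add: quarter_symmetric_connection_def D_LL gU B_def algebra_simps)

end

sublocale NB: connection_mfd M g NB
proof
  show "affine_connection M NB"
    by (rule M.quarter_symmetric_affine[OF time_vf[OF order_refl M.open_carrier]])
qed (rule M.lie_bracket_vf)

end

section \<open>Curvature components of the quarter-symmetric connection\<close>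

context warped_product_connection
begin

context
  fixes U
  assumes U: "open U" "U \<subseteq> carrier F"
begin

lemmas UM = IU[OF U]
lemmas TU = T_vf[OF U] and LU = L_vf[OF U]

text \<open>An iterated derivative needs the inner one as a field around the point. These versions
  present it as an explicit combination of fields, which \<open>NB.D_cong\<close> can
  substitute.\<close>

lemma
  assumes "q \<in> I \<times> U"
  shows NB_TT_at: "NB T T q = (\<lambda>h. (l2 - l1) * T q h)"
    and NB_TL_at: "X \<in> vector_fields F U \<Longrightarrow> NB T (lift X) q = (\<lambda>h. H (fst q) * lift X q h)"
    and NB_LT_at: "X \<in> vector_fields F U \<Longrightarrow> NB (lift X) T q = (\<lambda>h. (H (fst q) - l1) * lift X q h)"
    and NB_LL_at: "X \<in> vector_fields F U \<Longrightarrow> Y \<in> vector_fields F U \<Longrightarrow> NB (lift X) (lift Y) q =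
      (lift (DF X Y) + (\<lambda>q h. B (fst q) * gF (snd q) (X (snd q)) (Y (snd q)) * T q h)) q"
  using assms NB_TT[OF U] NB_TL[OF U] NB_LT[OF U] NB_LL[OF U] by (auto simp: plus_fun_def)

lemma smooth_fst_U: "smooth_on I a \<Longrightarrow> smooth_fun M (I \<times> U) (\<lambda>q. a (fst q))"
  by (rule smooth_fun_fst[OF _ U(1)])

lemma smooth_H_minus: "smooth_on I (\<lambda>t. H t - l1)"
  using smooth_on_add[OF open_I smooth_H smooth_on_const[of I "- l1"]] by simp

lemma smooth_BgF: "X \<in> vector_fields F U \<Longrightarrow> Y \<in> vector_fields F U \<Longrightarrow>
    smooth_fun M (I \<times> U) (\<lambda>q. B (fst q) * gF (snd q) (X (snd q)) (Y (snd q)))"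
  by (rule smooth_prod[OF U smooth_B F.g_smooth[OF _ _ U]])

context
  fixes t x
  assumes t: "t \<in> I" and x: "x \<in> U"
begin

lemma pU: "(t, x) \<in> I \<times> U" using t x by simp

text \<open>The bracket is zero on \<open>I \<times> U\<close> only, so locality first replaces it
  by \<open>0 * T\<close>; homogeneity then gives zero.\<close>

lemma NB_bracket_TL:
  assumes X: "X \<in> vector_fields F U" and Z: "Z \<in> vector_fields M (I \<times> U)"
  shows "NB (lie_bracket M T (lift X)) Z (t, x) = (\<lambda>h. 0)" "NB (lie_bracket M (lift X) T) Z (t, x) = (\<lambda>h. 0)"
proof -
  have 0: "NB (\<lambda>q h. 0 * T q h) Z (t, x) = (\<lambda>h. 0)"
    using NB.D_smult_left[OF UM TU Z pU M.smooth_fun_const[of _ 0]] by simp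
  have "NB (lie_bracket M T (lift X)) Z (t, x) = NB (\<lambda>q h. 0 * T q h) Z (t, x)"
    by (rule NB.D_cong[OF UM pU M.lie_bracket_vf[OF UM TU LU[OF X]] _ Z])
      (auto simp: bracket_TL[OF U _ _ X])
  then show "NB (lie_bracket M T (lift X)) Z (t, x) = (\<lambda>h. 0)" using 0 by simp
  have "NB (lie_bracket M (lift X) T) Z (t, x) = NB (\<lambda>q h. 0 * T q h) Z (t, x)"
    by (rule NB.D_cong[OF UM pU M.lie_bracket_vf[OF UM LU[OF X] TU] _ Z])
      (auto simp: bracket_LT[OF U _ _ X])
  then show "NB (lie_bracket M (lift X) T) Z (t, x) = (\<lambda>h. 0)" using 0 by simp
qed

text \<open>\<open>H'\<close> comes from \<open>T\<close> differentiating the factor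
  \<open>H - l1\<close> of \<open>NB (lift X) T\<close>. The product collects
  \<open>(H - l1) * H\<close> from the same term and \<open>(l2 - l1) * (H - l1)\<close> from the
  opposite order.\<close>

lemma curvature_TLT:
  assumes X: "X \<in> vector_fields F U"
  shows "curvature M NB T (lift X) T (t, x) =
    (\<lambda>h. (H' t + (H t - l1) * (H t - l2 + l1)) * lift X (t, x) h)"
proof -
  have xF: "x \<in> carrier F" using x U by auto
  have d: "deriv (\<lambda>t. H t - l1) t = H' t"
    using H_deriv[OF t] by (intro DERIV_imp_deriv) (auto intro!: derivative_eq_intros)
  have "NB T (NB (lift X) T) (t, x) = NB T (\<lambda>q h. (H (fst q) - l1) * lift X q h) (t, x)"
    by (rule NB.D_cong[OF UM pU TU _ NB.D_vf[OF UM LU[OF X] TU]]) (simp_all add: NB_LT_at X)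
  also have "\<dots> = (\<lambda>h. H' t * lift X (t, x) h + (H t - l1) * (H t * lift X (t, x) h))"
    using NB.D_smult_right[OF UM TU LU[OF X] pU smooth_fst_U[OF smooth_H_minus]]
    by (simp add: time_fst[OF smooth_H_minus t xF] d NB_TL_at[OF pU X])
  finally have 1: "NB T (NB (lift X) T) (t, x) = (\<lambda>h. H' t * lift X (t, x) h + (H t - l1) * (H t * lift X (t, x) h))" .
  have "NB (lift X) (NB T T) (t, x) = NB (lift X) (\<lambda>q h. (l2 - l1) * T q h) (t, x)"
    by (rule NB.D_cong[OF UM pU LU[OF X] _ NB.D_vf[OF UM TU TU]]) (simp_all add: NB_TT_at)
  also have "\<dots> = (\<lambda>h. (l2 - l1) * ((H t - l1) * lift X (t, x) h))"
    using NB.D_smult_right[OF UM LU[OF X] TU pU M.smooth_fun_const[of _ "l2 - l1"]]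
      M.tangent_const[OF M.vf_tangent[OF LU[OF X] pU]]
    by (simp add: NB_LT_at[OF pU X])
  finally show ?thesis
    using 1 NB_bracket_TL(1)[OF X TU] by (auto simp: NB.curvature_apply algebra_simps)
qed

text \<open>The part tangent to \<open>F\<close> is \<open>H t\<close> times the lift of
  \<open>DF X Y\<close> in both orders and cancels; only multiples of \<open>T\<close> remain.
  \<open>B'\<close> is the time derivative of the coefficient \<open>B\<close>.\<close>

lemma curvature_LTL:
  assumes X: "X \<in> vector_fields F U" and Y: "Y \<in> vector_fields F U"
  shows "curvature M NB (lift X) T (lift Y) (t, x) =
    (\<lambda>h. (H t * B t - B' t - B t * (l2 - l1)) * gF x (X x) (Y x) * T (t, x) h)"
proof -
  note XY = F.D_vf[OF U X Y]
  let ?c = "\<lambda>q. B (fst q) * gF (snd q) (X (snd q)) (Y (snd q))"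
  have "NB (lift X) (NB T (lift Y)) (t, x) = NB (lift X) (\<lambda>q h. H (fst q) * lift Y q h) (t, x)"
    by (rule NB.D_cong[OF UM pU LU[OF X] _ NB.D_vf[OF UM TU LU[OF Y]]]) (simp_all add: NB_TL_at Y)
  also have "\<dots> = (\<lambda>h. H t * NB (lift X) (lift Y) (t, x) h)"
    using NB.D_smult_right[OF UM LU[OF X] LU[OF Y] pU smooth_fst_U[OF smooth_H]]
    by (simp add: lift_fst[where X=X, OF F.vf_tangent[OF X x]])
  finally have 1: "NB (lift X) (NB T (lift Y)) (t, x) = (\<lambda>h. H t * NB (lift X) (lift Y) (t, x) h)" .
  have cT: "(\<lambda>q h. ?c q * T q h) \<in> vector_fields M (I \<times> U)"
    by (rule M.vf_smult[OF TU smooth_BgF[OF X Y]])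
  have "NB T (NB (lift X) (lift Y)) (t, x) = NB T (lift (DF X Y) + (\<lambda>q h. ?c q * T q h)) (t, x)"
    by (rule NB.D_cong[OF UM pU TU _ NB.D_vf[OF UM LU[OF X] LU[OF Y]] NB_LL_at[OF _ X Y]]) simp_all
  also have "\<dots> = NB T (lift (DF X Y)) (t, x) + NB T (\<lambda>q h. ?c q * T q h) (t, x)"
    by (rule NB.D_add_right[OF UM TU LU[OF XY] pU cT])
  finally have 2: "NB T (NB (lift X) (lift Y)) (t, x) = NB T (lift (DF X Y)) (t, x) + NB T (\<lambda>q h. ?c q * T q h) (t, x)" .
  have 3: "NB T (\<lambda>q h. ?c q * T q h) (t, x) =
      (\<lambda>h. B' t * gF x (X x) (Y x) * T (t, x) h + B t * gF x (X x) (Y x) * ((l2 - l1) * T (t, x) h))"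
    using NB.D_smult_right[OF UM TU TU pU smooth_BgF[OF X Y]]
    by (simp add: T_apply[OF U t x smooth_B F.g_smooth[OF X Y U] B_deriv[OF t]] NB_TT_at[OF pU])
  show ?thesis
    using 1 2 3 NB_bracket_TL(2)[OF X LU[OF Y]]
    by (auto simp: NB.curvature_apply NB_LL_at[OF pU X Y] NB_TL_at[OF pU XY] algebra_simps)
qed

text \<open>The \<open>T\<close>-component stays an anonymous \<open>a\<close>: the result will only
  be paired with lifts, which are orthogonal to \<open>T\<close>.\<close>

lemma NB_LLL:
  assumes X: "X \<in> vector_fields F U" and Y: "Y \<in> vector_fields F U" and Z: "Z \<in> vector_fields F U"
  shows "\<exists>a. \<forall>h. NB (lift X) (NB (lift Y) (lift Z)) (t, x) h =
    lift (DF X (DF Y Z)) (t, x) h + a * T (t, x) h + B t * (H t - l1) * gF x (Y x) (Z x) * lift X (t, x) h"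
proof -
  note YZ = F.D_vf[OF U Y Z]
  let ?c = "\<lambda>q. B (fst q) * gF (snd q) (Y (snd q)) (Z (snd q))"
  have cT: "(\<lambda>q h. ?c q * T q h) \<in> vector_fields M (I \<times> U)"
    by (rule M.vf_smult[OF TU smooth_BgF[OF Y Z]])
  have "NB (lift X) (NB (lift Y) (lift Z)) (t, x) = NB (lift X) (lift (DF Y Z) + (\<lambda>q h. ?c q * T q h)) (t, x)"
    by (rule NB.D_cong[OF UM pU LU[OF X] _ NB.D_vf[OF UM LU[OF Y] LU[OF Z]] NB_LL_at[OF _ Y Z]]) simp_all
  also have "\<dots> = NB (lift X) (lift (DF Y Z)) (t, x) + NB (lift X) (\<lambda>q h. ?c q * T q h) (t, x)"
    by (rule NB.D_add_right[OF UM LU[OF X] LU[OF YZ] pU cT])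
  finally have 1: "NB (lift X) (NB (lift Y) (lift Z)) (t, x) =
      NB (lift X) (lift (DF Y Z)) (t, x) + NB (lift X) (\<lambda>q h. ?c q * T q h) (t, x)" .
  have 2: "NB (lift X) (\<lambda>q h. ?c q * T q h) (t, x) =
      (\<lambda>h. lift X (t, x) ?c * T (t, x) h + B t * gF x (Y x) (Z x) * ((H t - l1) * lift X (t, x) h))"
    using NB.D_smult_right[OF UM LU[OF X] TU pU smooth_BgF[OF Y Z]]
    by (simp add: NB_LT_at[OF pU X])
  have "NB (lift X) (NB (lift Y) (lift Z)) (t, x) h =
    lift (DF X (DF Y Z)) (t, x) h + (B t * gF x (X x) (DF Y Z x) + lift X (t, x) ?c) * T (t, x) h
      + B t * (H t - l1) * gF x (Y x) (Z x) * lift X (t, x) h" for h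
    by (simp only: 1 plus_fun_apply 2 NB_LL_at[OF pU X YZ]) (simp add: algebra_simps)
  then show ?thesis by blast
qed

text \<open>An analogue of the Gauss equation. Pairing with a lift sees only the push-forward, which
  is the curvature of \<open>F\<close> plus a correction: \<open>NB\<close> sends two lifts to a
  multiple of \<open>T\<close> with factor \<open>B\<close>, and \<open>T\<close> back to a lift
  with factor \<open>H - l1\<close>.\<close>

lemma curvature_LLL:
  assumes X: "X \<in> vector_fields F U" and Y: "Y \<in> vector_fields F U" and Z: "Z \<in> vector_fields F U"
    and W: "W \<in> vector_fields F U"
  shows "g (t, x) (curvature M NB (lift X) (lift Y) (lift Z) (t, x)) (lift W (t, x)) =
    (f t)\<^sup>2 * (gF x (curvature F DF X Y Z x) (W x) + B t * (H t - l1) *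
      (gF x (Y x) (Z x) * gF x (X x) (W x) - gF x (X x) (Z x) * gF x (Y x) (W x)))"
proof -
  let ?R = "curvature M NB (lift X) (lift Y) (lift Z) (t, x)"
  note XY = F.lie_bracket_vf[OF U X Y]
  obtain a where a: "\<forall>h. NB (lift X) (NB (lift Y) (lift Z)) (t, x) h =
    lift (DF X (DF Y Z)) (t, x) h + a * T (t, x) h + B t * (H t - l1) * gF x (Y x) (Z x) * lift X (t, x) h"
    using NB_LLL[OF X Y Z] by blast
  obtain b where b: "\<forall>h. NB (lift Y) (NB (lift X) (lift Z)) (t, x) h =
    lift (DF Y (DF X Z)) (t, x) h + b * T (t, x) h + B t * (H t - l1) * gF x (X x) (Z x) * lift Y (t, x) h"
    using NB_LLL[OF Y X Z] by blast
  have "NB (lie_bracket M (lift X) (lift Y)) (lift Z) (t, x) = NB (lift (lie_bracket F X Y)) (lift Z) (t, x)"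
    by (rule NB.D_cong[OF UM pU M.lie_bracket_vf[OF UM LU[OF X] LU[OF Y]] _ LU[OF Z]])
      (auto simp: bracket_LL[OF U _ _ X Y])
  then have c: "NB (lie_bracket M (lift X) (lift Y)) (lift Z) (t, x) h =
      lift (DF (lie_bracket F X Y) Z) (t, x) h + B t * gF x (lie_bracket F X Y x) (Z x) * T (t, x) h" for h
    by (simp add: NB_LL_at[OF pU XY Z])
  define \<alpha> \<beta> where "\<alpha> = B t * (H t - l1) * gF x (Y x) (Z x)" and "\<beta> = - (B t * (H t - l1) * gF x (X x) (Z x))"
  note D = F.D_vf[OF U]
  have P: "push ?R = curvature F DF X Y Z x + ((\<lambda>k. \<alpha> * X x k) + (\<lambda>k. \<beta> * Y x k))"
  proof
    fix k
    have l: "lift V (t, x) (k \<circ> snd) = V x k" if "V \<in> vector_fields F U" for V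
      using lift_snd[where X=V, OF F.vf_tangent[OF that x] t] .
    show "push ?R k = (curvature F DF X Y Z x + ((\<lambda>k. \<alpha> * X x k) + (\<lambda>k. \<beta> * Y x k))) k"
      by (simp add: NB.curvature_apply a b c F.curvature_apply l X Y Z D XY time_snd \<alpha>_def \<beta>_def)
  qed
  have R: "?R \<in> tangent_space M (t, x)"
    by (rule M.vf_tangent[OF NB.curvature_vf[OF UM LU[OF X] LU[OF Y] LU[OF Z]] pU])
  have Q: "gF x (curvature F DF X Y Z x + ((\<lambda>k. \<alpha> * X x k) + (\<lambda>k. \<beta> * Y x k))) (W x) =
      gF x (curvature F DF X Y Z x) (W x) + (\<alpha> * gF x (X x) (W x) + \<beta> * gF x (Y x) (W x))"
    using F.vf_tangent[OF F.curvature_vf[OF U X Y Z] x] F.vf_tangent[OF X x] F.vf_tangent[OF Y x] F.vf_tangent[OF W x]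
    by (simp add: F.g_add_left F.g_scale_left F.tangent_scale F.tangent_add)
  show ?thesis
    unfolding g_lift[where X=W, OF t R F.vf_tangent[OF W x]] P Q by (simp add: \<alpha>_def \<beta>_def algebra_simps)
qed

end

end

text \<open>Curvature is computed on \<open>T\<close> and plain lifts, whose brackets are simple;
  this lemma inserts the normalizing factors \<open>1 / f\<close> afterwards.\<close>

lemma scaled_curvature:
  assumes U: "open U" "U \<subseteq> carrier M" "p \<in> U"
    and V: "X \<in> vector_fields M U" "Y \<in> vector_fields M U" "Z \<in> vector_fields M U" "W \<in> vector_fields M U"
    and a: "smooth_fun M U a" "smooth_fun M U b" "smooth_fun M U c" "smooth_fun M U d"
  shows "g p (curvature M NB (\<lambda>q h. a q * X q h) (\<lambda>q h. b q * Y q h) (\<lambda>q h. c q * Z q h) p) (\<lambda>h. d p * W p h)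
    = a p * b p * c p * d p * g p (curvature M NB X Y Z p) (W p)"
proof -
  note u = U(1,2)
  have Y: "(\<lambda>q h. b q * Y q h) \<in> vector_fields M U" and Z: "(\<lambda>q h. c q * Z q h) \<in> vector_fields M U"
    using V a M.vf_smult by blast+
  have "curvature M NB (\<lambda>q h. a q * X q h) (\<lambda>q h. b q * Y q h) (\<lambda>q h. c q * Z q h) p
      = (\<lambda>h. a p * b p * c p * curvature M NB X Y Z p h)"
    using NB.curvature_smult_1[OF u V(1) Y Z U(3) a(1)] NB.curvature_smult_2[OF u V(1,2) Z U(3) a(2)]
      NB.curvature_smult_3[OF u V(1-3) U(3) a(3)] by (simp add: mult.assoc)
  then show ?thesis
    using M.vf_tangent[OF NB.curvature_vf[OF u V(1-3)] U(3)] M.vf_tangent[OF V(4) U(3)]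
    by (simp add: M.g_scale_left M.g_scale_right M.tangent_scale)
qed

text \<open>The metric of two lifts is \<open>(f t)\<^sup>2\<close> times that on \<open>F\<close>,
  hence the factor \<open>inverse (f t)\<close>. The factor 1 at \<open>T\<close> gives every member
  the shape that \<open>scaled_curvature\<close> expects.\<close>

definition frame_M :: "(nat \<Rightarrow> 'a vfield) \<Rightarrow> nat \<Rightarrow> (real \<times> 'a) vfield" where
  "frame_M E i = (case i of 0 \<Rightarrow> (\<lambda>q h. 1 * T q h) | Suc i \<Rightarrow> (\<lambda>q h. inverse (f (fst q)) * lift (E i) q h))"

lemma frame_M_orthonormal:
  assumes fr: "orthonormal_frame F gF U \<epsilon> E"
  shows "orthonormal_frame M g (I \<times> U) (case_nat (-1) \<epsilon>) (frame_M E)"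
proof -
  let ?n = "DIM('e)"
  have U: "open U" "U \<subseteq> carrier F" and E: "\<And>i. i < ?n \<Longrightarrow> \<epsilon> i \<in> {1, -1} \<and> E i \<in> vector_fields F U"
    and orth: "\<And>i j x. i < ?n \<Longrightarrow> j < ?n \<Longrightarrow> x \<in> U \<Longrightarrow> gF x (E i x) (E j x) = (if i = j then \<epsilon> i else 0)"
    using fr by (auto simp: orthonormal_frame_def)
  have vf: "frame_M E i \<in> vector_fields M (I \<times> U)" if "i < Suc ?n" for i
    using that E M.vf_smult[OF L_vf[OF U] smooth_fun_fst[OF smooth_inverse_f U(1)]] T_vf[OF U]
    by (cases i) (auto simp: frame_M_def)
  have "g p (frame_M E i p) (frame_M E j p) = (if i = j then case_nat (-1) \<epsilon> i else 0)"
    if ij: "i < Suc ?n" "j < Suc ?n" and pU: "p \<in> I \<times> U" for i j p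
  proof -
    obtain t x where p: "p = (t, x)" and tx: "t \<in> I" "x \<in> U" using pU by auto
    have tT: "T (t, x) \<in> tangent_space M (t, x)" using M.vf_tangent[OF T_vf[OF U]] tx by auto
    have tL: "lift (E k) (t, x) \<in> tangent_space M (t, x)" if "k < ?n" for k
      using M.vf_tangent[OF L_vf[OF U]] E[OF that] tx by blast
    have s: "inverse (f t) * (inverse (f t) * ((f t)\<^sup>2 * c)) = c" for c
      using f_pos[OF tx(1)] by (simp add: power2_eq_square field_simps)
    show ?thesis
      using ij E tT tL orth[OF _ _ tx(2)]
      by (cases i; cases j)
        (auto simp: frame_M_def p g_TT[OF U tx] g_TL[OF U tx] g_LT[OF U tx] g_LL[OF U tx]
          M.g_scale_left M.g_scale_right M.tangent_scale s)
  qed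
  then show ?thesis
    using E vf IU[OF U] by (auto simp: orthonormal_frame_def split: nat.split)
qed

text \<open>The double sum splits by the type of the index pair: two lifts give the curvature of
  \<open>F\<close> and, in the last summand, the correction of \<open>curvature_LLL\<close>; the
  pairs of \<open>T\<close> and a lift, in the two orders, give the two terms with factor
  \<open>DIM('e)\<close>.\<close>

lemma scalar_curvature_M:
  assumes t: "t \<in> I" and x: "x \<in> carrier F"
  shows "scalar_curvature M g NB (t, x) = scalar_curvature F gF DF x / (f t)\<^sup>2
    + real DIM('e) * (- (H' t + (H t - l1) * (H t - l2 + l1)) + (H t * B t - B' t - B t * (l2 - l1)) / (f t)\<^sup>2)
    + B t / (f t)\<^sup>2 * (H t - l1) * (real DIM('e) - (real DIM('e))\<^sup>2)"
proof -
  let ?n = "DIM('e)"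
  obtain U \<epsilon> E where fr: "orthonormal_frame F gF U \<epsilon> E" "x \<in> U" using F.frame_exists[OF x] .
  have U: "open U" "U \<subseteq> carrier F" and E: "\<And>i. i < ?n \<Longrightarrow> \<epsilon> i \<in> {1, -1} \<and> E i \<in> vector_fields F U"
    and orth: "\<And>i j x. i < ?n \<Longrightarrow> j < ?n \<Longrightarrow> x \<in> U \<Longrightarrow> gF x (E i x) (E j x) = (if i = j then \<epsilon> i else 0)"
    using fr by (auto simp: orthonormal_frame_def)
  have p: "(t, x) \<in> I \<times> U" using t fr by simp
  note M1 = NB.scalar_curvature_frame[OF frame_M_orthonormal[OF fr(1)] p]
  have dim: "DIM(real \<times> 'e) = Suc ?n" by simp
  define r where "r = inverse (f t)"
  have r: "r > 0" "r * f t = 1" using f_pos[OF t] by (auto simp: r_def)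
  let ?K = "\<lambda>i j. g (t, x) (curvature M NB (frame_M E i) (frame_M E j) (frame_M E i) (t, x)) (frame_M E j (t, x))"
  define \<alpha> where "\<alpha> = H' t + (H t - l1) * (H t - l2 + l1)"
  define \<beta> where "\<beta> = H t * B t - B' t - B t * (l2 - l1)"
  note IU = IU[OF U] and TV = T_vf[OF U] and LV = L_vf[OF U]
  note gs = g_TT[OF U t fr(2)] g_LL[OF U t fr(2)]
  have tT: "T (t, x) \<in> tangent_space M (t, x)" by (rule M.vf_tangent[OF TV p])
  have tL: "lift (E k) (t, x) \<in> tangent_space M (t, x)" if "k < ?n" for k
    using M.vf_tangent[OF LV _] E[OF that] p by blast
  note one = M.smooth_fun_const[of "I \<times> U" 1] and inv = smooth_fun_fst[OF smooth_inverse_f U(1)]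
  have K00: "?K 0 0 = 0"
  proof -
    have "curvature M NB T T T (t, x) = (\<lambda>h. 0)"
      using fun_cong[OF NB.curvature_flip[OF IU TV TV TV p]] by (intro ext) simp
    then show ?thesis
      by (simp add: frame_M_def M.g_zero_left[OF tT])
  qed
  have e2: "\<epsilon> k * \<epsilon> k = 1" if "k < ?n" for k using E[OF that] by auto
  have K0: "\<epsilon> k * ?K 0 (Suc k) = \<alpha>" if k: "k < ?n" for k
  proof -
    have "?K 0 (Suc k) = r * r * g (t, x) (curvature M NB T (lift (E k)) T (t, x)) (lift (E k) (t, x))"
      using scaled_curvature[OF IU p TV LV TV LV one inv one inv] E[OF k] by (simp add: frame_M_def r_def)
    also have "\<dots> = r * r * (\<alpha> * ((f t)\<^sup>2 * \<epsilon> k))"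
      using E[OF k] tL[OF k] orth[OF k k fr(2)]
      by (simp add: curvature_TLT[OF U t fr(2)] M.g_scale_left gs \<alpha>_def)
    also have "\<dots> = (r * f t) * (r * f t) * \<alpha> * \<epsilon> k" by (simp add: power2_eq_square)
    finally show ?thesis using r(2) e2[OF k] by (simp add: mult.left_commute)
  qed
  \<comment> \<open>Here the minus sign is the square of \<open>T\<close>.\<close>
  have K1: "\<epsilon> k * ?K (Suc k) 0 = - (r * r * \<beta>)" if k: "k < ?n" for k
  proof -
    have "?K (Suc k) 0 = r * r * g (t, x) (curvature M NB (lift (E k)) T (lift (E k)) (t, x)) (T (t, x))"
      using scaled_curvature[OF IU p LV TV LV TV inv one inv one] E[OF k] by (simp add: frame_M_def r_def)
    also have "\<dots> = - (r * r * \<beta> * \<epsilon> k)"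
      using E[OF k] tT orth[OF k k fr(2)]
      by (simp add: curvature_LTL[OF U t fr(2)] M.g_scale_left gs \<beta>_def)
    finally show ?thesis using e2[OF k] by (simp add: algebra_simps)
  qed
  have K2: "\<epsilon> j * \<epsilon> k * ?K (Suc j) (Suc k) = r * r * (\<epsilon> j * \<epsilon> k * gF x (curvature F DF (E j) (E k) (E j) x) (E k x))
      + r * r * B t * (H t - l1) * ((if j = k then 1 else 0) - 1)" if j: "j < ?n" and k: "k < ?n" for j k
  proof -
    let ?c = "gF x (curvature F DF (E j) (E k) (E j) x) (E k x)"
    have "?K (Suc j) (Suc k) = r * r * r * r * g (t, x) (curvature M NB (lift (E j)) (lift (E k)) (lift (E j)) (t, x)) (lift (E k) (t, x))"
      using scaled_curvature[OF IU p LV LV LV LV inv inv inv inv] E[OF k] E[OF j] by (simp add: frame_M_def r_def)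
    also have "\<dots> = (r * f t) * (r * f t) * (r * r) * (?c + B t * (H t - l1) * ((if j = k then 1 else 0) - \<epsilon> j * \<epsilon> k))"
      using E[OF j] E[OF k] orth[OF j k fr(2)] orth[OF k j fr(2)] orth[OF j j fr(2)] orth[OF k k fr(2)] e2[OF j] e2[OF k]
      by (simp add: curvature_LLL[OF U t fr(2)] power2_eq_square)
    also have "\<dots> = r * r * ?c + r * r * B t * (H t - l1) * ((if j = k then 1 else 0) - \<epsilon> j * \<epsilon> k)"
      using r(2) by (simp add: algebra_simps)
    finally have K: "?K (Suc j) (Suc k) = r * r * ?c + r * r * B t * (H t - l1) * ((if j = k then 1 else 0) - \<epsilon> j * \<epsilon> k)" .
    \<comment> \<open>The signs occur squared, so the correction does not depend on the signature:
      it is 0 on the diagonal, as antisymmetry of the curvature demands, and -1 off it.\<close>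
    have "\<epsilon> j * \<epsilon> k * ((if j = k then 1 else 0) - \<epsilon> j * \<epsilon> k) = (if j = k then 1 else 0) - 1"
      using E[OF j] E[OF k] by auto
    moreover have "\<epsilon> j * \<epsilon> k * (r * r * ?c + r * r * B t * (H t - l1) * d) =
        r * r * (\<epsilon> j * \<epsilon> k * ?c) + r * r * B t * (H t - l1) * (\<epsilon> j * \<epsilon> k * d)" for d
      by (simp add: algebra_simps)
    ultimately show ?thesis unfolding K by simp
  qed
  let ?e = "case_nat (-1) \<epsilon> :: nat \<Rightarrow> real"
  have "scalar_curvature M g NB (t, x) = (\<Sum>i<Suc ?n. \<Sum>j<Suc ?n. ?e i * ?e j * ?K i j)"
    using M1 by (simp add: dim)
  \<comment> \<open>The frame sign -1 of \<open>T\<close> negates both kinds of mixed terms; in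
    \<open>K1\<close> it undoes the minus sign that came from the metric.\<close>
  also have "\<dots> = (\<Sum>k<?n. - (\<epsilon> k * ?K 0 (Suc k))) + (\<Sum>j<?n. - (\<epsilon> j * ?K (Suc j) 0) + (\<Sum>k<?n. \<epsilon> j * \<epsilon> k * ?K (Suc j) (Suc k)))"
    unfolding sum.lessThan_Suc_shift by (simp add: K00)
  also have "\<dots> = (\<Sum>k<?n. - \<alpha>) + (\<Sum>j<?n. r * r * \<beta> +
      (\<Sum>k<?n. r * r * (\<epsilon> j * \<epsilon> k * gF x (curvature F DF (E j) (E k) (E j) x) (E k x))
      + r * r * B t * (H t - l1) * ((if j = k then 1 else 0) - 1)))"
    by (intro arg_cong2[where f="(+)"] sum.cong refl) (simp_all add: K0 K1 K2)
  also have "\<dots> = real ?n * (- \<alpha>) + real ?n * (r * r * \<beta>) + r * r * scalar_curvature F gF DF x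
      + r * r * B t * (H t - l1) * (\<Sum>j<?n. \<Sum>k<?n. (if j = k then 1 else 0) - 1)"
    unfolding F.scalar_curvature_frame[OF fr] by (simp add: sum.distrib sum_distrib_left)
  finally have S: "scalar_curvature M g NB (t, x) = real ?n * (- \<alpha>) + real ?n * (r * r * \<beta>) + r * r * scalar_curvature F gF DF x
      + r * r * B t * (H t - l1) * (\<Sum>j<?n. \<Sum>k<?n. (if j = k then 1 else 0) - 1)" .
  \<comment> \<open>Minus the number of ordered pairs of distinct indices.\<close>
  have N: "(\<Sum>j<?n. \<Sum>k<?n. (if j = k then 1 else 0) - (1::real)) = real ?n - (real ?n)\<^sup>2"
    by (simp add: sum_subtractf power2_eq_square algebra_simps)
  show ?thesis
    unfolding S N using f_pos[OF t] by (simp add: \<alpha>_def \<beta>_def r_def power2_eq_square field_simps)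
qed

text \<open>The grouping shows the derivatives of \<open>(f t)\<^sup>2\<close>. The coefficient of
  \<open>f t * f' t\<close> is \<open>n\<^sup>2 * (l1 + l2)\<close> for a fibre of dimension
  \<open>n\<close>, hence \<open>9/2\<close> in front of the first derivative when
  \<open>n = 3\<close>.\<close>

lemma scalar_curvature_M_3:
  assumes t: "t \<in> I" and x: "x \<in> carrier F" and dim: "DIM('e) = 3"
  shows "scalar_curvature M g NB (t, x) * (f t)\<^sup>2 = scalar_curvature F gF DF x
    - 3 * (2 * (f' t)\<^sup>2 + 2 * f t * f'' t) + 9/2 * (l1 + l2) * (2 * f t * f' t)
    + (3 * l1\<^sup>2 + 3 * l2\<^sup>2 - 12 * l1 * l2) * (f t)\<^sup>2"
  unfolding scalar_curvature_M[OF t x] dim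
  using f_pos[OF t] by (simp add: H_def H'_def B_def B'_def power2_eq_square field_simps)

end

section \<open>The differential equation of the warping function\<close>

text \<open>Variation of constants: both coefficients are quotients of Wronskians, which satisfy the same
  first-order equation.\<close>

lemma linear_ode_2_solution:
  fixes y1 y2 w :: "real \<Rightarrow> real"
  assumes I: "is_interval I"
    and y1: "\<And>t. t \<in> I \<Longrightarrow> (y1 has_real_derivative y1' t) (at t)"
      "\<And>t. t \<in> I \<Longrightarrow> (y1' has_real_derivative a * y1' t + b * y1 t) (at t)"
    and y2: "\<And>t. t \<in> I \<Longrightarrow> (y2 has_real_derivative y2' t) (at t)"
      "\<And>t. t \<in> I \<Longrightarrow> (y2' has_real_derivative a * y2' t + b * y2 t) (at t)"
    and w: "\<And>t. t \<in> I \<Longrightarrow> (w has_real_derivative w' t) (at t)"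
      "\<And>t. t \<in> I \<Longrightarrow> (w' has_real_derivative a * w' t + b * w t) (at t)"
    and W: "\<And>t. t \<in> I \<Longrightarrow> y1 t * y2' t - y1' t * y2 t \<noteq> 0"
  shows "\<exists>c1 c2. \<forall>t\<in>I. w t = c1 * y1 t + c2 * y2 t"
proof -
  let ?W = "\<lambda>t. y1 t * y2' t - y1' t * y2 t"
  have const: "\<exists>c. \<forall>t\<in>I. N t / ?W t = c" if N: "\<And>t. t \<in> I \<Longrightarrow> (N has_real_derivative a * N t) (at t)" for N
  proof (rule has_field_derivative_zero_constant)
    show "convex I" using I by (rule is_interval_convex)
    fix t assume t: "t \<in> I"
    have "(?W has_real_derivative a * ?W t) (at t)"
      using y1[OF t] y2[OF t] by (auto intro!: derivative_eq_intros simp: algebra_simps)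
    from DERIV_divide[OF N[OF t] this W[OF t]]
    show "((\<lambda>t. N t / ?W t) has_field_derivative 0) (at t within I)"
      by (auto intro: has_field_derivative_at_within)
  qed
  have "((\<lambda>t. w t * y2' t - w' t * y2 t) has_real_derivative a * (w t * y2' t - w' t * y2 t)) (at t)"
    "((\<lambda>t. y1 t * w' t - y1' t * w t) has_real_derivative a * (y1 t * w' t - y1' t * w t)) (at t)" if t: "t \<in> I" for t
    using y1[OF t] y2[OF t] w[OF t] by (auto intro!: derivative_eq_intros simp: algebra_simps)
  from const[OF this(1)] const[OF this(2)] obtain c1 c2
    where c1: "\<And>t. t \<in> I \<Longrightarrow> (w t * y2' t - w' t * y2 t) / ?W t = c1"
      and c2: "\<And>t. t \<in> I \<Longrightarrow> (y1 t * w' t - y1' t * w t) / ?W t = c2"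
    by auto
  have "w t = c1 * y1 t + c2 * y2 t" if t: "t \<in> I" for t
  proof -
    \<comment> \<open>Cramer's rule for the coefficients of \<open>w\<close> with respect to
      \<open>y1\<close> and \<open>y2\<close>.\<close>
    have "(w t * y2' t - w' t * y2 t) * y1 t + (y1 t * w' t - y1' t * w t) * y2 t
        = w t * (y1 t * y2' t - y1' t * y2 t)" by (simp add: algebra_simps)
    then show ?thesis
      unfolding c1[OF t, symmetric] c2[OF t, symmetric] using W[OF t]
      by (simp add: add_divide_distrib[symmetric])
  qed
  then show ?thesis by blast
qed

text \<open>Forward, the difference from the particular solution \<open>yp\<close> solves the
  homogeneous equation. Backward, the formula for \<open>v\<close> is given on \<open>I\<close>
  only; since \<open>I\<close> is open, uniqueness of derivatives transfers it to \<open>v'\<close>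
  and then to \<open>v''\<close>.\<close>

lemma inhomogeneous_ode_2_iff:
  fixes y1 y2 v yp :: "real \<Rightarrow> real"
  assumes I: "is_interval I" "open I"
    and y1: "\<And>t. (y1 has_real_derivative y1' t) (at t)" "\<And>t. (y1' has_real_derivative a * y1' t + b * y1 t) (at t)"
    and y2: "\<And>t. (y2 has_real_derivative y2' t) (at t)" "\<And>t. (y2' has_real_derivative a * y2' t + b * y2 t) (at t)"
    and W: "\<And>t. y1 t * y2' t - y1' t * y2 t \<noteq> 0"
    and yp: "\<And>t. (yp has_real_derivative yp' t) (at t)" "\<And>t. (yp' has_real_derivative a * yp' t + b * yp t + r) (at t)"
    and v: "\<And>t. t \<in> I \<Longrightarrow> (v has_real_derivative v' t) (at t)" "\<And>t. t \<in> I \<Longrightarrow> (v' has_real_derivative v'' t) (at t)"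
  shows "(\<forall>t\<in>I. v'' t = a * v' t + b * v t + r) \<longleftrightarrow> (\<exists>c1 c2. \<forall>t\<in>I. v t = c1 * y1 t + c2 * y2 t + yp t)"
proof
  assume ode: "\<forall>t\<in>I. v'' t = a * v' t + b * v t + r"
  have d: "((\<lambda>t. v t - yp t) has_real_derivative v' t - yp' t) (at t)"
    "((\<lambda>t. v' t - yp' t) has_real_derivative a * (v' t - yp' t) + b * (v t - yp t)) (at t)" if "t \<in> I" for t
    using ode that by (auto intro!: derivative_eq_intros v yp simp: algebra_simps)
  obtain c1 c2 where "\<forall>t\<in>I. v t - yp t = c1 * y1 t + c2 * y2 t"
    using linear_ode_2_solution[OF I(1) y1 y2 d W] by blast
  then show "\<exists>c1 c2. \<forall>t\<in>I. v t = c1 * y1 t + c2 * y2 t + yp t"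
    by (metis diff_eq_eq)
next
  assume "\<exists>c1 c2. \<forall>t\<in>I. v t = c1 * y1 t + c2 * y2 t + yp t"
  then obtain c1 c2 where eq: "\<And>t. t \<in> I \<Longrightarrow> v t = c1 * y1 t + c2 * y2 t + yp t" by blast
  have v': "v' t = c1 * y1' t + c2 * y2' t + yp' t" if t: "t \<in> I" for t
  proof (rule DERIV_unique[OF v(1)[OF t]])
    have "((\<lambda>t. c1 * y1 t + c2 * y2 t + yp t) has_real_derivative c1 * y1' t + c2 * y2' t + yp' t) (at t)"
      by (auto intro!: derivative_eq_intros y1 y2 yp)
    then show "(v has_real_derivative c1 * y1' t + c2 * y2' t + yp' t) (at t)"
      by (rule has_field_derivative_transform_within_open[OF _ I(2) t]) (simp add: eq)
  qed
  have v'': "v'' t = c1 * (a * y1' t + b * y1 t) + c2 * (a * y2' t + b * y2 t) + (a * yp' t + b * yp t + r)"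
    if t: "t \<in> I" for t
  proof (rule DERIV_unique[OF v(2)[OF t]])
    have "((\<lambda>t. c1 * y1' t + c2 * y2' t + yp' t) has_real_derivative
        c1 * (a * y1' t + b * y1 t) + c2 * (a * y2' t + b * y2 t) + (a * yp' t + b * yp t + r)) (at t)"
      by (auto intro!: derivative_eq_intros y1 y2 yp)
    then show "(v' has_real_derivative
        c1 * (a * y1' t + b * y1 t) + c2 * (a * y2' t + b * y2 t) + (a * yp' t + b * yp t + r)) (at t)"
      by (rule has_field_derivative_transform_within_open[OF _ I(2) t]) (simp add: v')
  qed
  show "\<forall>t\<in>I. v'' t = a * v' t + b * v t + r"
    by (simp add: v'' v' eq algebra_simps)
qed

section \<open>The solution formulas in the five cases\<close>

context
  fixes I :: "real set" and v v' v'' :: "real \<Rightarrow> real" and s q SF \<Delta> :: real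
  assumes I: "is_interval I" "open I"
    and v: "\<And>t. t \<in> I \<Longrightarrow> (v has_real_derivative v' t) (at t)" "\<And>t. t \<in> I \<Longrightarrow> (v' has_real_derivative v'' t) (at t)"
    and \<Delta>: "\<Delta> = 9/4 * s\<^sup>2 - 4/3 * q"
begin

text \<open>The curvature equation divided by 3, with \<open>q\<close> the coefficient of
  \<open>v\<close>. The characteristic polynomial is \<open>r\<^sup>2 - 3/2 * s * r + q / 3\<close>,
  and \<open>\<Delta>\<close> is its discriminant.\<close>

abbreviation (input) "warping_ode \<equiv> (\<forall>t\<in>I. v'' t = 3/2 * s * v' t + (- q / 3) * v t + SF / 3)"

text \<open>\<open>SF / q\<close> is a constant solution. The Wronskian of the two exponentials is
  \<open>(r2 - r1) * exp ((r1 + r2) * t)\<close>, which is nonzero because the roots differ.\<close>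

lemma warping_ode_real_roots:
  assumes "\<Delta> > 0" "q \<noteq> 0"
  shows "warping_ode \<longleftrightarrow> (\<exists>c1 c2. \<forall>t\<in>I. v t = c1 * exp (1/2 * (3/2 * s + sqrt \<Delta>) * t)
    + c2 * exp (1/2 * (3/2 * s - sqrt \<Delta>) * t) + SF / q)"
proof -
  define r1 r2 where "r1 = 1/2 * (3/2 * s + sqrt \<Delta>)" and "r2 = 1/2 * (3/2 * s - sqrt \<Delta>)"
  have sq: "sqrt \<Delta> * sqrt \<Delta> = 9/4 * s\<^sup>2 - 4/3 * q" using assms(1) \<Delta> by simp
  have r: "r1 * r1 = 3/2 * s * r1 + (- q / 3)" "r2 * r2 = 3/2 * s * r2 + (- q / 3)"
    using sq by (simp_all add: r1_def r2_def algebra_simps power2_eq_square)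
  have "r1 \<noteq> r2" using assms(1) by (simp add: r1_def r2_def)
  have e: "r * (r * exp (r * t)) = 3/2 * s * (r * exp (r * t)) + (- q / 3) * exp (r * t)"
    if "r * r = 3/2 * s * r + (- q / 3)" for r t
    using arg_cong[OF that, of "\<lambda>x. x * exp (r * t)"] by (simp add: algebra_simps)
  show ?thesis
    unfolding r1_def[symmetric] r2_def[symmetric]
    by (rule inhomogeneous_ode_2_iff[OF I, where y1'="\<lambda>t. r1 * exp (r1 * t)" and y2'="\<lambda>t. r2 * exp (r2 * t)" and yp'="\<lambda>_. 0"])
      (use v \<open>r1 \<noteq> r2\<close> assms(2) e[OF r(1)] e[OF r(2)] in \<open>auto intro!: derivative_eq_intros simp: mult.commute\<close>)
qed

text \<open>The Wronskian is the square of \<open>exp (3/4 * s * t)\<close>. A vanishing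
  discriminant expresses \<open>q\<close> through \<open>s\<close>.\<close>

lemma warping_ode_double_root:
  assumes "\<Delta> = 0" "q \<noteq> 0"
  shows "warping_ode \<longleftrightarrow> (\<exists>c1 c2. \<forall>t\<in>I. v t = c1 * exp (3/4 * s * t)
    + c2 * (t * exp (3/4 * s * t)) + SF / q)"
proof -
  have q: "q = 27/16 * s\<^sup>2" using assms(1) \<Delta> by simp
  show ?thesis
    by (rule inhomogeneous_ode_2_iff[OF I, where y1'="\<lambda>t. 3/4 * s * exp (3/4 * s * t)"
          and y2'="\<lambda>t. (1 + 3/4 * s * t) * exp (3/4 * s * t)" and yp'="\<lambda>_. 0"])
      (use v assms(2) in \<open>auto intro!: derivative_eq_intros simp: q power2_eq_square field_simps\<close>)
qed

lemma warping_ode_complex_roots: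
  assumes "\<Delta> < 0"
  shows "warping_ode \<longleftrightarrow> (\<exists>c1 c2. \<forall>t\<in>I. v t = c1 * (exp (3/4 * s * t) * cos (1/2 * sqrt (- \<Delta>) * t))
    + c2 * (exp (3/4 * s * t) * sin (1/2 * sqrt (- \<Delta>) * t)) + SF / q)"
proof -
  \<comment> \<open>Real and imaginary part of the characteristic roots. In these terms
    \<open>q\<close> is 3 times the squared modulus of a root, so the denominator in
    \<open>SF / q\<close> is positive.\<close>
  define \<alpha> \<omega> where "\<alpha> = 3/4 * s" and "\<omega> = 1/2 * sqrt (- \<Delta>)"
  have \<omega>: "\<omega> > 0" "\<omega> * \<omega> = - \<Delta> / 4" using assms by (simp_all add: \<omega>_def)
  have s: "s = 4/3 * \<alpha>" and q: "q = 3 * (\<alpha> * \<alpha> + \<omega> * \<omega>)"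
    using \<omega>(2) \<Delta> by (simp_all add: \<alpha>_def power2_eq_square)
  have "q > 0" using \<omega>(1) by (simp add: q add_nonneg_pos)
  \<comment> \<open>The Wronskian reduces to \<open>\<omega> * exp (2 * x)\<close> since the squares
    of sine and cosine add up to 1.\<close>
  have W: "exp x * cos y * (exp x * (\<alpha> * sin y + \<omega> * cos y)) - exp x * (\<alpha> * cos y - \<omega> * sin y) * (exp x * sin y) \<noteq> 0" for x y
  proof -
    have "e * c * (e * (\<alpha> * d + \<omega> * c)) - e * (\<alpha> * c - \<omega> * d) * (e * d) = e * e * \<omega> * (c\<^sup>2 + d\<^sup>2)" for c d e
      by (simp add: algebra_simps power2_eq_square)
    from this[of "exp x" "cos y" "sin y"]
    have "exp x * cos y * (exp x * (\<alpha> * sin y + \<omega> * cos y)) - exp x * (\<alpha> * cos y - \<omega> * sin y) * (exp x * sin y)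
        = exp x * exp x * \<omega>"
      by simp
    then show ?thesis using \<omega>(1) by simp
  qed
  show ?thesis
    unfolding \<alpha>_def[symmetric] \<omega>_def[symmetric]
    by (rule inhomogeneous_ode_2_iff[OF I, where y1'="\<lambda>t. exp (\<alpha> * t) * (\<alpha> * cos (\<omega> * t) - \<omega> * sin (\<omega> * t))"
          and y2'="\<lambda>t. exp (\<alpha> * t) * (\<alpha> * sin (\<omega> * t) + \<omega> * cos (\<omega> * t))" and yp'="\<lambda>_. 0"])
      (use v W \<open>q > 0\<close> in \<open>auto intro!: derivative_eq_intros simp: s, auto simp: q algebra_simps\<close>)
qed

text \<open>For \<open>q = 0\<close> constants solve the homogeneous equation, so the particular
  solution is taken linear in \<open>t\<close>; its slope \<open>- 2 * SF / (9 * s)\<close> makes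
  \<open>3/2 * s * v'\<close> cancel \<open>SF / 3\<close>.\<close>

lemma warping_ode_zero_root:
  assumes "q = 0" "s \<noteq> 0"
  shows "warping_ode \<longleftrightarrow> (\<exists>c1 c2. \<forall>t\<in>I. v t = c1 * 1 + c2 * exp (3/2 * s * t) + (- 2 * SF / (9 * s) * t))"
  by (rule inhomogeneous_ode_2_iff[OF I, where y1'="\<lambda>t. 0" and y2'="\<lambda>t. 3/2 * s * exp (3/2 * s * t)"
        and yp'="\<lambda>_. - 2 * SF / (9 * s)"])
    (use v assms in \<open>auto intro!: derivative_eq_intros simp: field_simps\<close>)

text \<open>The equation degenerates to \<open>v'' = SF / 3\<close>, which is integrated
  twice.\<close>

lemma warping_ode_double_zero_root:
  assumes "q = 0" "s = 0"
  shows "warping_ode \<longleftrightarrow> (\<exists>c1 c2. \<forall>t\<in>I. v t = c1 * t + c2 * 1 + SF / 6 * t\<^sup>2)"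
  by (rule inhomogeneous_ode_2_iff[OF I, where y1'="\<lambda>t. 1" and y2'="\<lambda>t. 0" and yp'="\<lambda>t. SF / 3 * t"])
    (use v assms in \<open>auto intro!: derivative_eq_intros simp: field_simps\<close>)

end

theorem theorem3p19:
  fixes I :: "real set" and f v :: "real \<Rightarrow> real"
    and F :: "('a::{t2_space, second_countable_topology}, 'e::euclidean_space) atlas"
    and gF :: "'a metric" and nablaF :: "'a connection"
    and M :: "(real \<times> 'a, real \<times> 'e) atlas"
    and g :: "(real \<times> 'a) metric" and nabla nabla_bar :: "(real \<times> 'a) connection"
    and l1 l2 S D :: real
  assumes "open I" and "is_interval I" and "I \<noteq> {}"
    and "smooth_manifold F" and "carrier F \<noteq> {}" and "DIM('e) = 3"
    and "pseudo_riemannian_metric F gF" and "levi_civita_connection F gF nablaF"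
    and "smooth_on I f" and "\<forall>t\<in>I. f t > 0"
    and "M = interval_times I F" and "g = warped_metric f gF"
    and "levi_civita_connection M g nabla"
    and "l1 \<noteq> 0" and "l2 \<noteq> 0"
    and "nabla_bar = quarter_symmetric_connection g (time_field I F) l1 l2 nabla"
    and "v = (\<lambda>t. (f t)\<^sup>2)"
    and "D = 9/4 * (l1 + l2)\<^sup>2 - 4/3 * S + 4 * l1\<^sup>2 + 4 * l2\<^sup>2 - 16 * l1 * l2"
  shows "has_constant_scalar_curvature M g nabla_bar S \<longleftrightarrow>
    (\<exists>SF. has_constant_scalar_curvature F gF nablaF SF \<and>
      (\<exists>c1 c2.
        (S < 27/16 * (l1 + l2)\<^sup>2 + 3 * l1\<^sup>2 + 3 * l2\<^sup>2 - 12 * l1 * l2 \<and>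
         S \<noteq> 3 * l1\<^sup>2 + 3 * l2\<^sup>2 - 12 * l1 * l2 \<and>
         (\<forall>t\<in>I. v t = c1 * exp (1/2 * (3/2 * (l1 + l2) + sqrt D) * t)
                    + c2 * exp (1/2 * (3/2 * (l1 + l2) - sqrt D) * t)
                    + SF / (12 * l1 * l2 - 3 * l1\<^sup>2 - 3 * l2\<^sup>2 + S)))
      \<or> (S = 27/16 * (l1 + l2)\<^sup>2 + 3 * l1\<^sup>2 + 3 * l2\<^sup>2 - 12 * l1 * l2 \<and>
         \<comment> \<open>the denominator below must not vanish, i.e. \<open>l1 + l2 \<noteq> 0\<close>\<close>
         S \<noteq> 3 * l1\<^sup>2 + 3 * l2\<^sup>2 - 12 * l1 * l2 \<and>
         (\<forall>t\<in>I. v t = c1 * exp (3/4 * (l1 + l2) * t)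
                    + c2 * t * exp (3/4 * (l1 + l2) * t)
                    + SF / (12 * l1 * l2 - 3 * l1\<^sup>2 - 3 * l2\<^sup>2 + S)))
      \<or> (S > 27/16 * (l1 + l2)\<^sup>2 + 3 * l1\<^sup>2 + 3 * l2\<^sup>2 - 12 * l1 * l2 \<and>
         (\<forall>t\<in>I. v t = c1 * exp (3/4 * (l1 + l2) * t) * cos (1/2 * sqrt (- D) * t)
                    + c2 * exp (3/4 * (l1 + l2) * t) * sin (1/2 * sqrt (- D) * t)
                    + SF / (12 * l1 * l2 - 3 * l1\<^sup>2 - 3 * l2\<^sup>2 + S)))
      \<or> (S = 3 * l1\<^sup>2 + 3 * l2\<^sup>2 - 12 * l1 * l2 \<and> l1 + l2 \<noteq> 0 \<and>
         (\<forall>t\<in>I. v t = c1 - 2 * SF / (9 * (l1 + l2)) * t + c2 * exp (3/2 * (l1 + l2) * t)))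
      \<or> (S = 3 * l1\<^sup>2 + 3 * l2\<^sup>2 - 12 * l1 * l2 \<and> l1 + l2 = 0 \<and>
         (\<forall>t\<in>I. v t = SF / 6 * t\<^sup>2 + c1 * t + c2))))"
proof -
  interpret W: warped_product F gF I f
    by unfold_locales (use assms in auto)
  interpret C: warped_product_connection F gF I f nablaF nabla l1 l2
    by unfold_locales (use assms in auto)
  define s K where "s = l1 + l2" and "K = 3 * l1\<^sup>2 + 3 * l2\<^sup>2 - 12 * l1 * l2"
  define q where "q = S - K"
  define v' v'' where "v' = (\<lambda>t. 2 * f t * C.f' t)" and "v'' = (\<lambda>t. 2 * (C.f' t)\<^sup>2 + 2 * f t * C.f'' t)"
  have v: "(v has_real_derivative v' t) (at t)" "(v' has_real_derivative v'' t) (at t)" if "t \<in> I" for t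
    unfolding \<open>v = _\<close> v'_def v''_def using C.f_deriv[OF that] C.f'_deriv[OF that]
    by (auto intro!: derivative_eq_intros simp: power2_eq_square algebra_simps)
  have D: "D = 9/4 * s\<^sup>2 - 4/3 * q" by (simp add: \<open>D = _\<close> s_def q_def K_def algebra_simps)
  define ode where "ode SF \<longleftrightarrow> (\<forall>t\<in>I. v'' t = 3/2 * s * v' t + (- q / 3) * v t + SF / 3)" for SF
  have scal: "scalar_curvature M g nabla_bar (t, x) = S \<longleftrightarrow>
      v'' t = 3/2 * s * v' t + (- q / 3) * v t + scalar_curvature F gF nablaF x / 3"
    if t: "t \<in> I" and x: "x \<in> carrier F" for t x
  proof -
    \<comment> \<open>Multiplication by \<open>v t > 0\<close> is reversible and produces the
      left-hand side of \<open>scalar_curvature_M_3\<close>.\<close>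
    have "scalar_curvature M g nabla_bar (t, x) = S \<longleftrightarrow> scalar_curvature M g nabla_bar (t, x) * v t = S * v t"
      using W.f_pos[OF t] by (simp add: \<open>v = _\<close>)
    also have "scalar_curvature M g nabla_bar (t, x) * v t =
        scalar_curvature F gF nablaF x - 3 * v'' t + 9/2 * s * v' t + K * v t"
      using C.scalar_curvature_M_3[OF t x assms(6)]
      by (simp add: assms(11,12,16,17) v'_def v''_def s_def K_def)
    finally show ?thesis
      unfolding q_def by (simp add: field_simps) argo
  qed
  have M: "carrier M = I \<times> carrier F" unfolding assms(11) by (rule W.carrier_M)
  have const: "has_constant_scalar_curvature M g nabla_bar S \<longleftrightarrow>
      (\<exists>SF. has_constant_scalar_curvature F gF nablaF SF \<and> ode SF)"
  proof
    assume *: "has_constant_scalar_curvature M g nabla_bar S"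
    have eq: "v'' t = 3/2 * s * v' t + (- q / 3) * v t + scalar_curvature F gF nablaF x / 3"
      if "t \<in> I" "x \<in> carrier F" for t x
      using * scal[OF that] that by (auto simp: has_constant_scalar_curvature_def M)
    obtain t where t: "t \<in> I" using assms(3) by auto
    obtain x where x: "x \<in> carrier F" using assms(5) by auto
    have "scalar_curvature F gF nablaF y = scalar_curvature F gF nablaF x" if "y \<in> carrier F" for y
      using eq[OF t x] eq[OF t that] by simp
    then show "\<exists>SF. has_constant_scalar_curvature F gF nablaF SF \<and> ode SF"
      using eq[OF _ x] unfolding has_constant_scalar_curvature_def ode_def by blast
  next
    assume "\<exists>SF. has_constant_scalar_curvature F gF nablaF SF \<and> ode SF"
    then show "has_constant_scalar_curvature M g nabla_bar S"
      using scal by (auto simp: has_constant_scalar_curvature_def M ode_def)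
  qed
  \<comment> \<open>As a function of \<open>S\<close>, \<open>D\<close> is decreasing with zero at
    \<open>K + 27/16 * s\<^sup>2\<close>, where \<open>27/16\<close> is \<open>3/4\<close> of
    \<open>9/4\<close>; so the conditions on \<open>S\<close> are conditions on the signs of
    \<open>D\<close> and \<open>q\<close>.\<close>
  have cond: "S < 27/16 * s\<^sup>2 + 3 * l1\<^sup>2 + 3 * l2\<^sup>2 - 12 * l1 * l2 \<longleftrightarrow> D > 0"
    "S = 27/16 * s\<^sup>2 + 3 * l1\<^sup>2 + 3 * l2\<^sup>2 - 12 * l1 * l2 \<longleftrightarrow> D = 0"
    "S > 27/16 * s\<^sup>2 + 3 * l1\<^sup>2 + 3 * l2\<^sup>2 - 12 * l1 * l2 \<longleftrightarrow> D < 0"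
    "S = 3 * l1\<^sup>2 + 3 * l2\<^sup>2 - 12 * l1 * l2 \<longleftrightarrow> q = 0"
    by (auto simp: D q_def K_def field_simps)
  have den: "12 * l1 * l2 - 3 * l1\<^sup>2 - 3 * l2\<^sup>2 + S = q" by (simp add: q_def K_def)
  \<comment> \<open>The products are reassociated to match the left-nested form
    \<open>c2 * t * exp (3/4 * s * t)\<close> of the claim.\<close>
  note sol = warping_ode_real_roots warping_ode_double_root[unfolded mult.assoc[symmetric]]
    warping_ode_complex_roots[unfolded mult.assoc[symmetric]]
  note sol = sol[OF assms(2,1) v D, folded ode_def]
  note sol0 = warping_ode_zero_root[OF assms(2,1) v D, folded ode_def]
    warping_ode_double_zero_root[OF assms(2,1) v D, folded ode_def]
  show ?thesis
    unfolding const s_def[symmetric] cond den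
  proof (intro arg_cong[where f=Ex] ext conj_cong refl)
    fix SF
    \<comment> \<open>Each alternative leaves exactly one of the five disjuncts possible. For
      \<open>q = 0\<close> the sign of \<open>D = 9/4 * s\<^sup>2\<close> is decided by
      \<open>s\<close>.\<close>
    consider "D > 0" "q \<noteq> 0" | "D = 0" "q \<noteq> 0" | "D < 0" "q \<noteq> 0" | "q = 0" "s \<noteq> 0" | "q = 0" "s = 0"
      using D by (metis linorder_neqE_linordered_idom)
    then show "ode SF = (\<exists>c1 c2.
        (0 < D \<and> q \<noteq> 0 \<and> (\<forall>t\<in>I. v t = c1 * exp (1/2 * (3/2 * s + sqrt D) * t)
                  + c2 * exp (1/2 * (3/2 * s - sqrt D) * t) + SF / q))
      \<or> (D = 0 \<and> q \<noteq> 0 \<and> (\<forall>t\<in>I. v t = c1 * exp (3/4 * s * t) + c2 * t * exp (3/4 * s * t) + SF / q))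
      \<or> (D < 0 \<and> (\<forall>t\<in>I. v t = c1 * exp (3/4 * s * t) * cos (1/2 * sqrt (- D) * t)
                  + c2 * exp (3/4 * s * t) * sin (1/2 * sqrt (- D) * t) + SF / q))
      \<or> (q = 0 \<and> s \<noteq> 0 \<and> (\<forall>t\<in>I. v t = c1 - 2 * SF / (9 * s) * t + c2 * exp (3/2 * s * t)))
      \<or> (q = 0 \<and> s = 0 \<and> (\<forall>t\<in>I. v t = SF / 6 * t\<^sup>2 + c1 * t + c2)))"
    proof cases
      case 1
      then show ?thesis by (simp add: sol(1)[OF _ _ 1])
    next
      case 2
      then show ?thesis by (simp add: sol(2)[OF _ _ 2])
    next
      case 3
      then show ?thesis by (simp add: sol(3)[OF _ _ 3(1)])
    next
      case 4
      \<comment> \<open>Excludes the second and third disjunct; the first is excluded by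
        \<open>q = 0\<close>.\<close>
      then have "D > 0" by (simp add: D)
      with 4 show ?thesis by (simp add: sol0(1)[OF _ _ 4] algebra_simps)
    next
      case 5
      \<comment> \<open>The zero discriminant also occurs here, but the second disjunct demands
        \<open>q \<noteq> 0\<close>, so only the quadratic formula remains.\<close>
      then have "D = 0" by (simp add: D)
      with 5 show ?thesis by (simp add: sol0(2)[OF _ _ 5] algebra_simps)
    qed
  qed
qed

end
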